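(* For all $\varepsilon < O(1)$, $2^{-\Omega(n)}\le\delta\le 1/n^{1+\Omega(1)}$, sufficiently small constant $\alpha$, and any symmetric convex body $K\subseteq B_2^m$, if $\ell^*(K)=\Omega(\sqrt{m})$, then \[ \mathrm{sc}_{\varepsilon,\delta}(K,\alpha) = \Theta\left(\frac{\sqrt{m\log(1/\delta)}}{\alpha\varepsilon}\right), \] and $\mathrm{sc}_{\varepsilon,\delta}(K,\alpha)$ is achieved, up to constants, by the Gaussian mechanism, i.e. the algorithm that on input $\mathcal{D}$ outputs $\overline{\mathcal{D}}+\frac1n w$ with $w\sim N(0,\sigma(\varepsilon,\delta)^2 I_m)$, where $\sigma(\varepsilon,\delta)=(0.5\sqrt{\varepsilon}+\sqrt{2\log(1/\delta)})/\varepsilon$ and $n$ is the size of $\mathcal{D}$.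
   Context: Mean point problem over a closed convex set $K\subseteq\mathbb{R}^m$: a database of size $n$ is a multiset $\mathcal{D}=\{x_1,\dots,x_n\}$ of points of $K$; neighboring databases have symmetric difference (with multiplicity) of size at most $1$; $\overline{\mathcal{D}}=\frac1n\sum_i x_i$. $\mathcal{A}$ is $(\varepsilon,\delta)$-differentially private if for all neighboring $\mathcal{D},\mathcal{D}'$ and measurable $S$, $\Pr[\mathcal{A}(\mathcal{D})\in S]\le e^\varepsilon\Pr[\mathcal{A}(\mathcal{D}')\in S]+\delta$. $\mathrm{err}(K,\mathcal{A},n)=\sup_{\mathcal{D}}(\mathbb{E}\|\mathcal{A}(\mathcal{D})-\overline{\mathcal{D}}\|_2^2)^{1/2}$ over databases of at most $n$ points of $K$; $\mathrm{samp}(K,\mathcal{A},\alpha)=\min\{n:\mathrm{err}(K,\mathcal{A},n)\le\alpha\}$; $\mathrm{sc}_{\varepsilon,\delta}(K,\alpha)=\min$ of $\mathrm{samp}(K,\mathcal{A},\alpha)$ over $(\varepsilon,\delta)$-differentially private $\mathcal{A}$. $B_2^m$ is the Euclidean unit ball; a convex body is compact convex with nonempty interior; symmetric means $K=-K$. $\ell^*(K)=\mathbb{E}\max_{x\in K}\langle x,g\rangle$, $g\sim N(0,I_m)$. In the asymptotic hypotheses, $n$ is the database size and implicit constants are absolute.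
   Formalization: Here err is over databases of exactly n points; n = sc is at least 2; the lower end of the range of δ is 2^{-Ω(αεn)}; and privacy is claimed for the Gaussian mechanism that divides by a fixed public n, as the literal versions fail. *)

theory Defs
  imports "HOL-Probability.Probability" "HOL-Library.Multiset" "HOL-Library.Extended_Nat"
begin

text \<open>
  The constants in the theorem are uniform in the dimension \<open>m\<close>, so \<open>m\<close> has to be a number and not
  a type. \<open>\<real>\<^sup>m\<close> is the library space \<^const>\<open>Euclidean_space\<close> \<open>m\<close>: functions \<open>nat \<Rightarrow> real\<close> that vanish
  at all indices \<open>i \<ge> m\<close>, with the topology of pointwise convergence.
\<close>

abbreviation Rn :: "nat \<Rightarrow> (nat \<Rightarrow> real) set" where
  "Rn m \<equiv> topspace (Euclidean_space m)"

definition inner_Rn :: "nat \<Rightarrow> (nat \<Rightarrow> real) \<Rightarrow> (nat \<Rightarrow> real) \<Rightarrow> real" where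
  "inner_Rn m x y = (\<Sum>i<m. x i * y i)"

definition unit_ball :: "nat \<Rightarrow> (nat \<Rightarrow> real) set" where
  "unit_ball m = {x \<in> Rn m. L2_set x {..<m} \<le> 1}"

definition convex_Rn :: "(nat \<Rightarrow> real) set \<Rightarrow> bool" where
  "convex_Rn K \<longleftrightarrow>
     (\<forall>x\<in>K. \<forall>y\<in>K. \<forall>t. 0 \<le> t \<and> t \<le> 1 \<longrightarrow> (\<lambda>i. (1 - t) * x i + t * y i) \<in> K)"

definition convex_body :: "nat \<Rightarrow> (nat \<Rightarrow> real) set \<Rightarrow> bool" where
  "convex_body m K \<longleftrightarrow>
     compactin (Euclidean_space m) K \<and> convex_Rn K \<and> Euclidean_space m interior_of K \<noteq> {}"

definition symmetric_set :: "(nat \<Rightarrow> real) set \<Rightarrow> bool" where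
  "symmetric_set K \<longleftrightarrow> K = (\<lambda>x i. - x i) ` K"

definition borel_Rn :: "nat \<Rightarrow> (nat \<Rightarrow> real) measure" where
  "borel_Rn m = restrict_space borel (Rn m)"

text \<open>\<open>gaussian m s\<close> is \<open>N(0, s\<^sup>2 I\<^sub>m)\<close>, for \<open>s > 0\<close>. The product measure lives on functions
  that are \<open>undefined\<close> outside \<open>{..<m}\<close>, whence the extension by zero.\<close>

definition gaussian :: "nat \<Rightarrow> real \<Rightarrow> (nat \<Rightarrow> real) measure" where
  "gaussian m s =
     distr (\<Pi>\<^sub>M i\<in>{..<m}. density lborel (\<lambda>t. ennreal (normal_density 0 s t))) (borel_Rn m)
       (\<lambda>x i. if i < m then x i else 0)"

text \<open>The supremum is a maximum for nonempty compact \<open>K\<close>, and it is integrable in \<open>g\<close>.\<close>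

definition lstar :: "nat \<Rightarrow> (nat \<Rightarrow> real) set \<Rightarrow> real" where
  "lstar m K = (\<integral>g. (SUP x\<in>K. inner_Rn m x g) \<partial>gaussian m 1)"

type_synonym database = "(nat \<Rightarrow> real) multiset"

definition databases :: "(nat \<Rightarrow> real) set \<Rightarrow> database set" where
  "databases K = {D. set_mset D \<subseteq> K}"

definition neighboring :: "database \<Rightarrow> database \<Rightarrow> bool" where
  "neighboring D D' \<longleftrightarrow> size (D - D') + size (D' - D) \<le> 1"

definition db_mean :: "database \<Rightarrow> nat \<Rightarrow> real" where
  "db_mean D = (\<lambda>i. (\<Sum>x\<in>#D. x i) / real (size D))"

text \<open>A randomized algorithm is represented by its output distributions.\<close>

type_synonym algorithm = "database \<Rightarrow> (nat \<Rightarrow> real) measure"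

definition is_algorithm :: "nat \<Rightarrow> (nat \<Rightarrow> real) set \<Rightarrow> algorithm \<Rightarrow> bool" where
  "is_algorithm m K A \<longleftrightarrow>
     (\<forall>D\<in>databases K. prob_space (A D) \<and> sets (A D) = sets (borel_Rn m))"

definition diff_private ::
    "nat \<Rightarrow> (nat \<Rightarrow> real) set \<Rightarrow> real \<Rightarrow> real \<Rightarrow> algorithm \<Rightarrow> bool" where
  "diff_private m K \<epsilon> \<delta> A \<longleftrightarrow> is_algorithm m K A \<and>
     (\<forall>D\<in>databases K. \<forall>D'\<in>databases K. neighboring D D' \<longrightarrow>
        (\<forall>S\<in>sets (borel_Rn m). measure (A D) S \<le> exp \<epsilon> * measure (A D') S + \<delta>))"

definition ennreal_sqrt :: "ennreal \<Rightarrow> ennreal" where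
  "ennreal_sqrt v = (if v = \<infinity> then \<infinity> else ennreal (sqrt (enn2real v)))"

text \<open>
  The supremum runs over the databases of size exactly \<open>n\<close>. A supremum over all nonempty databases
  of size at most \<open>n\<close> would be nondecreasing in \<open>n\<close> and would include the databases with a single
  point, on which no private algorithm is accurate; no \<open>n\<close> would then reach a small error.
\<close>

definition err :: "nat \<Rightarrow> (nat \<Rightarrow> real) set \<Rightarrow> algorithm \<Rightarrow> nat \<Rightarrow> ennreal" where
  "err m K A n =
     (SUP D \<in> {D \<in> databases K. size D = n}.
        ennreal_sqrt (\<integral>\<^sup>+y. ennreal ((L2_set (\<lambda>i. y i - db_mean D i) {..<m})\<^sup>2) \<partial>A D))"

text \<open>Minima of possibly empty sets of sample sizes: the value is \<open>\<infinity>\<close> if there is none. The mean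
  of the empty database is not defined, hence \<open>n \<ge> 1\<close>.\<close>

definition samp :: "nat \<Rightarrow> (nat \<Rightarrow> real) set \<Rightarrow> algorithm \<Rightarrow> real \<Rightarrow> enat" where
  "samp m K A \<alpha> = Inf {enat n |n. 1 \<le> n \<and> err m K A n \<le> ennreal \<alpha>}"

definition sample_complexity ::
    "nat \<Rightarrow> (nat \<Rightarrow> real) set \<Rightarrow> real \<Rightarrow> real \<Rightarrow> real \<Rightarrow> enat" where
  "sample_complexity m K \<epsilon> \<delta> \<alpha> = (INF A \<in> {A. diff_private m K \<epsilon> \<delta> A}. samp m K A \<alpha>)"

text \<open>
  The range \<open>2 powr (- \<Omega>(n)) \<le> \<delta> \<le> 1 / n powr (1 + \<Omega>(1))\<close> at database size \<open>n\<close>, with \<open>c\<^sub>e\<close> and \<open>c\<^sub>d\<close> the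
  constants behind the two \<open>\<Omega>\<close>. The constant in the exponent is scaled by \<open>\<alpha> * \<epsilon>\<close>: noise with
  density proportional to \<open>exp (- \<epsilon> * norm z)\<close>, added to the sum of the points, is private with
  \<open>\<delta> = 0\<close>, so the sample complexity \<open>n\<close> is always \<open>O(m / (\<alpha> * \<epsilon>))\<close>. Hence
  \<open>n = \<Theta>(sqrt (m * ln (1 / \<delta>)) / (\<alpha> * \<epsilon>))\<close> already implies \<open>ln (1 / \<delta>) = O(\<alpha> * \<epsilon> * n)\<close>, and with
  an unscaled absolute constant the lower bound would fail as \<open>\<epsilon>\<close> tends to \<open>0\<close>. The case \<open>n = 1\<close>
  is left out because the upper bound on \<open>\<delta>\<close> is then void (it even admits \<open>\<delta> = 1\<close>).
\<close>

definition delta_range :: "real \<Rightarrow> real \<Rightarrow> real \<Rightarrow> real \<Rightarrow> nat \<Rightarrow> real \<Rightarrow> bool" where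
  "delta_range c\<^sub>e c\<^sub>d \<epsilon> \<alpha> n \<delta> \<longleftrightarrow>
     2 \<le> n \<and> 2 powr (- (c\<^sub>e * (\<alpha> * \<epsilon>) * real n)) \<le> \<delta> \<and> \<delta> \<le> 1 / real n powr (1 + c\<^sub>d)"

definition noise_level :: "real \<Rightarrow> real \<Rightarrow> real" where
  "noise_level \<epsilon> \<delta> = (0.5 * sqrt \<epsilon> + sqrt (2 * ln (1 / \<delta>))) / \<epsilon>"

definition gaussian_mechanism :: "nat \<Rightarrow> real \<Rightarrow> algorithm" where
  "gaussian_mechanism m s D =
     distr (gaussian m s) (borel_Rn m) (\<lambda>w i. db_mean D i + 1 / real (size D) * w i)"

text \<open>
  Neighboring databases have different sizes, and for them the mechanism above uses different noise
  variances, which distinguishes the sizes if \<open>m\<close> is large. It is private when the nominal size \<open>n\<close>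
  is public, that is, when the sum of the points and the noise are both divided by a fixed \<open>n\<close>.
  On databases of size \<open>n\<close> the two mechanisms coincide.
\<close>

definition gaussian_mechanism_public :: "nat \<Rightarrow> real \<Rightarrow> nat \<Rightarrow> algorithm" where
  "gaussian_mechanism_public m s n D =
     distr (gaussian m s) (borel_Rn m) (\<lambda>w i. (\<Sum>x\<in>#D. x i) / real n + 1 / real n * w i)"

lemma gaussian_mechanism_public_eq:
  "size D = n \<Longrightarrow> gaussian_mechanism_public m s n D = gaussian_mechanism m s D"
  by (auto simp: gaussian_mechanism_public_def gaussian_mechanism_def db_mean_def)

end

theory Submission
  imports Defs "HOL-Real_Asymp.Real_Asymp"
begin

text \<open>
  The upper bound is the usual analysis of Gaussian noise: by the translation formula for the
  Gaussian measure the privacy loss between neighbours is Gaussian, and its tail is bounded by an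
  exponential moment.

  The lower bound is a fingerprinting argument carried out directly on \<open>K\<close>, without passing to
  nearly Euclidean projections of \<open>K\<close>. Let \<open>G, g\<^sub>1, \<dots>, g\<^sub>q\<close> be independent standard Gaussian
  vectors and let the database consist of \<open>k\<close> copies of each \<open>u (G + g\<^sub>j)\<close>, where \<open>u y\<close> maximises
  \<open>\<langle>x, y\<rangle>\<close> over a finite net of \<open>K\<close>, padded with zeros to size \<open>n\<close>. The sums \<open>G + g\<^sub>j\<close> are
  independent of \<open>G - (g\<^sub>1 + \<dots> + g\<^sub>q)\<close>, so an output \<open>Y\<close> satisfies
  \<open>E \<langle>Y, G\<rangle> = E \<langle>Y, g\<^sub>1\<rangle> + \<dots> + E \<langle>Y, g\<^sub>q\<rangle>\<close>. If \<open>Y\<close> is close to the mean, the left-hand side is at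
  least of order \<open>(k * q / n) * \<ell>\<^sup>*(K)\<close>. If \<open>Y\<close> is private, removing the \<open>k\<close> copies of the \<open>j\<close>-th
  point costs a factor \<open>exp (k * \<epsilon>)\<close> and makes \<open>\<langle>Y, g\<^sub>j\<rangle>\<close> a centred Gaussian of standard deviation
  \<open>O(k * q / n)\<close>, so \<open>E \<langle>Y, g\<^sub>j\<rangle>\<close> is at most of order \<open>(k * q / n) * sqrt (k * \<epsilon>)\<close>. Hence
  \<open>\<ell>\<^sup>*(K) = O(q * sqrt (k * \<epsilon>))\<close>, and the choices \<open>k \<approx> ln (1 / \<delta>) / \<epsilon>\<close> and \<open>q \<approx> \<alpha> * n / k\<close> give
  the claim.
\<close>

section \<open>Translates of Gaussian product measures\<close>

text \<open>The index type is arbitrary so that one product serves both for a single noise vector,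
  indexed by coordinates, and for a whole Gaussian matrix, indexed by pairs of row and
  column.\<close>

definition normals :: "real \<Rightarrow> 'i set \<Rightarrow> ('i \<Rightarrow> real) measure" where
  "normals s I = (\<Pi>\<^sub>M i\<in>I. density lborel (\<lambda>t. ennreal (normal_density 0 s t)))"

lemma sets_normals [measurable_cong]: "sets (normals s I) = sets (\<Pi>\<^sub>M i\<in>I. borel)"
  unfolding normals_def by (intro sets_PiM_cong) auto

lemma space_normals: "space (normals s I) = (\<Pi>\<^sub>E i\<in>I. UNIV)"
  by (simp add: normals_def space_PiM)

lemma prob_space_normals: "0 < s \<Longrightarrow> prob_space (normals s I)"
  unfolding normals_def by (intro prob_space_PiM prob_space_normal_density)

text \<open>Both sides are the normal law with mean \<open>v\<close>: on the right by completing the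
  square in the exponent, on the left by substitution in the Lebesgue integral.\<close>

lemma distr_normal_shift:
  assumes "0 < s"
  shows "distr (density lborel (\<lambda>t. ennreal (normal_density 0 s t))) borel (\<lambda>t. t + v) =
    density (density lborel (\<lambda>t. ennreal (normal_density 0 s t)))
      (\<lambda>t. ennreal (exp (v * t / s\<^sup>2 - v\<^sup>2 / (2 * s\<^sup>2))))"
proof -
  have "density (density lborel (\<lambda>t. ennreal (normal_density 0 s t)))
      (\<lambda>t. ennreal (exp (v * t / s\<^sup>2 - v\<^sup>2 / (2 * s\<^sup>2)))) = density lborel (\<lambda>t. ennreal (normal_density v s t))"
  proof (subst density_density_eq, simp, simp, intro density_cong AE_I2)
    fix t
    have "-(t\<^sup>2) / (2 * s\<^sup>2) + (v * t / s\<^sup>2 - v\<^sup>2 / (2 * s\<^sup>2)) = -((t - v)\<^sup>2) / (2 * s\<^sup>2)"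
      using assms by (simp add: field_simps power2_eq_square)
    then have "normal_density 0 s t * exp (v * t / s\<^sup>2 - v\<^sup>2 / (2 * s\<^sup>2)) = normal_density v s t"
      unfolding normal_density_def by (simp add: exp_add[symmetric])
    then show "ennreal (normal_density 0 s t) * ennreal (exp (v * t / s\<^sup>2 - v\<^sup>2 / (2 * s\<^sup>2))) =
        ennreal (normal_density v s t)"
      by (simp flip: ennreal_mult)
  qed auto
  moreover have "distr (density lborel (\<lambda>t. ennreal (normal_density 0 s t))) borel (\<lambda>t. t + v) =
      density lborel (\<lambda>t. ennreal (normal_density v s t))"
  proof (rule measure_eqI)
    fix A assume "A \<in> sets (distr (density lborel (\<lambda>t. ennreal (normal_density 0 s t))) borel (\<lambda>t. t + v))"
    then have [measurable]: "A \<in> sets borel" by simp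
    have "emeasure (density lborel (\<lambda>t. ennreal (normal_density v s t))) A =
       (\<integral>\<^sup>+t. ennreal (normal_density v s t) * indicator A t \<partial>lborel)"
      by (simp add: emeasure_density)
    also have "\<dots> = (\<integral>\<^sup>+t. ennreal (normal_density v s (v + 1 * t)) * indicator A (v + 1 * t) \<partial>lborel)"
      by (subst nn_integral_real_affine[where c = 1 and t = v]) auto
    also have "\<dots> = (\<integral>\<^sup>+t. ennreal (normal_density 0 s t) * indicator ((\<lambda>t. t + v) -` A) t \<partial>lborel)"
      by (intro nn_integral_cong) (auto simp: normal_density_def indicator_def add.commute)
    also have "\<dots> = emeasure (distr (density lborel (\<lambda>t. ennreal (normal_density 0 s t))) borel (\<lambda>t. t + v)) A"
      using measurable_sets_borel[of "\<lambda>t. t + v" borel A]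
      by (subst emeasure_distr) (auto simp: emeasure_density)
    finally show "emeasure (distr (density lborel (\<lambda>t. ennreal (normal_density 0 s t))) borel (\<lambda>t. t + v)) A =
        emeasure (density lborel (\<lambda>t. ennreal (normal_density v s t))) A" by simp
  qed auto
  ultimately show ?thesis by simp
qed

text \<open>The translate and the reweighted measure agree on boxes, where both factor into the
  one-dimensional case because the exponential of a sum is a product; boxes determine a finite
  product measure.\<close>

lemma distr_normals_shift:
  fixes v :: "'i \<Rightarrow> real"
  assumes s: "0 < s" and I: "finite I"
  shows "distr (normals s I) (\<Pi>\<^sub>M i\<in>I. borel) (\<lambda>x. \<lambda>i\<in>I. x i + v i) =
    density (normals s I)
      (\<lambda>x. ennreal (exp ((\<Sum>i\<in>I. v i * x i) / s\<^sup>2 - (\<Sum>i\<in>I. (v i)\<^sup>2) / (2 * s\<^sup>2))))"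
    (is "?L = ?R")
proof -
  let ?N = "density lborel (\<lambda>t. ennreal (normal_density 0 s t))"
  let ?w = "\<lambda>i t. ennreal (exp (v i * t / s\<^sup>2 - (v i)\<^sup>2 / (2 * s\<^sup>2)))"
  interpret N: prob_space ?N by (rule prob_space_normal_density[OF s])
  interpret P: product_sigma_finite "\<lambda>_. ?N" by standard
  have pd: "prob_space (distr ?N borel (\<lambda>t. t + v i))" for i
    by (rule N.prob_space_distr) simp
  interpret D: product_prob_space "\<lambda>i. distr ?N borel (\<lambda>t. t + v i)"
    by (intro product_prob_spaceI pd)
  have sh: "(\<lambda>x. \<lambda>i\<in>I. x i + v i) \<in> measurable (normals s I) (\<Pi>\<^sub>M i\<in>I. borel)"
    by measurable
  have 1: "?L = PiM I (\<lambda>i. distr ?N borel (\<lambda>t. t + v i))"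
  proof (rule D.PiM_eqI[OF I])
    show "sets ?L = sets (PiM I (\<lambda>i. distr ?N borel (\<lambda>t. t + v i)))"
      by (auto intro!: sets_PiM_cong)
    fix A assume "\<And>i. i \<in> I \<Longrightarrow> A i \<in> sets (distr ?N borel (\<lambda>t. t + v i))"
    then have A: "A i \<in> sets borel" if "i \<in> I" for i using that by simp
    have A': "(\<lambda>t. t + v i) -` A i \<in> sets borel" if "i \<in> I" for i
      using A[OF that] measurable_sets_borel[of "\<lambda>t. t + v i" borel "A i"] by simp
    have "emeasure ?L (PiE I A) =
        emeasure (normals s I) ((\<lambda>x. \<lambda>i\<in>I. x i + v i) -` (PiE I A) \<inter> space (normals s I))"
      using A I by (intro emeasure_distr[OF sh]) (auto intro!: sets_PiM_I_finite)
    also have "(\<lambda>x. \<lambda>i\<in>I. x i + v i) -` (PiE I A) \<inter> space (normals s I) =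
        PiE I (\<lambda>i. (\<lambda>t. t + v i) -` A i)"
      by (auto simp: space_normals PiE_def Pi_def extensional_def)
    also have "emeasure (normals s I) \<dots> = (\<Prod>i\<in>I. emeasure ?N ((\<lambda>t. t + v i) -` A i))"
      unfolding normals_def using A' I by (intro P.emeasure_PiM) auto
    also have "\<dots> = (\<Prod>i\<in>I. emeasure (distr ?N borel (\<lambda>t. t + v i)) (A i))"
      using A by (intro prod.cong) (auto simp: emeasure_distr)
    finally show "emeasure ?L (PiE I A) = \<dots>" .
  qed
  have w: "ennreal (exp ((\<Sum>i\<in>I. v i * x i) / s\<^sup>2 - (\<Sum>i\<in>I. (v i)\<^sup>2) / (2 * s\<^sup>2))) = (\<Prod>i\<in>I. ?w i (x i))" for x
    using I by (simp add: prod_ennreal exp_sum[symmetric] sum_subtractf sum_divide_distrib)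
  have 2: "?R = PiM I (\<lambda>i. distr ?N borel (\<lambda>t. t + v i))"
  proof (rule D.PiM_eqI[OF I])
    show "sets ?R = sets (PiM I (\<lambda>i. distr ?N borel (\<lambda>t. t + v i)))"
      by (auto simp: sets_normals intro!: sets_PiM_cong)
    fix A assume "\<And>i. i \<in> I \<Longrightarrow> A i \<in> sets (distr ?N borel (\<lambda>t. t + v i))"
    then have A[measurable]: "A i \<in> sets borel" if "i \<in> I" for i using that by simp
    have *: "PiE I A \<in> sets (normals s I)"
      using A I by (auto simp: sets_normals intro!: sets_PiM_I_finite)
    have "emeasure ?R (PiE I A) = (\<integral>\<^sup>+x. (\<Prod>i\<in>I. ?w i (x i)) * indicator (PiE I A) x \<partial>normals s I)"
      unfolding w by (rule emeasure_density) (use * in measurable)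
    also have "\<dots> = (\<integral>\<^sup>+x. (\<Prod>i\<in>I. ?w i (x i) * indicator (A i) (x i)) \<partial>normals s I)"
    proof (rule nn_integral_cong)
      fix x assume "x \<in> space (normals s I)"
      \<comment> \<open>Points of the space are \<open>undefined\<close> outside \<open>I\<close>,
        so membership in the box is a condition on the coordinates in \<open>I\<close>
        alone.\<close>
      then have "indicator (PiE I A) x = (\<Prod>i\<in>I. indicator (A i) (x i) :: ennreal)"
        using I by (auto simp: space_normals PiE_def indicator_def prod_zero_iff intro!: prod.neutral)
      then show "(\<Prod>i\<in>I. ?w i (x i)) * indicator (PiE I A) x = (\<Prod>i\<in>I. ?w i (x i) * indicator (A i) (x i))"
        by (simp add: prod.distrib)
    qed
    also have "\<dots> = (\<Prod>i\<in>I. \<integral>\<^sup>+t. ?w i t * indicator (A i) t \<partial>?N)"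
      unfolding normals_def using I by (intro P.product_nn_integral_prod) (auto, measurable)
    also have "\<dots> = (\<Prod>i\<in>I. emeasure (density ?N (?w i)) (A i))"
      by (intro prod.cong refl) (simp add: emeasure_density A)
    also have "\<dots> = (\<Prod>i\<in>I. emeasure (distr ?N borel (\<lambda>t. t + v i)) (A i))"
      by (simp add: distr_normal_shift[OF s])
    finally show "emeasure ?R (PiE I A) = \<dots>" .
  qed
  show ?thesis using 1 2 by simp
qed

text \<open>No Gaussian integral has to be computed: the translate by \<open>s\<^sup>2 * v\<close>
  has total mass 1, and writing this mass with the density from the translation formula gives the
  claim up to the constant factor \<open>exp (- ?c)\<close>.\<close>

lemma nn_integral_normals_exp:
  assumes s: "0 < s" and I: "finite I"
  shows "(\<integral>\<^sup>+x. ennreal (exp (\<Sum>i\<in>I. v i * x i)) \<partial>normals s I) = ennreal (exp (s\<^sup>2 * (\<Sum>i\<in>I. (v i)\<^sup>2) / 2))"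
proof -
  interpret N: prob_space "normals s I" by (rule prob_space_normals[OF s])
  let ?v = "\<lambda>i. s\<^sup>2 * v i"
  let ?c = "s\<^sup>2 * (\<Sum>i\<in>I. (v i)\<^sup>2) / 2"
  have "(\<lambda>x. \<lambda>i\<in>I. x i + ?v i) \<in> measurable (normals s I) (\<Pi>\<^sub>M i\<in>I. borel)"
    by measurable
  then have "emeasure (distr (normals s I) (\<Pi>\<^sub>M i\<in>I. borel) (\<lambda>x. \<lambda>i\<in>I. x i + ?v i))
      (space (distr (normals s I) (\<Pi>\<^sub>M i\<in>I. borel) (\<lambda>x. \<lambda>i\<in>I. x i + ?v i))) = 1"
    by (intro prob_space.emeasure_space_1 N.prob_space_distr)
  then have "(\<integral>\<^sup>+x. ennreal (exp ((\<Sum>i\<in>I. ?v i * x i) / s\<^sup>2 - (\<Sum>i\<in>I. (?v i)\<^sup>2) / (2 * s\<^sup>2))) \<partial>normals s I) = 1"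
    unfolding distr_normals_shift[OF s I]
    by (subst (asm) emeasure_density) (auto cong: nn_integral_cong)
  moreover have "(\<Sum>i\<in>I. ?v i * x i) / s\<^sup>2 - (\<Sum>i\<in>I. (?v i)\<^sup>2) / (2 * s\<^sup>2) = (\<Sum>i\<in>I. v i * x i) - ?c" for x
  proof -
    have "(\<Sum>i\<in>I. ?v i * x i) = s\<^sup>2 * (\<Sum>i\<in>I. v i * x i)"
      by (simp add: sum_distrib_left mult.assoc)
    moreover have "(\<Sum>i\<in>I. (?v i)\<^sup>2) = s\<^sup>2 * s\<^sup>2 * (\<Sum>i\<in>I. (v i)\<^sup>2)"
      by (simp add: sum_distrib_left power_mult_distrib power2_eq_square mult_ac)
    ultimately show ?thesis using s by (simp add: field_simps power2_eq_square power4_eq_xxxx)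
  qed
  ultimately have "(\<integral>\<^sup>+x. ennreal (exp (- ?c)) * ennreal (exp (\<Sum>i\<in>I. v i * x i)) \<partial>normals s I) = 1"
    by (simp add: ennreal_mult[symmetric] exp_add[symmetric] add.commute)
  then have "ennreal (exp (- ?c)) * (\<integral>\<^sup>+x. ennreal (exp (\<Sum>i\<in>I. v i * x i)) \<partial>normals s I) = 1"
    by (subst (asm) nn_integral_cmult) auto
  then have "ennreal (exp ?c) * (ennreal (exp (- ?c)) * (\<integral>\<^sup>+x. ennreal (exp (\<Sum>i\<in>I. v i * x i)) \<partial>normals s I)) = ennreal (exp ?c)"
    by simp
  then show ?thesis
    by (simp add: mult.assoc[symmetric] ennreal_mult[symmetric] exp_minus)
qed

lemma integrable_normals_exp:
  assumes "0 < s" "finite I"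
  shows "integrable (normals s I) (\<lambda>x. exp (\<Sum>i\<in>I. v i * x i))"
  by (rule integrableI_nonneg) (auto simp: nn_integral_normals_exp[OF assms])

lemma integral_normals_shift:
  fixes f :: "_ \<Rightarrow> real"
  assumes I: "finite I" and [measurable]: "f \<in> borel_measurable (normals 1 I)"
  shows "(\<integral>x. f (\<lambda>i\<in>I. x i + v i) \<partial>normals 1 I) =
    (\<integral>x. exp ((\<Sum>i\<in>I. v i * x i) - (\<Sum>i\<in>I. (v i)\<^sup>2) / 2) * f x \<partial>normals 1 I)"
proof -
  have [measurable]: "f \<in> borel_measurable (\<Pi>\<^sub>M i\<in>I. borel)"
    using assms(2) by (simp add: measurable_cong_sets[OF sets_normals refl])
  have "(\<integral>x. f (\<lambda>i\<in>I. x i + v i) \<partial>normals 1 I) =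
      integral\<^sup>L (distr (normals 1 I) (\<Pi>\<^sub>M i\<in>I. borel) (\<lambda>x. \<lambda>i\<in>I. x i + v i)) f"
    by (subst integral_distr) auto
  also have "\<dots> = (\<integral>x. exp ((\<Sum>i\<in>I. v i * x i) - (\<Sum>i\<in>I. (v i)\<^sup>2) / 2) * f x \<partial>normals 1 I)"
    by (subst distr_normals_shift[OF zero_less_one I], subst integral_density) (auto simp: field_simps)
  finally show ?thesis .
qed

text \<open>A majorant, uniform in \<open>n\<close>, of the difference quotients of the exponential
  function at 0. It consists of exponentials of \<open>X\<close>, which are Gaussian integrable, so
  it serves for dominated convergence.\<close>

lemma exp_secant_bound:
  fixes X :: real
  assumes "1 \<le> (n::nat)"
  shows "\<bar>real n * (exp (X / real n) - 1)\<bar> \<le> exp (2 * X) + exp (- (2 * X))"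
proof -
  have h: "\<bar>exp y - 1\<bar> \<le> \<bar>y\<bar> * exp \<bar>y\<bar>" for y :: real
  proof (cases "y \<ge> 0")
    case True
    have "1 - y \<le> exp (- y)" using exp_ge_add_one_self[of "- y"] by simp
    then have "(1 - y) * exp y \<le> exp (- y) * exp y" by (intro mult_right_mono) auto
    then show ?thesis using True by (simp add: exp_minus algebra_simps)
  next
    case False
    have "1 + y \<le> exp y" by (rule exp_ge_add_one_self)
    moreover have "(- y) * 1 \<le> (- y) * exp (- y)" using False by (intro mult_left_mono) auto
    moreover have "exp y \<le> 1" using False by simp
    moreover have "\<bar>exp y - 1\<bar> = 1 - exp y" "\<bar>y\<bar> = - y" using False by auto
    ultimately show ?thesis unfolding \<open>\<bar>y\<bar> = - y\<close> by linarith
  qed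
  have n: "real n > 0" using assms by simp
  have "\<bar>real n * (exp (X / real n) - 1)\<bar> = real n * \<bar>exp (X / real n) - 1\<bar>"
    by (simp add: abs_mult)
  also have "\<dots> \<le> real n * (\<bar>X / real n\<bar> * exp \<bar>X / real n\<bar>)"
    by (intro mult_left_mono h) simp
  also have "\<dots> = \<bar>X\<bar> * exp \<bar>X / real n\<bar>" using n by simp
  also have "\<dots> \<le> exp \<bar>X\<bar> * exp \<bar>X\<bar>"
  proof (intro mult_mono)
    show "\<bar>X\<bar> \<le> exp \<bar>X\<bar>" using exp_ge_add_one_self[of "\<bar>X\<bar>"] by linarith
    have "\<bar>X / real n\<bar> \<le> \<bar>X\<bar>" using n assms by (simp add: abs_divide divide_le_eq mult_le_cancel_left1)
    then show "exp \<bar>X / real n\<bar> \<le> exp \<bar>X\<bar>" by simp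
  qed auto
  also have "\<dots> = exp (2 * \<bar>X\<bar>)" by (simp flip: exp_add)
  also have "\<dots> \<le> exp (2 * X) + exp (- (2 * X))"
    by (cases "X \<ge> 0") (auto simp: abs_if)
  finally show ?thesis .
qed

text \<open>Differentiate the translation formula along \<open>v\<close> at the origin.\<close>

lemma integral_normals_shift_invariant:
  fixes F :: "('i \<Rightarrow> real) \<Rightarrow> real"
  assumes I: "finite I" and [measurable]: "F \<in> borel_measurable (normals 1 I)"
    and B: "\<And>x. \<bar>F x\<bar> \<le> B"
    and inv: "\<And>x t. x \<in> space (normals 1 I) \<Longrightarrow> F (\<lambda>i\<in>I. x i + t * v i) = F x"
  shows "(\<integral>x. F x * (\<Sum>i\<in>I. v i * x i) \<partial>normals 1 I) = 0"
proof -
  interpret N: prob_space "normals 1 I" by (rule prob_space_normals) simp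
  define X where "X x = (\<Sum>i\<in>I. v i * x i)" for x
  have [measurable]: "X \<in> borel_measurable (normals 1 I)" unfolding X_def by measurable
  define c where "c = (\<Sum>i\<in>I. (v i)\<^sup>2) / 2"
  have iX: "integrable (normals 1 I) (\<lambda>x. exp (t * X x))" for t
    using integrable_normals_exp[OF zero_less_one I, of "\<lambda>i. t * v i"]
    by (simp add: X_def sum_distrib_left mult.assoc)
  have B0: "0 \<le> B" using B[of undefined] by linarith
  have iF: "integrable (normals 1 I) F"
    by (rule N.integrable_const_bound[where B = B]) (auto simp: B)
  have iFX: "integrable (normals 1 I) (\<lambda>x. F x * exp (t * X x))" for t
  proof (rule Bochner_Integration.integrable_bound)
    show "integrable (normals 1 I) (\<lambda>x. B * exp (t * X x))" using iX by simp
    show "AE x in normals 1 I. norm (F x * exp (t * X x)) \<le> norm (B * exp (t * X x))"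
      using B B0 by (auto simp: abs_mult intro!: mult_right_mono)
  qed measurable
  \<comment> \<open>Invariance of \<open>F\<close> turns the translation formula into an identity
    for exponential moments weighted by \<open>F\<close>, valid for all \<open>t\<close>; the claim
    is its derivative at \<open>t = 0\<close>.\<close>
  have eq: "(\<integral>x. F x * exp (t * X x) \<partial>normals 1 I) = exp (t\<^sup>2 * c) * (\<integral>x. F x \<partial>normals 1 I)" for t
  proof -
    have "(\<integral>x. F x \<partial>normals 1 I) = (\<integral>x. F (\<lambda>i\<in>I. x i + t * v i) \<partial>normals 1 I)"
      by (intro Bochner_Integration.integral_cong) (auto simp: inv)
    also have "\<dots> = (\<integral>x. exp (t * X x - t\<^sup>2 * c) * F x \<partial>normals 1 I)"
      by (subst integral_normals_shift[OF I])
        (auto simp: X_def c_def sum_distrib_left power_mult_distrib mult.assoc sum_divide_distrib)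
    also have "\<dots> = (\<integral>x. exp (- t\<^sup>2 * c) * (F x * exp (t * X x)) \<partial>normals 1 I)"
      by (intro Bochner_Integration.integral_cong) (auto simp: exp_diff exp_minus field_simps)
    finally have "(\<integral>x. F x \<partial>normals 1 I) = exp (- t\<^sup>2 * c) * (\<integral>x. F x * exp (t * X x) \<partial>normals 1 I)"
      by simp
    then show ?thesis by (simp add: mult.assoc[symmetric] exp_minus)
  qed
  let ?s = "\<lambda>n x. F x * (real (Suc n) * (exp (X x / real (Suc n)) - 1))"
  have lim: "(\<lambda>n. \<integral>x. ?s n x \<partial>normals 1 I) \<longlonglongrightarrow> (\<integral>x. F x * X x \<partial>normals 1 I)"
  proof (rule integral_dominated_convergence)
    show "integrable (normals 1 I) (\<lambda>x. B * (exp (2 * X x) + exp (- (2 * X x))))"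
      using iX[of 2] iX[of "-2"] by simp
    show "AE x in normals 1 I. (\<lambda>n. ?s n x) \<longlonglongrightarrow> F x * X x"
    proof (intro AE_I2 tendsto_mult tendsto_const)
      fix x
      have "(\<lambda>n. real (Suc n) * (exp (y / real (Suc n)) - 1)) \<longlonglongrightarrow> y" for y :: real
        by real_asymp
      then show "(\<lambda>n. real (Suc n) * (exp (X x / real (Suc n)) - 1)) \<longlonglongrightarrow> X x" .
    qed
    show "AE x in normals 1 I. norm (?s n x) \<le> B * (exp (2 * X x) + exp (- (2 * X x)))" for n
      using B exp_secant_bound[of "Suc n"] unfolding real_norm_def abs_mult
      by (intro AE_I2 mult_mono) (auto simp: abs_mult B0)
  qed measurable
  have "(\<integral>x. ?s n x \<partial>normals 1 I) =
      real (Suc n) * (exp ((1 / real (Suc n))\<^sup>2 * c) - 1) * (\<integral>x. F x \<partial>normals 1 I)" for n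
  proof -
    have "(\<integral>x. ?s n x \<partial>normals 1 I) =
        (\<integral>x. real (Suc n) * (F x * exp (1 / real (Suc n) * X x)) - real (Suc n) * F x \<partial>normals 1 I)"
      by (intro Bochner_Integration.integral_cong) (auto simp: algebra_simps)
    also have "\<dots> = real (Suc n) * (\<integral>x. F x * exp (1 / real (Suc n) * X x) \<partial>normals 1 I) -
        real (Suc n) * (\<integral>x. F x \<partial>normals 1 I)"
      by (subst Bochner_Integration.integral_diff)
        (use iF iFX[of "1 / real (Suc n)"] in \<open>auto simp del: of_nat_Suc\<close>)
    finally show ?thesis unfolding eq by (simp add: algebra_simps)
  qed
  \<comment> \<open>On the right-hand side the exponent is quadratic in \<open>t\<close>, so the
    derivative at 0 vanishes.\<close>
  moreover have "(\<lambda>n. real (Suc n) * (exp ((1 / real (Suc n))\<^sup>2 * c) - 1) * e) \<longlonglongrightarrow> 0" for e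
    by real_asymp
  ultimately have "(\<lambda>n. \<integral>x. ?s n x \<partial>normals 1 I) \<longlonglongrightarrow> 0" by simp
  with lim show ?thesis unfolding X_def[symmetric] by (rule LIMSEQ_unique)
qed

lemma integrable_normals_moments:
  assumes "finite I" "i \<in> I" "0 < s"
  shows "integrable (normals s I) (\<lambda>x. x i)" "integrable (normals s I) (\<lambda>x. (x i)\<^sup>2)"
    "(\<integral>x. (x i)\<^sup>2 \<partial>normals s I) = s\<^sup>2"
proof -
  let ?N = "density lborel (\<lambda>t. ennreal (normal_density 0 s t))"
  have d: "distr (normals s I) ?N (\<lambda>x. x i) = ?N"
    unfolding normals_def by (intro distr_PiM_component assms prob_space_normal_density)
  have m: "(\<lambda>x. x i) \<in> measurable (normals s I) ?N"
    using assms unfolding normals_def by measurable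
  have 1: "integrable ?N (\<lambda>t. t)"
    using integrable_normal_moment[OF assms(3), of 0 1] by (simp add: integrable_density)
  have 2: "integrable ?N (\<lambda>t. t\<^sup>2)"
    using integrable_normal_moment[OF assms(3), of 0 2] by (simp add: integrable_density)
  have 3: "(\<integral>t. t\<^sup>2 \<partial>?N) = s\<^sup>2"
    using integral_normal_moment_even[OF assms(3), of 0 1] by (simp add: integral_density)
  show "integrable (normals s I) (\<lambda>x. x i)"
    by (rule integrable_distr[OF m]) (simp only: d 1)
  show "integrable (normals s I) (\<lambda>x. (x i)\<^sup>2)"
    by (rule integrable_distr[OF m]) (simp only: d 2)
  have "(\<integral>t. t\<^sup>2 \<partial>distr (normals s I) ?N (\<lambda>x. x i)) = (\<integral>x. (x i)\<^sup>2 \<partial>normals s I)"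
    by (rule integral_distr[OF m]) simp
  then show "(\<integral>x. (x i)\<^sup>2 \<partial>normals s I) = s\<^sup>2"
    unfolding d 3 by (rule sym)
qed

section \<open>The Gaussian mechanism\<close>

text \<open>The privacy loss of a shift of length at most 1 is Gaussian with mean at most
  \<open>1 / (2 * s\<^sup>2)\<close>, so \<open>t\<close> is the margin left below \<epsilon>. Where
  the loss is at most \<epsilon>, the translated measure pays for \<open>S\<close>; the remaining
  event is a Gaussian tail.\<close>

lemma gaussian_tail_shift:
  assumes s: "0 < s" and I: "finite I" and d: "(\<Sum>i\<in>I. (d i)\<^sup>2) \<le> 1"
    and t: "0 \<le> t" "t = \<epsilon> - 1 / (2 * s\<^sup>2)"
    and S: "S \<in> sets (\<Pi>\<^sub>M i\<in>I. borel)"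
  shows "emeasure (normals s I) S \<le> ennreal (exp \<epsilon>) *
     emeasure (normals s I) ((\<lambda>x. \<lambda>i\<in>I. x i + d i) -` S \<inter> space (normals s I)) + ennreal (exp (- (s\<^sup>2 * t\<^sup>2) / 2))"
proof -
  define X where "X x = (\<Sum>i\<in>I. d i * x i)" for x :: "'a \<Rightarrow> real"
  define D where "D = (\<Sum>i\<in>I. (d i)\<^sup>2)"
  define w where "w x = exp (X x / s\<^sup>2 - D / (2 * s\<^sup>2))" for x
  have [measurable]: "S \<in> sets (normals s I)" using S by (simp add: sets_normals)
  have [measurable]: "X \<in> borel_measurable (normals s I)" unfolding X_def by measurable
  have [measurable]: "w \<in> borel_measurable (normals s I)" unfolding w_def by measurable
  have D1: "D \<le> 1" using d by (simp add: D_def)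
  have eps: "\<epsilon> * s\<^sup>2 - 1/2 = s\<^sup>2 * t" using s by (simp add: t field_simps)
  \<comment> \<open>A pointwise Chernoff bound with parameter \<open>t\<close>: if the density ratio
    \<open>w x\<close> is below \<open>exp (- \<epsilon>)\<close>, then \<open>- X x\<close> is at
    least \<open>s\<^sup>2 * t\<close> and the second summand is at least 1.\<close>
  have pt: "indicator S x \<le> exp \<epsilon> * (w x * indicator S x) + exp (- (t * (s\<^sup>2 * t))) * exp (- t * X x)" for x
  proof (cases "exp \<epsilon> * w x \<ge> 1")
    case True
    then have "indicator S x \<le> exp \<epsilon> * w x * indicator S x"
      by (auto simp: indicator_def)
    then show ?thesis by (simp add: add_increasing2 mult.assoc)
  next
    case False
    then have "exp (\<epsilon> + (X x / s\<^sup>2 - D / (2 * s\<^sup>2))) < exp 0" unfolding w_def exp_add by simp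
    then have "\<epsilon> + (X x / s\<^sup>2 - D / (2 * s\<^sup>2)) < 0" by (simp only: exp_less_cancel_iff)
    then have "(\<epsilon> + (X x / s\<^sup>2 - D / (2 * s\<^sup>2))) * s\<^sup>2 < 0 * s\<^sup>2"
      using s by (intro mult_strict_right_mono) auto
    moreover have "(\<epsilon> + (X x / s\<^sup>2 - D / (2 * s\<^sup>2))) * s\<^sup>2 = \<epsilon> * s\<^sup>2 + X x - D / 2"
      using s by (simp add: distrib_right left_diff_distrib)
    ultimately have "\<epsilon> * s\<^sup>2 + X x - D / 2 < 0" by simp
    then have "s\<^sup>2 * t \<le> - X x" using D1 eps by linarith
    then have "t * (s\<^sup>2 * t) \<le> t * (- X x)" using t(1) by (rule mult_left_mono)
    then have "1 \<le> exp (- (t * (s\<^sup>2 * t)) + - t * X x)" by simp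
    then have "1 \<le> exp (- (t * (s\<^sup>2 * t))) * exp (- t * X x)" unfolding exp_add .
    moreover have "0 \<le> exp \<epsilon> * (w x * indicator S x)" by (simp add: w_def)
    moreover have "indicator S x \<le> (1 :: real)" by (simp add: indicator_def)
    ultimately show ?thesis by linarith
  qed
  have "emeasure (normals s I) S = (\<integral>\<^sup>+x. ennreal (indicator S x) \<partial>normals s I)"
    by (simp add: ennreal_indicator)
  also have "\<dots> \<le> (\<integral>\<^sup>+x. ennreal (exp \<epsilon>) * (ennreal (w x) * indicator S x) +
        ennreal (exp (- (t * (s\<^sup>2 * t)))) * ennreal (exp (- t * X x)) \<partial>normals s I)"
  proof (rule nn_integral_mono)
    fix x
    have "ennreal (indicator S x) \<le> ennreal (exp \<epsilon> * (w x * indicator S x) + exp (- (t * (s\<^sup>2 * t))) * exp (- t * X x))"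
      by (rule ennreal_leI[OF pt])
    also have "\<dots> = ennreal (exp \<epsilon>) * (ennreal (w x) * indicator S x) +
        ennreal (exp (- (t * (s\<^sup>2 * t)))) * ennreal (exp (- t * X x))"
      by (simp add: ennreal_plus ennreal_mult ennreal_indicator w_def)
    finally show "ennreal (indicator S x) \<le> \<dots>" .
  qed
  also have "\<dots> = ennreal (exp \<epsilon>) * (\<integral>\<^sup>+x. ennreal (w x) * indicator S x \<partial>normals s I) +
        ennreal (exp (- (t * (s\<^sup>2 * t)))) * (\<integral>\<^sup>+x. ennreal (exp (- t * X x)) \<partial>normals s I)"
    by (simp add: nn_integral_add nn_integral_cmult)
  also have "(\<integral>\<^sup>+x. ennreal (w x) * indicator S x \<partial>normals s I) =
      emeasure (density (normals s I) w) S"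
    by (simp add: emeasure_density)
  also have "\<dots> = emeasure (distr (normals s I) (\<Pi>\<^sub>M i\<in>I. borel) (\<lambda>x. \<lambda>i\<in>I. x i + d i)) S"
    unfolding distr_normals_shift[OF s I] w_def X_def D_def ..
  also have "\<dots> = emeasure (normals s I) ((\<lambda>x. \<lambda>i\<in>I. x i + d i) -` S \<inter> space (normals s I))"
    using S by (intro emeasure_distr) measurable
  also have "(\<integral>\<^sup>+x. ennreal (exp (- t * X x)) \<partial>normals s I) = ennreal (exp (s\<^sup>2 * (t\<^sup>2 * D) / 2))"
    using nn_integral_normals_exp[OF s I, of "\<lambda>i. - t * d i"]
    by (simp add: X_def D_def sum_distrib_left mult.assoc power_mult_distrib sum_negf)
  also have "ennreal (exp (- (t * (s\<^sup>2 * t)))) * \<dots> = ennreal (exp (- (s\<^sup>2 * t\<^sup>2) + s\<^sup>2 * (t\<^sup>2 * D) / 2))"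
    by (simp add: ennreal_mult[symmetric] exp_add[symmetric] power2_eq_square mult_ac)
  finally have "emeasure (normals s I) S \<le> ennreal (exp \<epsilon>) *
      emeasure (normals s I) ((\<lambda>x. \<lambda>i\<in>I. x i + d i) -` S \<inter> space (normals s I)) +
      ennreal (exp (- (s\<^sup>2 * t\<^sup>2) + s\<^sup>2 * (t\<^sup>2 * D) / 2))" .
  also have "\<dots> \<le> ennreal (exp \<epsilon>) *
      emeasure (normals s I) ((\<lambda>x. \<lambda>i\<in>I. x i + d i) -` S \<inter> space (normals s I)) +
      ennreal (exp (- (s\<^sup>2 * t\<^sup>2) / 2))"
  proof (intro add_left_mono ennreal_leI)
    have "(s\<^sup>2 * t\<^sup>2) * D \<le> (s\<^sup>2 * t\<^sup>2) * 1" using D1 by (intro mult_left_mono) auto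
    then show "exp (- (s\<^sup>2 * t\<^sup>2) + s\<^sup>2 * (t\<^sup>2 * D) / 2) \<le> exp (- (s\<^sup>2 * t\<^sup>2) / 2)" by simp
  qed
  finally show ?thesis .
qed

text \<open>The summand \<open>0.5 * sqrt \<epsilon>\<close> of \<open>noise_level\<close> pays for
  the mean of the privacy loss: since \<open>sqrt \<epsilon> * s\<close> is at least 1,
  \<open>1 / (2 * s)\<close> is at most \<open>sqrt \<epsilon> / 2\<close>. What remains is that
  \<open>s * t\<close> is at least \<open>sqrt (2 * ln (1 / \<delta>))\<close>, exactly what the
  tail bound needs.\<close>

lemma noise_level_bound:
  assumes "0 < \<epsilon>" "\<epsilon> \<le> 1" "0 < \<delta>" "\<delta> \<le> 1/2"
  defines "s \<equiv> noise_level \<epsilon> \<delta>" and "t \<equiv> \<epsilon> - 1 / (2 * (noise_level \<epsilon> \<delta>)\<^sup>2)"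
  shows "0 < s" "0 \<le> t" "exp (- (s\<^sup>2 * t\<^sup>2) / 2) \<le> \<delta>"
proof -
  define r where "r = sqrt (2 * ln (1 / \<delta>))"
  have "ln 2 \<le> ln (1 / \<delta>)" using assms by (intro ln_mono) (auto simp: field_simps)
  then have l: "1 \<le> 2 * ln (1 / \<delta>)" using ln2_ge_two_thirds by linarith
  then have r: "1 \<le> r" by (simp add: r_def)
  have se: "0 < sqrt \<epsilon>" "sqrt \<epsilon> \<le> 1" "sqrt \<epsilon> * sqrt \<epsilon> = \<epsilon>" using assms by auto
  have es: "\<epsilon> * s = sqrt \<epsilon> / 2 + r" using assms by (simp add: s_def noise_level_def r_def)
  then have "0 < \<epsilon> * s" using se r by linarith
  then show s: "0 < s" using assms by (simp add: zero_less_mult_iff)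
  have "sqrt \<epsilon> * (sqrt \<epsilon> * s) = sqrt \<epsilon> / 2 + r" using es se(3) by (simp flip: mult.assoc)
  then have "sqrt \<epsilon> * 1 \<le> sqrt \<epsilon> * (sqrt \<epsilon> * s)" using r se(2) by linarith
  then have 1: "1 \<le> sqrt \<epsilon> * s" using se by simp
  have "1 / (2 * s) \<le> sqrt \<epsilon> / 2" using 1 s by (simp add: field_simps)
  then have st: "r \<le> \<epsilon> * s - 1 / (2 * s)" using es by linarith
  have eq: "s * t = \<epsilon> * s - 1 / (2 * s)" using s by (simp add: t_def s_def field_simps power2_eq_square)
  have "0 \<le> s * t" using st r eq by linarith
  then show "0 \<le> t" using s by (simp add: zero_le_mult_iff)
  have "r\<^sup>2 \<le> (s * t)\<^sup>2" using st r unfolding eq by (intro power_mono) auto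
  moreover have "r\<^sup>2 = 2 * ln (1 / \<delta>)" using l by (simp add: r_def)
  ultimately have "- (s\<^sup>2 * t\<^sup>2) / 2 \<le> ln \<delta>" using assms by (simp add: power_mult_distrib ln_div)
  then show "exp (- (s\<^sup>2 * t\<^sup>2) / 2) \<le> \<delta>" using assms by (metis exp_le_cancel_iff exp_ln)
qed

section \<open>Privacy of the mechanism with public size\<close>

lemma Rn_iff: "x \<in> Rn m \<longleftrightarrow> (\<forall>i\<ge>m. x i = 0)"
  by (auto simp: topspace_Euclidean_space)

lemma measurable_borel_RnI:
  assumes "\<And>i. (\<lambda>x. f x i) \<in> borel_measurable M" "\<And>x i. x \<in> space M \<Longrightarrow> m \<le> i \<Longrightarrow> f x i = 0"
  shows "f \<in> measurable M (borel_Rn m)"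
  unfolding borel_Rn_def
  by (intro measurable_restrict_space2 measurable_coordinatewise_then_product)
    (use assms in \<open>auto simp: Rn_iff\<close>)

lemma measurable_coordinate_borel_Rn: "(\<lambda>y. y i) \<in> borel_measurable (borel_Rn m)"
  unfolding borel_Rn_def by (intro measurable_restrict_space1 measurable_product_coordinates)

lemma space_borel_Rn: "space (borel_Rn m) = Rn m"
  by (simp add: borel_Rn_def space_restrict_space)

text \<open>Writes the mechanism as a direct image of the product measure \<open>normals\<close>, to
  which the translation formula applies; the detour over \<open>gaussian\<close> and its extension
  by zero is composed away.\<close>

lemma gaussian_mechanism_public_distr:
  assumes "K \<subseteq> Rn m" "D \<in> databases K"
  shows "gaussian_mechanism_public m s n D = distr (normals s {..<m}) (borel_Rn m)
    (\<lambda>w i. ((\<Sum>x\<in>#D. x i) + (if i < m then w i else 0)) / real n)"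
    and "(\<lambda>w i. ((\<Sum>x\<in>#D. x i) + (if i < m then w i else 0)) / real n) \<in>
      measurable (normals s {..<m}) (borel_Rn m)"
proof -
  have z: "(\<Sum>x\<in>#D. x i) = 0" if "m \<le> i" for i
  proof -
    have "image_mset (\<lambda>x. x i) D = image_mset (\<lambda>_. 0) D"
      using assms that by (intro image_mset_cong) (auto simp: databases_def Rn_iff subset_iff)
    then show ?thesis by simp
  qed
  have c: "(\<lambda>w. if i < m then w i else 0) \<in> borel_measurable (normals s {..<m})" for i
    by (cases "i < m") auto
  then show 1: "(\<lambda>w i. ((\<Sum>x\<in>#D. x i) + (if i < m then w i else 0)) / real n) \<in>
      measurable (normals s {..<m}) (borel_Rn m)"
    by (intro measurable_borel_RnI) (auto simp: z)
  have 2: "(\<lambda>w i. if i < m then w i else 0) \<in> measurable (normals s {..<m}) (borel_Rn m)"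
    by (intro measurable_borel_RnI c) auto
  have 3: "(\<lambda>w i. (\<Sum>x\<in>#D. x i) / real n + 1 / real n * w i) \<in> measurable (borel_Rn m) (borel_Rn m)"
    by (intro measurable_borel_RnI borel_measurable_add borel_measurable_times measurable_coordinate_borel_Rn)
      (auto simp: z space_borel_Rn Rn_iff)
  show "gaussian_mechanism_public m s n D = distr (normals s {..<m}) (borel_Rn m)
    (\<lambda>w i. ((\<Sum>x\<in>#D. x i) + (if i < m then w i else 0)) / real n)"
    unfolding gaussian_mechanism_public_def gaussian_def normals_def[symmetric]
    by (subst distr_distr[OF 3 2]) (auto simp: comp_def add_divide_distrib intro!: distr_cong)
qed

lemma neighboring_cases:
  assumes "neighboring D D'"
  obtains "D = D'" | x where "D = add_mset x D'" | x where "D' = add_mset x D"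
proof -
  have 1: "D \<inter># D' + (D - D') = D" "D \<inter># D' + (D' - D) = D'"
    by (simp_all add: multiset_eq_iff min_def)
  show ?thesis
  proof (cases "size (D - D') = 0")
    case True
    then have e: "D - D' = {#}" by simp
    have "size (D' - D) = 0 \<or> size (D' - D) = 1" using assms unfolding neighboring_def by linarith
    then show ?thesis
    proof
      assume "size (D' - D) = 0" then show ?thesis using 1 e that by simp
    next
      assume "size (D' - D) = 1"
      then obtain x where "D' - D = {#x#}" using size_1_singleton_mset by blast
      then show ?thesis using 1 e that(3)[of x] by (metis add.right_neutral add_mset_add_single)
    qed
  next
    case False
    then have a: "size (D - D') = 1" "size (D' - D) = 0" using assms unfolding neighboring_def by linarith+
    then obtain x where "D - D' = {#x#}" using size_1_singleton_mset by blast
    then show ?thesis using 1 a that(2)[of x] by (metis add.right_neutral add_mset_add_single size_eq_0_iff_empty)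
  qed
qed

lemma unit_ball_sum_squares: "x \<in> unit_ball m \<Longrightarrow> (\<Sum>i<m. (x i)\<^sup>2) \<le> 1"
  by (auto simp: unit_ball_def L2_set_def)

lemma unit_ball_Rn: "unit_ball m \<subseteq> Rn m"
  by (auto simp: unit_ball_def)

text \<open>The sum has sensitivity 1: a neighbour gains or loses at most one point of the unit
  ball.\<close>

lemma neighboring_sums:
  assumes "K \<subseteq> unit_ball m" "D \<in> databases K" "D' \<in> databases K" "neighboring D D'"
  obtains d where "\<And>i. (\<Sum>x\<in>#D'. x i) = (\<Sum>x\<in>#D. x i) + (d i :: real)" "(\<Sum>i<m. (d i)\<^sup>2) \<le> 1"
    "\<And>i. m \<le> i \<Longrightarrow> d i = 0"
  using assms(4)
proof (cases rule: neighboring_cases)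
  case 1
  then show ?thesis using that[of "\<lambda>_. 0"] by simp
next
  case (2 x)
  then have x: "x \<in> unit_ball m" using assms by (auto simp: databases_def)
  then show ?thesis
    using 2 unit_ball_Rn[of m] by (intro that[of "\<lambda>i. - x i"]) (auto simp: Rn_iff unit_ball_sum_squares[OF x])
next
  case (3 x)
  then have x: "x \<in> unit_ball m" using assms by (auto simp: databases_def)
  then show ?thesis
    using 3 unit_ball_Rn[of m] by (intro that[of x]) (auto simp: Rn_iff unit_ball_sum_squares[OF x])
qed

text \<open>Moving the sum by \<open>d\<close> is the same as moving the noise by \<open>d\<close>,
  because both are divided by the same \<open>n\<close>. Privacy thus compares the Gaussian measure
  with a translate by a vector of length at most 1.\<close>

lemma gaussian_mechanism_public_private:
  assumes K: "K \<subseteq> unit_ball m" and e: "0 < \<epsilon>" "\<epsilon> \<le> 1" "0 < \<delta>" "\<delta> \<le> 1/2"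
  shows "diff_private m K \<epsilon> \<delta> (gaussian_mechanism_public m (noise_level \<epsilon> \<delta>) n)"
proof -
  define s where "s = noise_level \<epsilon> \<delta>"
  define t where "t = \<epsilon> - 1 / (2 * s\<^sup>2)"
  note nb = noise_level_bound[OF e, folded s_def, folded t_def]
  interpret N: prob_space "normals s {..<m}" by (rule prob_space_normals[OF nb(1)])
  have KR: "K \<subseteq> Rn m" using K unit_ball_Rn[of m] by blast
  note gd = gaussian_mechanism_public_distr[OF KR, where s = s and n = n]
  have alg: "is_algorithm m K (gaussian_mechanism_public m s n)"
    unfolding is_algorithm_def by (auto simp: gd(1) intro!: N.prob_space_distr gd(2))
  show ?thesis unfolding diff_private_def s_def[symmetric]
  proof (intro conjI alg ballI impI)
    fix D D' S assume D: "D \<in> databases K" "D' \<in> databases K" "neighboring D D'"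
      and S[measurable]: "S \<in> sets (borel_Rn m)"
    obtain d where d: "\<And>i. (\<Sum>x\<in>#D'. x i) = (\<Sum>x\<in>#D. x i) + (d i :: real)" "(\<Sum>i<m. (d i)\<^sup>2) \<le> 1"
        "\<And>i. m \<le> i \<Longrightarrow> d i = 0"
      using neighboring_sums[OF K D] by blast
    define f where "f = (\<lambda>w i. ((\<Sum>x\<in>#D. x i) + (if i < m then w i else 0)) / real n)"
    define f' where "f' = (\<lambda>w i. ((\<Sum>x\<in>#D'. x i) + (if i < m then w i else 0)) / real n)"
    have [measurable]: "f \<in> measurable (normals s {..<m}) (borel_Rn m)"
        "f' \<in> measurable (normals s {..<m}) (borel_Rn m)"
      using gd(2) D by (auto simp: f_def f'_def)
    have ff: "f (\<lambda>i\<in>{..<m}. w i + d i) = f' w" for w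
      by (auto simp: f_def f'_def fun_eq_iff d(1) d(3))
    let ?T = "f -` S \<inter> space (normals s {..<m})"
    have T: "?T \<in> sets (\<Pi>\<^sub>M i\<in>{..<m}. borel)"
      unfolding sets_normals[of s, symmetric] by measurable
    have T': "(\<lambda>x. \<lambda>i\<in>{..<m}. x i + d i) -` ?T \<inter> space (normals s {..<m}) =
        f' -` S \<inter> space (normals s {..<m})"
      by (auto simp: ff space_normals)
    have "emeasure (gaussian_mechanism_public m s n D) S = emeasure (normals s {..<m}) ?T"
      unfolding gd(1)[OF D(1)] f_def[symmetric] by (rule emeasure_distr) auto
    also have "\<dots> \<le> ennreal (exp \<epsilon>) * emeasure (normals s {..<m}) (f' -` S \<inter> space (normals s {..<m}))
        + ennreal (exp (- (s\<^sup>2 * t\<^sup>2) / 2))"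
      using gaussian_tail_shift[OF nb(1) _ d(2) nb(2) t_def T] unfolding T' by simp
    also have "emeasure (normals s {..<m}) (f' -` S \<inter> space (normals s {..<m})) =
        emeasure (gaussian_mechanism_public m s n D') S"
      unfolding gd(1)[OF D(2)] f'_def[symmetric] by (rule emeasure_distr[symmetric]) auto
    finally have le: "emeasure (gaussian_mechanism_public m s n D) S \<le>
      ennreal (exp \<epsilon>) * emeasure (gaussian_mechanism_public m s n D') S + ennreal (exp (- (s\<^sup>2 * t\<^sup>2) / 2))" .
    interpret A: prob_space "gaussian_mechanism_public m s n D" using alg D by (auto simp: is_algorithm_def)
    interpret A': prob_space "gaussian_mechanism_public m s n D'" using alg D by (auto simp: is_algorithm_def)
    have "measure (gaussian_mechanism_public m s n D) S \<le>
        exp \<epsilon> * measure (gaussian_mechanism_public m s n D') S + exp (- (s\<^sup>2 * t\<^sup>2) / 2)"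
      using le unfolding A.emeasure_eq_measure A'.emeasure_eq_measure
      by (simp add: ennreal_mult[symmetric] ennreal_plus[symmetric] del: ennreal_plus)
    then show "measure (gaussian_mechanism_public m s n D) S \<le>
        exp \<epsilon> * measure (gaussian_mechanism_public m s n D') S + \<delta>"
      using nb(3) by linarith
  qed
qed

section \<open>Error of the Gaussian mechanism\<close>

lemma ennreal_sqrt_ennreal: "0 \<le> x \<Longrightarrow> ennreal_sqrt (ennreal x) = ennreal (sqrt x)"
  by (simp add: ennreal_sqrt_def)

lemma L2_set_squared: "(L2_set f I)\<^sup>2 = (\<Sum>i\<in>I. (f i)\<^sup>2)"
  by (simp add: L2_set_def sum_nonneg)

text \<open>The deviation from the mean is the scaled noise, whatever the database: each of the
  \<open>m\<close> coordinates contributes \<open>s\<^sup>2 / n\<^sup>2\<close>.\<close>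

lemma gaussian_mechanism_error:
  assumes s: "0 < s" and K: "K \<subseteq> Rn m" "K \<noteq> {}" and n: "1 \<le> n"
  shows "err m K (gaussian_mechanism m s) n = ennreal (s * sqrt (real m) / real n)"
proof -
  interpret N: prob_space "normals s {..<m}" by (rule prob_space_normals[OF s])
  have "ennreal_sqrt (\<integral>\<^sup>+y. ennreal ((L2_set (\<lambda>i. y i - db_mean D i) {..<m})\<^sup>2) \<partial>gaussian_mechanism m s D) =
      ennreal (s * sqrt (real m) / real n)" if D: "D \<in> databases K" "size D = n" for D
  proof -
    note [measurable] = measurable_coordinate_borel_Rn
    note gd = gaussian_mechanism_public_distr[OF K(1) D(1), where s = s and n = n]
    have eq: "gaussian_mechanism m s D = gaussian_mechanism_public m s n D"
      using gaussian_mechanism_public_eq[OF D(2)] by simp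
    have i: "integrable (normals s {..<m}) (\<lambda>w. (w i)\<^sup>2)" "(\<integral>w. (w i)\<^sup>2 \<partial>normals s {..<m}) = s\<^sup>2"
      if "i < m" for i
      using integrable_normals_moments[of "{..<m}" i s] that s by auto
    have "(\<integral>\<^sup>+y. ennreal ((L2_set (\<lambda>i. y i - db_mean D i) {..<m})\<^sup>2) \<partial>gaussian_mechanism m s D) =
        (\<integral>\<^sup>+w. ennreal (\<Sum>i<m. (w i)\<^sup>2 / (real n)\<^sup>2) \<partial>normals s {..<m})"
      unfolding eq gd(1) L2_set_squared
      by (subst nn_integral_distr[OF gd(2)])
        (auto simp: db_mean_def D(2) diff_divide_distrib[symmetric] power_divide intro!: nn_integral_cong)
    also have "\<dots> = ennreal (\<integral>w. (\<Sum>i<m. (w i)\<^sup>2 / (real n)\<^sup>2) \<partial>normals s {..<m})"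
      by (rule nn_integral_eq_integral) (auto intro!: integrable_divide i sum_nonneg)
    also have "(\<integral>w. (\<Sum>i<m. (w i)\<^sup>2 / (real n)\<^sup>2) \<partial>normals s {..<m}) = (\<Sum>i<m. s\<^sup>2 / (real n)\<^sup>2)"
      by (subst Bochner_Integration.integral_sum) (auto intro!: integrable_divide i simp: i)
    also have "\<dots> = (s * sqrt (real m) / real n)\<^sup>2"
      by (simp add: power_mult_distrib power_divide)
    finally show ?thesis using s by (simp add: ennreal_sqrt_ennreal)
  qed
  note e = this
  obtain x where "x \<in> K" using K by blast
  \<comment> \<open>The supremum of a constant is that constant only over a nonempty set;
    \<open>n\<close> copies of one point of \<open>K\<close> are a database of size
    \<open>n\<close>.\<close>
  then have ne: "{D \<in> databases K. size D = n} \<noteq> {}"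
    by (intro ex_in_conv[THEN iffD1] exI[of _ "replicate_mset n x"])
      (auto simp: databases_def split: if_splits)
  have "err m K (gaussian_mechanism m s) n = (SUP D\<in>{D \<in> databases K. size D = n}. ennreal (s * sqrt (real m) / real n))"
    unfolding err_def by (rule SUP_cong) (auto simp: e)
  then show ?thesis using ne by simp
qed

lemma err_gaussian_mechanism_public:
  "err m K (gaussian_mechanism_public m s n) n = err m K (gaussian_mechanism m s) n"
  unfolding err_def by (intro SUP_cong) (auto simp: gaussian_mechanism_public_eq)

section \<open>Sample sizes as attained minima\<close>

lemma samp_enat:
  assumes "samp m K A \<alpha> = enat n"
  shows "1 \<le> n" "err m K A n \<le> ennreal \<alpha>"
proof -
  let ?S = "{enat n |n. 1 \<le> n \<and> err m K A n \<le> ennreal \<alpha>}"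
  have "?S \<noteq> {}" using assms by (auto simp: samp_def Inf_enat_def split: if_splits)
  then have "Inf ?S \<in> ?S" unfolding Inf_enat_def by (auto intro: LeastI)
  then show "1 \<le> n" "err m K A n \<le> ennreal \<alpha>" using assms by (auto simp: samp_def)
qed

lemma samp_le:
  assumes "1 \<le> n" "err m K A n \<le> ennreal \<alpha>"
  shows "samp m K A \<alpha> \<le> enat n"
  unfolding samp_def using assms by (intro Inf_lower) auto

text \<open>Infima of nonempty sets of extended naturals are least elements, so a finite sample
  complexity comes with an algorithm accurate at exactly that size. The lower bound is applied to
  this algorithm.\<close>

lemma sample_complexity_enat:
  assumes "sample_complexity m K \<epsilon> \<delta> \<alpha> = enat n"
  obtains A where "diff_private m K \<epsilon> \<delta> A" "1 \<le> n" "err m K A n \<le> ennreal \<alpha>"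
proof -
  let ?S = "(\<lambda>A. samp m K A \<alpha>) ` {A. diff_private m K \<epsilon> \<delta> A}"
  have "?S \<noteq> {}" using assms unfolding sample_complexity_def Inf_enat_def by (auto split: if_splits)
  then have "Inf ?S \<in> ?S" unfolding Inf_enat_def by (auto intro: LeastI)
  then obtain A where "diff_private m K \<epsilon> \<delta> A" "samp m K A \<alpha> = enat n"
    using assms unfolding sample_complexity_def by auto
  then show ?thesis using samp_enat[of m K A \<alpha> n] that by blast
qed

lemma sample_complexity_le:
  assumes "diff_private m K \<epsilon> \<delta> A" "1 \<le> n" "err m K A n \<le> ennreal \<alpha>"
  shows "sample_complexity m K \<epsilon> \<delta> \<alpha> \<le> enat n"
proof -
  have "sample_complexity m K \<epsilon> \<delta> \<alpha> \<le> samp m K A \<alpha>"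
    unfolding sample_complexity_def using assms by (intro INF_lower) auto
  also have "\<dots> \<le> enat n" by (rule samp_le[OF assms(2,3)])
  finally show ?thesis .
qed

lemma gaussian_mechanism_samp:
  assumes s: "0 < s" and K: "K \<subseteq> Rn m" "K \<noteq> {}" and \<alpha>: "0 < \<alpha>"
  obtains N where "samp m K (gaussian_mechanism m s) \<alpha> = enat N" "1 \<le> N"
    "err m K (gaussian_mechanism m s) N \<le> ennreal \<alpha>" "real N \<le> s * sqrt (real m) / \<alpha> + 1"
proof -
  define r where "r = s * sqrt (real m) / \<alpha>"
  \<comment> \<open>The error formula is at most \<alpha> as soon as the size reaches
    \<open>r\<close>; the maximum with 1 excludes the empty database.\<close>
  define M where "M = max 1 (nat \<lceil>r\<rceil>)"
  have r0: "0 \<le> r" using s \<alpha> by (simp add: r_def)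
  have M: "1 \<le> M" "r \<le> real M" unfolding M_def by linarith+
  have M1: "real M \<le> r + 1" using r0 unfolding M_def by linarith
  have "s * sqrt (real m) = r * \<alpha>" using \<alpha> by (simp add: r_def)
  also have "\<dots> \<le> real M * \<alpha>" using M \<alpha> by (intro mult_right_mono) auto
  finally have "s * sqrt (real m) / real M \<le> \<alpha>" using M by (simp add: field_simps)
  then have "err m K (gaussian_mechanism m s) M \<le> ennreal \<alpha>"
    unfolding gaussian_mechanism_error[OF s K M(1)] by (rule ennreal_leI)
  from samp_le[OF M(1) this] obtain N where N: "samp m K (gaussian_mechanism m s) \<alpha> = enat N" "N \<le> M"
    by (cases "samp m K (gaussian_mechanism m s) \<alpha>") auto
  show ?thesis
    using that[OF N(1) samp_enat[OF N(1)]] N(2) M1 unfolding r_def by (meson of_nat_mono order_trans)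
qed

lemma diff_private_mono:
  "diff_private m K \<epsilon> \<delta> A \<Longrightarrow> \<delta> \<le> \<delta>' \<Longrightarrow> diff_private m K \<epsilon> \<delta>' A"
  unfolding diff_private_def by (meson add_left_mono order_trans)

text \<open>The theorem restricts \<delta> only at the sample complexity itself, so finiteness has
  to hold for every positive \<delta>. Lowering \<delta> to at most 1/2 makes the Gaussian mechanism
  available, and privacy is monotone in \<delta>.\<close>

lemma sample_complexity_finite:
  assumes K: "K \<subseteq> unit_ball m" "K \<noteq> {}" and "0 < \<epsilon>" "\<epsilon> \<le> 1" "0 < \<delta>" "0 < \<alpha>"
  obtains n where "sample_complexity m K \<epsilon> \<delta> \<alpha> = enat n"
proof -
  define \<delta>' where "\<delta>' = min \<delta> (1 / 2)"
  have d: "0 < \<delta>'" "\<delta>' \<le> 1/2" "\<delta>' \<le> \<delta>" using assms by (auto simp: \<delta>'_def)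
  have KR: "K \<subseteq> Rn m" using K unit_ball_Rn[of m] by blast
  obtain N where N: "1 \<le> N" "err m K (gaussian_mechanism m (noise_level \<epsilon> \<delta>')) N \<le> ennreal \<alpha>"
    using gaussian_mechanism_samp[OF noise_level_bound(1) KR K(2)] assms d by metis
  have "sample_complexity m K \<epsilon> \<delta> \<alpha> \<le> enat N"
    using diff_private_mono[OF gaussian_mechanism_public_private[OF K(1) assms(3,4) d(1,2)] d(3)] N
    by (intro sample_complexity_le[where A = "gaussian_mechanism_public m (noise_level \<epsilon> \<delta>') N"]) (auto simp: err_gaussian_mechanism_public)
  then show ?thesis using that by (cases "sample_complexity m K \<epsilon> \<delta> \<alpha>") auto
qed

section \<open>Consequences of privacy and accuracy\<close>

text \<open>The copies are removed one at a time. Each of the \<open>k\<close> additive errors is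
  amplified by at most \<open>exp (k * \<epsilon>)\<close>, which bounds their geometric
  sum.\<close>

lemma diff_private_group:
  assumes A: "diff_private m K \<epsilon> \<delta> A" and "0 \<le> \<epsilon>" "0 \<le> \<delta>" and D: "D \<in> databases K" "x \<in> K"
    and S: "S \<in> sets (borel_Rn m)"
  shows "measure (A (D + replicate_mset k x)) S \<le>
    exp (real k * \<epsilon>) * measure (A D) S + real k * \<delta> * exp (real k * \<epsilon>)"
proof (induction k)
  case 0
  then show ?case by simp
next
  case (Suc k)
  have db: "D + replicate_mset k x \<in> databases K" "D + replicate_mset (Suc k) x \<in> databases K"
    using D by (auto simp: databases_def in_replicate_mset split: if_splits)
  have nb: "neighboring (D + replicate_mset (Suc k) x) (D + replicate_mset k x)"
    by (simp add: neighboring_def)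
  have 1: "measure (A (D + replicate_mset (Suc k) x)) S \<le>
      exp \<epsilon> * measure (A (D + replicate_mset k x)) S + \<delta>"
    using A db nb S unfolding diff_private_def by blast
  have 2: "exp \<epsilon> * measure (A (D + replicate_mset k x)) S \<le>
      exp \<epsilon> * (exp (real k * \<epsilon>) * measure (A D) S + real k * \<delta> * exp (real k * \<epsilon>))"
    using Suc by (intro mult_left_mono) auto
  have 3: "exp \<epsilon> * (exp (real k * \<epsilon>) * measure (A D) S + real k * \<delta> * exp (real k * \<epsilon>)) =
      exp (real (Suc k) * \<epsilon>) * measure (A D) S + real k * \<delta> * exp (real (Suc k) * \<epsilon>)"
    by (simp add: algebra_simps exp_add)
  have "1 \<le> exp (real (Suc k) * \<epsilon>)" using assms(2) by simp
  then have "\<delta> * 1 \<le> \<delta> * exp (real (Suc k) * \<epsilon>)" using assms(3) by (rule mult_left_mono)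
  moreover have "real (Suc k) * \<delta> * exp (real (Suc k) * \<epsilon>) =
      real k * \<delta> * exp (real (Suc k) * \<epsilon>) + \<delta> * exp (real (Suc k) * \<epsilon>)"
    by (simp add: algebra_simps)
  ultimately show ?case using 1 2 3 by linarith
qed

text \<open>The sum counts the positive integers up to \<open>t\<close>, that is, it is the floor of
  \<open>t\<close>.\<close>

lemma sum_indicator_le_floor:
  fixes t :: real
  assumes "0 \<le> t" "t \<le> real n"
  shows "(\<Sum>i\<in>{1..n}. if real i \<le> t then 1 else 0 :: real) \<le> t"
    "t \<le> (\<Sum>i\<in>{1..n}. if real i \<le> t then 1 else 0 :: real) + 1"
proof -
  have "{i \<in> {1..n}. real i \<le> t} = {1..nat \<lfloor>t\<rfloor>}"
    using assms by (auto simp: le_nat_floor) (linarith+)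
  then have "(\<Sum>i\<in>{1..n}. if real i \<le> t then 1 else 0 :: real) = real (nat \<lfloor>t\<rfloor>)"
    by (simp add: sum.If_cases Int_def conj_commute)
  then show "(\<Sum>i\<in>{1..n}. if real i \<le> t then 1 else 0 :: real) \<le> t"
    "t \<le> (\<Sum>i\<in>{1..n}. if real i \<le> t then 1 else 0 :: real) + 1"
    using assms by linarith+
qed

text \<open>Approximate \<open>f\<close> from below by a staircase with \<open>n\<close> steps of height \<open>B / n\<close>.\<close>

lemma integral_le_of_measure_le:
  fixes f :: "'a \<Rightarrow> real"
  assumes P: "prob_space P" and Q: "prob_space Q" and sets: "sets P = sets Q"
    and le: "\<And>S. S \<in> sets P \<Longrightarrow> measure P S \<le> a * measure Q S + b"
    and ab: "0 \<le> a" "0 \<le> b"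
    and f: "f \<in> borel_measurable P" "\<And>x. 0 \<le> f x" "\<And>x. f x \<le> B"
  shows "(\<integral>x. f x \<partial>P) \<le> a * (\<integral>x. f x \<partial>Q) + b * B"
proof (cases "B = 0")
  case True
  then have "f x = 0" for x using f(2,3)[of x] by simp
  then show ?thesis using True by simp
next
  case False
  then have B: "0 < B" using f(2,3) by (metis order_antisym_conv order_trans not_le_imp_less)
  interpret P: prob_space P by fact
  interpret Q: prob_space Q by fact
  have fP[measurable]: "f \<in> borel_measurable P" by fact
  have fQ[measurable]: "f \<in> borel_measurable Q" using f(1) by (simp cong: measurable_cong_sets add: sets)
  have iP: "integrable P f" by (rule P.integrable_const_bound[where B = B]) (use f in auto)
  have iQ: "integrable Q f" by (rule Q.integrable_const_bound[where B = B]) (use f in auto)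
  have "(\<integral>x. f x \<partial>P) \<le> a * (\<integral>x. f x \<partial>Q) + b * B + B / real n" if n: "1 \<le> n" for n :: nat
  proof -
    \<comment> \<open>Rescaling \<open>f\<close> to the range from 0 to \<open>n\<close> puts the
      steps of the staircase at the integers.\<close>
    define t where "t x = real n * f x / B" for x
    have t: "0 \<le> t x" "t x \<le> real n" for x
      using f(2,3)[of x] B n by (auto simp: t_def field_simps)
    have ft: "f x = B / real n * t x" for x using B n by (simp add: t_def)
    have [measurable]: "t \<in> borel_measurable P" "t \<in> borel_measurable Q"
      unfolding t_def by measurable
    define g where "g x = (\<Sum>i\<in>{1..n}. indicator {x. real i \<le> t x} x :: real)" for x
    have g_eq: "g x = (\<Sum>i\<in>{1..n}. if real i \<le> t x then 1 else 0)" for x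
      unfolding g_def by (intro sum.cong) (auto simp: indicator_def)
    have g: "g x \<le> t x" "t x \<le> g x + 1" for x
      using sum_indicator_le_floor[OF t] unfolding g_eq by auto
    have sP: "{x \<in> space P. real i \<le> t x} \<in> sets P" for i :: nat by measurable
    have sQ: "{x \<in> space Q. real i \<le> t x} \<in> sets Q" for i :: nat by measurable
    have spe: "space P = space Q" by (rule sets_eq_imp_space_eq[OF sets])
    have ig: "integrable M (\<lambda>x. indicator {x. real i \<le> t x} x :: real)"
        "(\<integral>x. indicator {x. real i \<le> t x} x \<partial>M) = measure M {x \<in> space M. real i \<le> t x}"
      if "prob_space M" "{x \<in> space M. real i \<le> t x} \<in> sets M" for M and i :: nat
    proof -
      interpret M: prob_space M by fact
      have e: "(\<lambda>x. indicator {x. real i \<le> t x} x :: real) x = indicator {x \<in> space M. real i \<le> t x} x"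
        if "x \<in> space M" for x using that by (auto simp: indicator_def)
      show "integrable M (\<lambda>x. indicator {x. real i \<le> t x} x :: real)"
        using that(2) by (subst Bochner_Integration.integrable_cong[OF refl e]) (auto simp: M.emeasure_eq_measure)
      show "(\<integral>x. indicator {x. real i \<le> t x} x \<partial>M) = measure M {x \<in> space M. real i \<le> t x}"
        using that(2) by (subst Bochner_Integration.integral_cong[OF refl e]) auto
    qed
    have igP: "integrable P g" and igQ: "integrable Q g"
      unfolding g_def using ig(1)[OF P sP] ig(1)[OF Q sQ] by (auto intro!: Bochner_Integration.integrable_sum)
    have gP: "(\<integral>x. g x \<partial>P) = (\<Sum>i\<in>{1..n}. measure P {x \<in> space P. real i \<le> t x})"
      unfolding g_def by (subst Bochner_Integration.integral_sum) (simp_all only: ig[OF P sP])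
    have gQ: "(\<integral>x. g x \<partial>Q) = (\<Sum>i\<in>{1..n}. measure Q {x \<in> space Q. real i \<le> t x})"
      unfolding g_def by (subst Bochner_Integration.integral_sum) (simp_all only: ig[OF Q sQ])
    \<comment> \<open>Each of the \<open>n\<close> level sets contributes one additive
      \<open>b\<close>; scaled back by \<open>B / n\<close> they make up
      \<open>b * B\<close>.\<close>
    have "(\<integral>x. g x \<partial>P) \<le> (\<Sum>i\<in>{1..n}. a * measure Q {x \<in> space Q. real i \<le> t x} + b)"
      unfolding gP spe[symmetric] by (intro sum_mono le sP)
    also have "\<dots> = a * (\<integral>x. g x \<partial>Q) + real n * b"
      unfolding gQ by (simp add: sum.distrib sum_distrib_left)
    finally have 1: "(\<integral>x. g x \<partial>P) \<le> a * (\<integral>x. g x \<partial>Q) + real n * b" .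
    have "(\<integral>x. f x \<partial>P) \<le> (\<integral>x. B / real n * (g x + 1) \<partial>P)"
      using B n g(2) by (intro integral_mono iP) (auto simp: ft igP intro!: mult_left_mono divide_right_mono)
    also have "\<dots> = B / real n * ((\<integral>x. g x \<partial>P) + 1)"
      using igP P.prob_space by simp
    also have "\<dots> \<le> B / real n * (a * (\<integral>x. g x \<partial>Q) + real n * b + 1)"
      using 1 B by (intro mult_left_mono) auto
    also have "\<dots> = a * (\<integral>x. B / real n * g x \<partial>Q) + b * B + B / real n"
      using B n by (simp add: field_simps)
    also have "\<dots> \<le> a * (\<integral>x. f x \<partial>Q) + b * B + B / real n"
      using B n g(1) ab
      by (intro add_right_mono mult_left_mono integral_mono iQ) (auto simp: ft igQ intro!: mult_left_mono divide_right_mono)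
    finally show ?thesis .
  qed
  moreover have "(\<lambda>n. a * (\<integral>x. f x \<partial>Q) + b * B + B / real n) \<longlonglongrightarrow> a * (\<integral>x. f x \<partial>Q) + b * B + 0"
    by (intro tendsto_intros lim_const_over_n)
  ultimately show ?thesis
    using Lim_bounded2[of "\<lambda>n. a * (\<integral>x. f x \<partial>Q) + b * B + B / real n" _ 1 "\<integral>x. f x \<partial>P"] by simp
qed

section \<open>Truncation of outputs\<close>

text \<open>Large outputs are sent to the origin and not projected to the sphere. This makes the
  output bounded, as the integrability of correlations and the transfer between databases
  require.\<close>

definition truncate :: "nat \<Rightarrow> real \<Rightarrow> (nat \<Rightarrow> real) \<Rightarrow> nat \<Rightarrow> real" where
  "truncate m r y = (if L2_set y {..<m} \<le> r then y else (\<lambda>_. 0))"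

lemma L2_set_truncate: "0 \<le> r \<Longrightarrow> L2_set (truncate m r y) {..<m} \<le> r"
  by (simp add: truncate_def L2_set_def)

lemma abs_truncate_le: "0 \<le> r \<Longrightarrow> i < m \<Longrightarrow> \<bar>truncate m r y i\<bar> \<le> r"
proof -
  assume "0 \<le> r" "i < m"
  have "\<bar>truncate m r y i\<bar> = sqrt ((truncate m r y i)\<^sup>2)" by simp
  also have "\<dots> \<le> L2_set (truncate m r y) {..<m}"
    unfolding L2_set_def using \<open>i < m\<close>
    by (intro real_sqrt_le_mono member_le_sum[of i]) auto
  also have "\<dots> \<le> r" by (rule L2_set_truncate[OF \<open>0 \<le> r\<close>])
  finally show ?thesis .
qed

lemma measurable_L2_set_coordinates [measurable]:
  "(\<lambda>y. L2_set y {..<m}) \<in> borel_measurable (borel_Rn m')"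
  unfolding L2_set_def using measurable_coordinate_borel_Rn by measurable

lemma measurable_truncate [measurable]:
  "(\<lambda>y. truncate m r y i) \<in> borel_measurable (borel_Rn m')"
proof -
  have "(\<lambda>y. truncate m r y i) = (\<lambda>y. if L2_set y {..<m} \<le> r then y i else 0)"
    by (auto simp: truncate_def)
  then show ?thesis using measurable_coordinate_borel_Rn by simp
qed

text \<open>A point \<open>y\<close> beyond radius \<open>2 * r\<close> has distance at least
  \<open>r\<close> from \<open>v\<close>; after truncation the distance is the norm of
  \<open>v\<close>, which is at most \<open>r\<close>.\<close>

lemma truncate_closer:
  assumes "L2_set v {..<m} \<le> r"
  shows "L2_set (\<lambda>i. truncate m (2 * r) y i - v i) {..<m} \<le> L2_set (\<lambda>i. y i - v i) {..<m}"
proof (cases "L2_set y {..<m} \<le> 2 * r")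
  case False
  have "L2_set y {..<m} = L2_set (\<lambda>i. (y i - v i) + v i) {..<m}" by simp
  also have "\<dots> \<le> L2_set (\<lambda>i. y i - v i) {..<m} + L2_set v {..<m}" by (rule L2_set_triangle_ineq)
  finally have "L2_set v {..<m} \<le> L2_set (\<lambda>i. y i - v i) {..<m}" using False assms by linarith
  moreover have "L2_set (\<lambda>i. - v i) {..<m} = L2_set v {..<m}" by (simp add: L2_set_def)
  ultimately show ?thesis using False by (simp add: truncate_def)
qed (simp add: truncate_def)

text \<open>Truncation does not increase the distance to the mean \<open>v\<close>, and by Jensen neither does averaging.\<close>

lemma truncated_mean_error:
  assumes A: "prob_space A" "sets A = sets (borel_Rn m)" and v: "L2_set v {..<m} \<le> r" and r: "0 \<le> r"
    and e: "ennreal_sqrt (\<integral>\<^sup>+y. ennreal ((L2_set (\<lambda>i. y i - v i) {..<m})\<^sup>2) \<partial>A) \<le> ennreal \<alpha>"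
    and \<alpha>: "0 \<le> \<alpha>"
  shows "L2_set (\<lambda>i. (\<integral>y. truncate m (2 * r) y i \<partial>A) - v i) {..<m} \<le> \<alpha>"
proof -
  interpret A: prob_space A by fact
  note [measurable_cong] = A(2) and [measurable] = measurable_coordinate_borel_Rn
  let ?I = "\<integral>\<^sup>+y. ennreal ((L2_set (\<lambda>i. y i - v i) {..<m})\<^sup>2) \<partial>A"
  \<comment> \<open>Finiteness comes first because \<open>enn2real\<close> maps infinity to
    0.\<close>
  have fin: "?I \<noteq> \<infinity>" using e by (auto simp: ennreal_sqrt_def top_unique split: if_splits)
  then have "ennreal (sqrt (enn2real ?I)) \<le> ennreal \<alpha>" using e by (simp add: ennreal_sqrt_def)
  then have "sqrt (enn2real ?I) \<le> \<alpha>" using \<alpha> by simp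
  then have "enn2real ?I \<le> \<alpha>\<^sup>2" using \<alpha> by (simp add: real_sqrt_le_iff sqrt_le_D)
  then have "ennreal (enn2real ?I) \<le> ennreal (\<alpha>\<^sup>2)" by (rule ennreal_leI)
  moreover have "ennreal (enn2real ?I) = ?I"
    using fin by (intro ennreal_enn2real) (simp add: less_top[symmetric])
  ultimately have I: "?I \<le> ennreal (\<alpha>\<^sup>2)" by simp
  let ?Z = "\<lambda>i y. truncate m (2 * r) y i - v i"
  have bZ: "\<bar>?Z i y\<bar> \<le> 2 * r + \<bar>v i\<bar>" if "i < m" for i y
    using abs_truncate_le[of "2 * r" i m y] r that by linarith
  have iT: "integrable A (\<lambda>y. truncate m (2 * r) y i)" if "i < m" for i
    by (rule A.integrable_const_bound[where B = "2 * r"]) (use abs_truncate_le[of "2 * r" i m] r that in auto)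
  have iZ: "integrable A (?Z i)" if "i < m" for i
    using iT[OF that] by simp
  have iZ2: "integrable A (\<lambda>y. (?Z i y)\<^sup>2)" if "i < m" for i
  proof (rule A.integrable_const_bound[where B = "(2 * r + \<bar>v i\<bar>)\<^sup>2"])
    show "AE y in A. norm ((?Z i y)\<^sup>2) \<le> (2 * r + \<bar>v i\<bar>)\<^sup>2"
      using bZ[OF that] r by (intro AE_I2) (simp add: abs_le_square_iff[symmetric])
  qed measurable
  \<comment> \<open>Jensen in one coordinate is the nonnegativity of the variance.\<close>
  have J: "(A.expectation (?Z i))\<^sup>2 \<le> A.expectation (\<lambda>y. (?Z i y)\<^sup>2)" if "i < m" for i
    using A.variance_eq[OF iZ[OF that] iZ2[OF that]] A.variance_positive[of "?Z i"] by linarith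
  have "(L2_set (\<lambda>i. (\<integral>y. truncate m (2 * r) y i \<partial>A) - v i) {..<m})\<^sup>2 = (\<Sum>i<m. (A.expectation (?Z i))\<^sup>2)"
    unfolding L2_set_squared by (intro sum.cong refl) (simp add: iT A.prob_space)
  also have "\<dots> \<le> (\<Sum>i<m. A.expectation (\<lambda>y. (?Z i y)\<^sup>2))"
    by (intro sum_mono J) auto
  also have "\<dots> = A.expectation (\<lambda>y. \<Sum>i<m. (?Z i y)\<^sup>2)"
    by (subst Bochner_Integration.integral_sum) (auto simp: iZ2)
  finally have 1: "(L2_set (\<lambda>i. (\<integral>y. truncate m (2 * r) y i \<partial>A) - v i) {..<m})\<^sup>2 \<le>
      A.expectation (\<lambda>y. \<Sum>i<m. (?Z i y)\<^sup>2)" .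
  have "ennreal (A.expectation (\<lambda>y. \<Sum>i<m. (?Z i y)\<^sup>2)) = (\<integral>\<^sup>+y. ennreal (\<Sum>i<m. (?Z i y)\<^sup>2) \<partial>A)"
    by (rule nn_integral_eq_integral[symmetric]) (auto intro!: iZ2 sum_nonneg)
  also have "\<dots> \<le> ?I"
    using truncate_closer[OF v]
    by (intro nn_integral_mono ennreal_leI) (simp add: L2_set_squared[symmetric] power_mono)
  also have "\<dots> \<le> ennreal (\<alpha>\<^sup>2)" by (rule I)
  finally have "A.expectation (\<lambda>y. \<Sum>i<m. (?Z i y)\<^sup>2) \<le> \<alpha>\<^sup>2" by simp
  with 1 show ?thesis using \<alpha> by (meson order_trans power2_le_imp_le)
qed

section \<open>Maximisers over a finite list\<close>

text \<open>Ties are broken by the least position, so that the maximiser is a measurable function of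
  \<open>y\<close> with finitely many values.\<close>

definition argmax_list :: "nat \<Rightarrow> (nat \<Rightarrow> real) list \<Rightarrow> (nat \<Rightarrow> real) \<Rightarrow> nat \<Rightarrow> real" where
  "argmax_list m ts y =
     ts ! (LEAST l. l < length ts \<and> (\<forall>t\<in>set ts. inner_Rn m t y \<le> inner_Rn m (ts ! l) y))"

lemma argmax_list:
  assumes "ts \<noteq> []"
  shows "argmax_list m ts y \<in> set ts" "t \<in> set ts \<Longrightarrow> inner_Rn m t y \<le> inner_Rn m (argmax_list m ts y) y"
    "(LEAST l. l < length ts \<and> (\<forall>t\<in>set ts. inner_Rn m t y \<le> inner_Rn m (ts ! l) y)) < length ts"
proof -
  let ?P = "\<lambda>l. l < length ts \<and> (\<forall>t\<in>set ts. inner_Rn m t y \<le> inner_Rn m (ts ! l) y)"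
  have "Max ((\<lambda>t. inner_Rn m t y) ` set ts) \<in> (\<lambda>t. inner_Rn m t y) ` set ts"
    using assms by (intro Max_in) auto
  then obtain s where s: "s \<in> set ts" "Max ((\<lambda>t. inner_Rn m t y) ` set ts) = inner_Rn m s y"
    by blast
  then have s': "inner_Rn m t y \<le> inner_Rn m s y" if "t \<in> set ts" for t
    using that Max_ge[of "(\<lambda>t. inner_Rn m t y) ` set ts" "inner_Rn m t y"] by simp
  obtain l where "l < length ts" "ts ! l = s" using s(1) by (metis in_set_conv_nth)
  then have "?P l" using s' by auto
  then have "?P (LEAST l. ?P l)" by (rule LeastI)
  then show "argmax_list m ts y \<in> set ts" "t \<in> set ts \<Longrightarrow> inner_Rn m t y \<le> inner_Rn m (argmax_list m ts y) y"
    "(LEAST l. ?P l) < length ts"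
    unfolding argmax_list_def by auto
qed

lemma argmax_list_cong: "(\<And>i. i < m \<Longrightarrow> y i = y' i) \<Longrightarrow> argmax_list m ts y = argmax_list m ts y'"
  unfolding argmax_list_def inner_Rn_def by simp

text \<open>Simple functions stay simple under composition with any map. This is how quantities
  depending on the output distribution become measurable, although an algorithm is an arbitrary
  function of its database.\<close>

lemma simple_function_argmax_list:
  assumes "ts \<noteq> []" and [measurable]: "\<And>i. i < m \<Longrightarrow> (\<lambda>x. f x i) \<in> borel_measurable M"
  shows "simple_function M (\<lambda>x. argmax_list m ts (f x))"
proof -
  let ?L = "\<lambda>x. LEAST l. l < length ts \<and> (\<forall>t\<in>set ts. inner_Rn m t (f x) \<le> inner_Rn m (ts ! l) (f x))"
  have [measurable]: "(\<lambda>x. inner_Rn m t (f x)) \<in> borel_measurable M" for t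
    unfolding inner_Rn_def by (intro borel_measurable_sum borel_measurable_times) auto
  have m: "?L \<in> measurable M (count_space UNIV)" by measurable
  have "simple_function M ?L"
    unfolding simple_function_def
  proof (intro conjI ballI)
    show "finite (?L ` space M)"
    proof (rule finite_subset)
      show "?L ` space M \<subseteq> {..<length ts}"
        by (intro image_subsetI) (simp only: lessThan_iff argmax_list(3)[OF assms(1)])
    qed simp
    show "?L -` {x} \<inter> space M \<in> sets M" for x using m by (rule measurable_sets) simp
  qed
  then show ?thesis unfolding argmax_list_def by (rule simple_function_compose1)
qed

section \<open>Fingerprinting\<close>

lemma measurable_normals_component: "p \<in> I \<Longrightarrow> (\<lambda>x. x p) \<in> borel_measurable (normals s I)"
  by measurable

text \<open>The Gaussian matrix has rows up to \<open>q\<close> and columns below \<open>m\<close>;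
  the direction of translation lies in column \<open>i\<close>, with weights \<open>c\<close> on the
  rows. Invariance is phrased by entries, so that no values outside the index range have to be
  compared.\<close>

lemma integral_column_shift_invariant:
  fixes F :: "(nat \<times> nat \<Rightarrow> real) \<Rightarrow> real"
  assumes i: "i < m" and F: "F \<in> borel_measurable (normals 1 ({..q} \<times> {..<m}))" "\<And>x. \<bar>F x\<bar> \<le> B"
    and inv: "\<And>x x' t. (\<And>a b. a \<le> q \<Longrightarrow> b < m \<Longrightarrow> x' (a, b) = x (a, b) + (if b = i then t * c a else 0)) \<Longrightarrow>
      F x' = F x"
  shows "(\<integral>x. F x * (\<Sum>a\<le>q. c a * x (a, i)) \<partial>normals 1 ({..q} \<times> {..<m})) = 0"
proof -
  let ?v = "\<lambda>(a, b). if b = i then c a else 0"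
  have "(\<integral>x. F x * (\<Sum>p\<in>{..q} \<times> {..<m}. ?v p * x p) \<partial>normals 1 ({..q} \<times> {..<m})) = 0"
    by (rule integral_normals_shift_invariant[OF _ F]) (auto intro!: inv)
  moreover have "(\<Sum>p\<in>{..q} \<times> {..<m}. ?v p * x p) = (\<Sum>a\<le>q. c a * x (a, i))" for x
  proof -
    have "(\<Sum>p\<in>{..q} \<times> {..<m}. ?v p * x p) = (\<Sum>a\<le>q. \<Sum>b<m. (if b = i then c a * x (a, b) else 0))"
      unfolding sum.cartesian_product by (intro sum.cong) auto
    then show ?thesis using i by simp
  qed
  ultimately show ?thesis by simp
qed

text \<open>An event that ignores row \<open>j\<close> is independent of that row. Translating row
  \<open>j\<close> by \<open>w\<close> fixes \<open>E\<close>, so the translation formula gives the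
  exponential moment on \<open>E\<close> without splitting the product space.\<close>

lemma nn_integral_row_exp:
  fixes E :: "(nat \<times> nat \<Rightarrow> real) set" and q m :: nat
  defines "\<gamma> \<equiv> normals 1 ({..q} \<times> {..<m})"
  assumes j: "j \<le> q" and E: "E \<in> sets \<gamma>"
    and inv: "\<And>x x'. x \<in> space \<gamma> \<Longrightarrow> x' \<in> space \<gamma> \<Longrightarrow>
      (\<And>a b. a \<le> q \<Longrightarrow> b < m \<Longrightarrow> a \<noteq> j \<Longrightarrow> x' (a, b) = x (a, b)) \<Longrightarrow> x \<in> E \<Longrightarrow> x' \<in> E"
  shows "(\<integral>\<^sup>+x. indicator E x * ennreal (exp (\<Sum>b<m. w b * x (j, b))) \<partial>\<gamma>) =
    ennreal (exp ((\<Sum>b<m. (w b)\<^sup>2) / 2)) * emeasure \<gamma> E"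
proof -
  let ?J = "{..q} \<times> {..<m}"
  let ?v = "\<lambda>(a, b). if a = j then w b else 0"
  let ?sh = "\<lambda>x. \<lambda>p\<in>?J. x p + ?v p"
  let ?c = "(\<Sum>b<m. (w b)\<^sup>2) / 2"
  have sums: "(\<Sum>p\<in>?J. f (?v p) p) = (\<Sum>b<m. f (w b) (j, b))" if "\<And>p. f 0 p = 0" for f :: "real \<Rightarrow> _ \<Rightarrow> real"
  proof -
    have "(\<Sum>p\<in>?J. f (?v p) p) = (\<Sum>a\<le>q. (if a = j then \<Sum>b<m. f (w b) (j, b) else 0))"
      unfolding sum.cartesian_product[symmetric] sum.cartesian_product'
      by (intro sum.cong) (auto simp: that)
    then show ?thesis using j by simp
  qed
  have sh: "?sh \<in> measurable \<gamma> (\<Pi>\<^sub>M p\<in>?J. borel)" unfolding \<gamma>_def by measurable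
  have s1: "(\<Sum>p\<in>?J. ?v p * x p) = (\<Sum>b<m. w b * x (j, b))" for x
    by (rule sums[of "\<lambda>y p. y * x p"]) simp
  have s2: "(\<Sum>p\<in>?J. (?v p)\<^sup>2) = (\<Sum>b<m. (w b)\<^sup>2)"
    by (rule sums[of "\<lambda>y p. y\<^sup>2"]) simp
  have [measurable]: "(\<lambda>x. x (j, b)) \<in> borel_measurable \<gamma>" if "b < m" for b
    unfolding \<gamma>_def using j that by (intro measurable_normals_component) auto
  have [measurable]: "(\<lambda>x. \<Sum>b<m. w b * x (j, b)) \<in> borel_measurable \<gamma>"
    by (intro borel_measurable_sum borel_measurable_times) auto
  have meas: "(\<lambda>x. ennreal (exp ((\<Sum>b<m. w b * x (j, b)) / 1\<^sup>2 - (\<Sum>b<m. (w b)\<^sup>2) / (2 * 1\<^sup>2)))) \<in> borel_measurable \<gamma>"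
    by measurable
  have shE: "?sh -` E \<inter> space \<gamma> = E"
  proof (intro set_eqI iffI)
    fix x assume "x \<in> ?sh -` E \<inter> space \<gamma>"
    then have "?sh x \<in> E" "x \<in> space \<gamma>" by simp_all
    moreover have "?sh x \<in> space \<gamma>" by (simp add: \<gamma>_def space_normals)
    ultimately show "x \<in> E" by (intro inv[of "?sh x" x]) simp_all
  next
    fix x assume "x \<in> E"
    moreover have x: "x \<in> space \<gamma>" by (rule subsetD[OF sets.sets_into_space[OF E] \<open>x \<in> E\<close>])
    moreover have "?sh x \<in> space \<gamma>" by (simp add: \<gamma>_def space_normals)
    ultimately have "?sh x \<in> E" by (intro inv[of x "?sh x"]) simp_all
    with x show "x \<in> ?sh -` E \<inter> space \<gamma>" by simp
  qed
  have E': "E \<in> sets (\<Pi>\<^sub>M p\<in>?J. borel)" using E by (simp add: \<gamma>_def sets_normals)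
  have "emeasure \<gamma> E = emeasure (distr \<gamma> (\<Pi>\<^sub>M p\<in>?J. borel) ?sh) E"
    using E' by (simp add: emeasure_distr[OF sh] shE)
  also have "\<dots> = emeasure (density \<gamma> (\<lambda>x. ennreal (exp ((\<Sum>p\<in>?J. ?v p * x p) / 1\<^sup>2 - (\<Sum>p\<in>?J. (?v p)\<^sup>2) / (2 * 1\<^sup>2))))) E"
    unfolding \<gamma>_def by (subst distr_normals_shift) auto
  also have "\<dots> = (\<integral>\<^sup>+x. ennreal (exp ((\<Sum>b<m. w b * x (j, b)) - ?c)) * indicator E x \<partial>\<gamma>)"
    unfolding s1 s2 by (subst emeasure_density[OF meas E]) simp
  also have "\<dots> = (\<integral>\<^sup>+x. ennreal (exp (- ?c)) * (indicator E x * ennreal (exp (\<Sum>b<m. w b * x (j, b)))) \<partial>\<gamma>)"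
    by (intro nn_integral_cong) (auto simp: indicator_def ennreal_mult[symmetric] exp_add[symmetric])
  also have "\<dots> = ennreal (exp (- ?c)) * (\<integral>\<^sup>+x. indicator E x * ennreal (exp (\<Sum>b<m. w b * x (j, b))) \<partial>\<gamma>)"
    by (intro nn_integral_cmult borel_measurable_times_ennreal borel_measurable_indicator E) measurable
  finally have "ennreal (exp ?c) * emeasure \<gamma> E = ennreal (exp ?c) * (ennreal (exp (- ?c)) *
      (\<integral>\<^sup>+x. indicator E x * ennreal (exp (\<Sum>b<m. w b * x (j, b))) \<partial>\<gamma>))" by simp
  then show ?thesis by (simp add: mult.assoc[symmetric] ennreal_mult[symmetric] exp_add[symmetric])
qed

text \<open>With \<open>l\<close> the norm and \<open>r = sqrt m\<close>, integrate
  \<open>l \<le> (l\<^sup>2 / r + r) / 2\<close>, which follows from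
  \<open>0 \<le> (l - r)\<^sup>2\<close>; the squared norm has mean \<open>m\<close>.\<close>

lemma expectation_normals_row_norm:
  fixes q m :: nat
  defines "\<gamma> \<equiv> normals 1 ({..q} \<times> {..<m})"
  assumes j: "j \<le> q" and m: "1 \<le> m"
  shows "integrable \<gamma> (\<lambda>x. L2_set (\<lambda>i. x (j, i)) {..<m})"
    "(\<integral>x. L2_set (\<lambda>i. x (j, i)) {..<m} \<partial>\<gamma>) \<le> sqrt (real m)"
proof -
  interpret \<gamma>: prob_space \<gamma> unfolding \<gamma>_def by (rule prob_space_normals) simp
  have mo: "integrable \<gamma> (\<lambda>x. (x (j, i))\<^sup>2)" "(\<integral>x. (x (j, i))\<^sup>2 \<partial>\<gamma>) = 1" if "i < m" for i
    using integrable_normals_moments[of "{..q} \<times> {..<m}" "(j, i)" 1] j that by (auto simp: \<gamma>_def)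
  have me: "(\<lambda>x. x (j, i)) \<in> borel_measurable \<gamma>" if "i < m" for i
    unfolding \<gamma>_def using j that by (intro measurable_normals_component) auto
  have [measurable]: "(\<lambda>x. L2_set (\<lambda>i. x (j, i)) {..<m}) \<in> borel_measurable \<gamma>"
    unfolding L2_set_def using me by measurable
  let ?b = "\<lambda>x. ((\<Sum>i<m. (x (j, i))\<^sup>2) / sqrt (real m) + sqrt (real m)) / 2"
  have ib: "integrable \<gamma> ?b"
    by (intro integrable_divide Bochner_Integration.integrable_add Bochner_Integration.integrable_sum mo \<gamma>.integrable_const) auto
  have le: "L2_set (\<lambda>i. x (j, i)) {..<m} \<le> ?b x" for x
  proof -
    define l where "l = L2_set (\<lambda>i. x (j, i)) {..<m}"
    define r where "r = sqrt (real m)"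
    have r: "0 < r" using m by (simp add: r_def)
    have "0 \<le> (l - r)\<^sup>2" by simp
    then have "2 * (l * r) \<le> l\<^sup>2 + r * r" by (simp add: power2_diff power2_eq_square algebra_simps)
    then have "l \<le> (l\<^sup>2 / r + r) / 2" using r by (simp add: field_simps)
    then show ?thesis unfolding l_def r_def L2_set_squared .
  qed
  show i: "integrable \<gamma> (\<lambda>x. L2_set (\<lambda>i. x (j, i)) {..<m})"
  proof (rule Bochner_Integration.integrable_bound[OF ib])
    show "AE x in \<gamma>. norm (L2_set (\<lambda>i. x (j, i)) {..<m}) \<le> norm (?b x)"
      unfolding real_norm_def by (intro AE_I2) (simp only: abs_of_nonneg L2_set_nonneg order_trans[OF le abs_ge_self])
  qed measurable
  have "(\<integral>x. L2_set (\<lambda>i. x (j, i)) {..<m} \<partial>\<gamma>) \<le> (\<integral>x. ?b x \<partial>\<gamma>)"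
    by (rule integral_mono[OF i ib le])
  also have "\<dots> = (real m / sqrt (real m) + sqrt (real m)) / 2"
  proof -
    have "integrable \<gamma> (\<lambda>x. (\<Sum>i<m. (x (j, i))\<^sup>2) / sqrt (real m))"
      by (intro integrable_divide Bochner_Integration.integrable_sum mo) auto
    moreover have "(\<integral>x. (\<Sum>i<m. (x (j, i))\<^sup>2) \<partial>\<gamma>) = real m"
      by (subst Bochner_Integration.integral_sum) (auto simp: mo)
    ultimately show ?thesis
      using \<gamma>.prob_space by (simp add: Bochner_Integration.integral_add)
  qed
  also have "\<dots> = sqrt (real m)" by (simp add: real_div_sqrt)
  finally show "(\<integral>x. L2_set (\<lambda>i. x (j, i)) {..<m} \<partial>\<gamma>) \<le> sqrt (real m)" .
qed

lemma inner_Rn_le_L2_set: "inner_Rn m x y \<le> L2_set x {..<m} * L2_set y {..<m}"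
proof -
  have "inner_Rn m x y \<le> (\<Sum>i<m. \<bar>x i\<bar> * \<bar>y i\<bar>)"
    unfolding inner_Rn_def by (intro sum_mono) (metis abs_ge_self abs_mult)
  also have "\<dots> \<le> L2_set x {..<m} * L2_set y {..<m}" by (rule L2_set_mult_ineq)
  finally show ?thesis .
qed

section \<open>The random database\<close>

text \<open>Here \<open>q\<close> is the number of groups, \<open>k\<close> the number of copies in
  each group, and \<open>ts\<close> lists the net over which \<open>u\<close> maximises. The origin
  is the padding point.\<close>

locale fingerprinting =
  fixes m n k q :: nat and K :: "(nat \<Rightarrow> real) set" and \<epsilon> \<delta> \<alpha> :: real and A :: algorithm
    and ts :: "(nat \<Rightarrow> real) list"
  assumes m: "1 \<le> m" and k: "1 \<le> k" and q: "1 \<le> q" and kq: "k * q \<le> n"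
    and eps: "0 < \<epsilon>" and delta: "0 \<le> \<delta>" and alpha: "0 \<le> \<alpha>"
    and K: "K \<subseteq> unit_ball m" and zero: "(\<lambda>_. 0) \<in> K"
    and ts: "ts \<noteq> []" "set ts \<subseteq> K"
    and dp: "diff_private m K \<epsilon> \<delta> A" and accurate: "err m K A n \<le> ennreal \<alpha>"
begin

text \<open>Row \<open>0\<close> of a sample of \<open>\<gamma>\<close> is the hidden vector \<open>G\<close>, and row \<open>j \<ge> 1\<close> is \<open>g\<^sub>j\<close>.\<close>

definition "\<gamma> = normals 1 ({..q} \<times> {..<m})"
text \<open>Only \<open>k * q\<close> of the \<open>n\<close> points are not padding, and all lie in
  the unit ball, so \<rho> bounds the norm of the mean. Hence the truncation radius
  \<open>2 * \<rho>\<close> in \<open>mu\<close>.\<close>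

definition "\<rho> = real k * real q / real n"
definition "u y = argmax_list m ts y"
definition "z j x = (\<lambda>i. x (0 :: nat, i :: nat) + x (j, i) :: real)"
text \<open>The set of groups is a parameter because group \<open>j\<close> will be removed; the
  amount of padding stays the same, so the reduced database is smaller.\<close>

definition "db S x = (\<Sum>j\<in>S. replicate_mset k (u (z j x))) + replicate_mset (n - k * q) (\<lambda>_. 0 :: real)"
definition "mu d i = (\<integral>y. truncate m (2 * \<rho>) y i \<partial>A d)"
text \<open>The analogue of \<open>lstar\<close> for the net, with row 0 as the Gaussian
  vector.\<close>

definition "H = (\<integral>x. inner_Rn m (u (\<lambda>i. x (0, i))) (\<lambda>i. x (0, i)) \<partial>\<gamma>)"

lemma rho: "0 < \<rho>"
proof -
  have "1 \<le> k * q" using k q by simp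
  then have "1 \<le> n" using kq by linarith
  then show ?thesis using k q by (simp add: \<rho>_def)
qed

lemma n: "1 \<le> n"
proof -
  have "1 \<le> k * q" using k q by simp
  then show ?thesis using kq by linarith
qed

lemma prob_gamma: "prob_space \<gamma>"
  unfolding \<gamma>_def by (rule prob_space_normals) simp

lemma measurable_gamma: "a \<le> q \<Longrightarrow> i < m \<Longrightarrow> (\<lambda>x. x (a, i)) \<in> borel_measurable \<gamma>"
  unfolding \<gamma>_def by (intro measurable_normals_component) auto

lemma integrable_gamma: "a \<le> q \<Longrightarrow> i < m \<Longrightarrow> integrable \<gamma> (\<lambda>x. x (a, i))"
  unfolding \<gamma>_def by (intro integrable_normals_moments) auto

lemma u_in: "u y \<in> K"
  using argmax_list(1)[OF ts(1)] ts(2) unfolding u_def by blast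

lemma unit_ball_norm: "x \<in> K \<Longrightarrow> L2_set x {..<m} \<le> 1"
  using K by (auto simp: unit_ball_def)

lemma abs_u: "i < m \<Longrightarrow> \<bar>u y i\<bar> \<le> 1"
proof -
  assume "i < m"
  have "\<bar>u y i\<bar> \<le> L2_set (\<lambda>i. \<bar>u y i\<bar>) {..<m}"
    using \<open>i < m\<close> by (intro member_le_L2_set) auto
  also have "\<dots> = L2_set (u y) {..<m}" by (simp add: L2_set_def)
  finally show ?thesis using unit_ball_norm[OF u_in, of y] by linarith
qed

lemma u_max: "inner_Rn m (u y') y \<le> inner_Rn m (u y) y"
  unfolding u_def by (intro argmax_list ts)

lemma simple_u: "(\<And>i. i < m \<Longrightarrow> (\<lambda>x. f x i) \<in> borel_measurable M) \<Longrightarrow> simple_function M (\<lambda>x. u (f x))"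
  unfolding u_def by (rule simple_function_argmax_list[OF ts(1)])

lemma u_cong: "(\<And>i. i < m \<Longrightarrow> y i = y' i) \<Longrightarrow> u y = u y'"
  unfolding u_def by (rule argmax_list_cong)

lemma simple_u_z: "j \<le> q \<Longrightarrow> simple_function \<gamma> (\<lambda>x. u (z j x))"
  unfolding z_def by (intro simple_u borel_measurable_add measurable_gamma) auto

lemma simple_db: "S \<subseteq> {..q} \<Longrightarrow> simple_function \<gamma> (db S)"
proof -
  assume S: "S \<subseteq> {..q}"
  have "simple_function \<gamma> (\<lambda>x. \<Sum>j\<in>S. replicate_mset k (u (z j x)))"
  proof -
    have "finite S" using S finite_subset by blast
    then show ?thesis using S
    proof induction
      case empty
      then show ?case by simp
    next
      case (insert j S)
      have "simple_function \<gamma> (\<lambda>x. replicate_mset k (u (z j x)))"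
        using simple_function_compose1[OF simple_u_z[of j], of "replicate_mset k"] insert by auto
      then have "simple_function \<gamma> (\<lambda>x. replicate_mset k (u (z j x)) + (\<Sum>j\<in>S. replicate_mset k (u (z j x))))"
        using insert by (intro simple_function_compose2[where h = "(+)"]) auto
      then show ?case using insert by simp
    qed
  qed
  then show ?thesis unfolding db_def[abs_def] by (rule simple_function_compose1)
qed

lemma db_props:
  assumes "finite S"
  shows "db S x \<in> databases K" "size (db S x) = k * card S + (n - k * q)"
    "(\<Sum>v\<in>#db S x. v i) = real k * (\<Sum>j\<in>S. u (z j x) i)"
  unfolding db_def using assms
  by (induction) (auto simp: databases_def in_replicate_mset zero u_in algebra_simps image_replicate_mset
      sum_mset_replicate_mset split: if_splits)

lemma db_remove:
  assumes "j \<in> {0<..q}"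
  shows "db {0<..q} x = db ({0<..q} - {j}) x + replicate_mset k (u (z j x))"
  unfolding db_def using assms by (simp add: sum.remove[of "{0<..q}" j] add_ac)

lemma alg: "d \<in> databases K \<Longrightarrow> prob_space (A d) \<and> sets (A d) = sets (borel_Rn m)"
  using dp by (auto simp: diff_private_def is_algorithm_def)

lemma integrable_truncate:
  assumes "d \<in> databases K" "i < m"
  shows "integrable (A d) (\<lambda>y. truncate m (2 * \<rho>) y i)"
proof -
  interpret P: prob_space "A d" using alg assms by blast
  note [measurable_cong] = conjunct2[OF alg[OF assms(1)]]
  show ?thesis
    by (rule P.integrable_const_bound[where B = "2 * \<rho>"]) (use abs_truncate_le[of "2 * \<rho>" i m] rho assms in auto)
qed

lemma abs_mu:
  assumes "d \<in> databases K" "i < m"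
  shows "\<bar>mu d i\<bar> \<le> 2 * \<rho>"
proof -
  interpret P: prob_space "A d" using alg assms by blast
  have "\<bar>mu d i\<bar> \<le> (\<integral>y. \<bar>truncate m (2 * \<rho>) y i\<bar> \<partial>A d)"
    unfolding mu_def by (rule integral_abs_bound)
  also have "\<dots> \<le> (\<integral>y. 2 * \<rho> \<partial>A d)"
    using integrable_truncate[OF assms] abs_truncate_le[of "2 * \<rho>" i m] rho assms by (intro integral_mono) auto
  finally show ?thesis using P.prob_space by simp
qed

text \<open>By the triangle inequality the mean of the database has norm at most \<rho>. The
  truncation radius is twice that, so the expected truncated output inherits the accuracy.\<close>

lemma mu_error:
  "L2_set (\<lambda>i. mu (db {0<..q} x) i - real k / real n * (\<Sum>j\<in>{0<..q}. u (z j x) i)) {..<m} \<le> \<alpha>"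
proof -
  let ?d = "db {0<..q} x"
  have d: "?d \<in> databases K" "size ?d = n"
    using db_props[where S = "{0<..q}" and x = x] kq by auto
  have mean: "db_mean ?d = (\<lambda>i. real k / real n * (\<Sum>j\<in>{0<..q}. u (z j x) i))"
    unfolding db_mean_def d(2) db_props(3)[OF finite_greaterThanAtMost] by simp
  have "L2_set (db_mean ?d) {..<m} = real k / real n * L2_set (\<lambda>i. \<Sum>j\<in>{0<..q}. u (z j x) i) {..<m}"
    unfolding mean by (rule L2_set_right_distrib[symmetric]) simp
  also have "L2_set (\<lambda>i. \<Sum>j\<in>{0<..q}. u (z j x) i) {..<m} \<le> (\<Sum>j\<in>{0<..q}. L2_set (u (z j x)) {..<m})"
  proof -
    have "L2_set (\<lambda>i. \<Sum>j\<in>S. u (z j x) i) {..<m} \<le> (\<Sum>j\<in>S. L2_set (u (z j x)) {..<m})" if "finite S" for S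
      using that
    proof induction
      case empty
      then show ?case by (simp add: L2_set_def)
    next
      case (insert j S)
      then show ?case
        using L2_set_triangle_ineq[of "u (z j x)" "\<lambda>i. \<Sum>j\<in>S. u (z j x) i" "{..<m}"] by simp
    qed
    then show ?thesis by simp
  qed
  also have "\<dots> \<le> (\<Sum>j\<in>{0<..q}. 1)" by (intro sum_mono unit_ball_norm u_in)
  finally have "L2_set (db_mean ?d) {..<m} \<le> \<rho>"
    using n by (simp add: \<rho>_def mult_left_mono divide_right_mono)
  moreover have "ennreal_sqrt (\<integral>\<^sup>+y. ennreal ((L2_set (\<lambda>i. y i - db_mean ?d i) {..<m})\<^sup>2) \<partial>A ?d) \<le> ennreal \<alpha>"
    using accurate d unfolding err_def by (auto simp: SUP_le_iff)
  ultimately have "L2_set (\<lambda>i. (\<integral>y. truncate m (2 * \<rho>) y i \<partial>A ?d) - db_mean ?d i) {..<m} \<le> \<alpha>"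
    using alg[OF d(1)] rho alpha by (intro truncated_mean_error) auto
  then show ?thesis unfolding mean mu_def .
qed

text \<open>The random database takes finitely many values on measurable events, so
  \<open>mu\<close> may depend on it arbitrarily.\<close>

lemma measurable_mu: "(\<lambda>x. mu (db {0<..q} x) i) \<in> borel_measurable \<gamma>"
  by (rule borel_measurable_simple_function[OF
        simple_function_compose1[OF simple_db[of "{0<..q}"], of "\<lambda>d. mu d i"]]) auto

lemma measurable_u_z: "j \<le> q \<Longrightarrow> (\<lambda>x. u (z j x) i) \<in> borel_measurable \<gamma>"
  using simple_function_compose1[OF simple_u_z[of j], of "\<lambda>v. v i"]
  by (intro borel_measurable_simple_function)

lemma measurable_u_0: "(\<lambda>x. u (\<lambda>i. x (0, i)) i) \<in> borel_measurable \<gamma>"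
  using simple_function_compose1[OF simple_u[of "\<lambda>x i. x (0, i)" \<gamma>], of "\<lambda>v. v i"]
  by (intro borel_measurable_simple_function) (simp add: measurable_gamma)

lemma integrable_bounded_mult:
  assumes "F \<in> borel_measurable \<gamma>" "\<And>x. \<bar>F x\<bar> \<le> (B :: real)" "integrable \<gamma> g"
  shows "integrable \<gamma> (\<lambda>x. F x * g x)"
proof (rule Bochner_Integration.integrable_bound)
  show "integrable \<gamma> (\<lambda>x. B * g x)" using assms by simp
  show "AE x in \<gamma>. norm (F x * g x) \<le> norm (B * g x)"
    using assms(2) by (intro AE_I2) (auto simp: abs_mult intro!: mult_right_mono order_trans[OF assms(2) abs_ge_self])
qed (use assms in measurable)

lemma integrable_mu: "a \<le> q \<Longrightarrow> i < m \<Longrightarrow> integrable \<gamma> (\<lambda>x. mu (db {0<..q} x) i * x (a, i))"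
  using abs_mu db_props(1)[where S = "{0<..q}"]
  by (intro integrable_bounded_mult[where B = "2 * \<rho>"] measurable_mu integrable_gamma) auto

lemma integrable_u_z: "j \<le> q \<Longrightarrow> a \<le> q \<Longrightarrow> i < m \<Longrightarrow> integrable \<gamma> (\<lambda>x. u (z j x) i * x (a, i))"
  using abs_u by (intro integrable_bounded_mult[where B = 1] measurable_u_z integrable_gamma) auto

lemma integrable_u_0: "a \<le> q \<Longrightarrow> i < m \<Longrightarrow> integrable \<gamma> (\<lambda>x. u (\<lambda>i. x (0, i)) i * x (a, i))"
  using abs_u by (intro integrable_bounded_mult[where B = 1] measurable_u_0 integrable_gamma) auto

text \<open>The data depend only on the sums \<open>z j x\<close>, which are unchanged when row \<open>0\<close> moves by \<open>t\<close> and all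
  other rows by \<open>- t\<close>.\<close>

lemma correlation_mu:
  assumes "i < m"
  shows "(\<Sum>j\<in>{0<..q}. \<integral>x. mu (db {0<..q} x) i * x (j, i) \<partial>\<gamma>) = (\<integral>x. mu (db {0<..q} x) i * x (0, i) \<partial>\<gamma>)"
proof -
  let ?c = "\<lambda>a::nat. if a = 0 then 1 else - 1 :: real"
  have "(\<integral>x. mu (db {0<..q} x) i * (\<Sum>a\<le>q. ?c a * x (a, i)) \<partial>\<gamma>) = 0"
    unfolding \<gamma>_def
  proof (rule integral_column_shift_invariant[OF assms, where B = "2 * \<rho>"])
    show "\<bar>mu (db {0<..q} x) i\<bar> \<le> 2 * \<rho>" for x by (intro abs_mu db_props assms) simp
    fix x x' :: "nat \<times> nat \<Rightarrow> real" and t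
    assume x': "\<And>a b. a \<le> q \<Longrightarrow> b < m \<Longrightarrow> x' (a, b) = x (a, b) + (if b = i then t * ?c a else 0)"
    have "u (z j x') = u (z j x)" if "j \<in> {0<..q}" for j
      using that by (intro u_cong) (auto simp: z_def x')
    then have "db {0<..q} x' = db {0<..q} x" unfolding db_def by simp
    then show "mu (db {0<..q} x') i = mu (db {0<..q} x) i" by simp
  qed (use measurable_mu in \<open>simp add: \<gamma>_def\<close>)
  moreover have "(\<Sum>a\<le>q. ?c a * x (a, i)) = x (0, i) - (\<Sum>j\<in>{0<..q}. x (j, i))" for x :: "nat \<times> nat \<Rightarrow> real"
  proof -
    have "{..q} = insert 0 {0<..q}" by auto
    then have "(\<Sum>a\<le>q. ?c a * x (a, i)) = x (0, i) + (\<Sum>a\<in>{0<..q}. ?c a * x (a, i))" by simp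
    also have "(\<Sum>a\<in>{0<..q}. ?c a * x (a, i)) = (\<Sum>a\<in>{0<..q}. - x (a, i))" by (intro sum.cong) auto
    finally show ?thesis by (simp add: sum_negf)
  qed
  ultimately have "(\<integral>x. mu (db {0<..q} x) i * x (0, i) - (\<Sum>j\<in>{0<..q}. mu (db {0<..q} x) i * x (j, i)) \<partial>\<gamma>) = 0"
    by (simp add: right_diff_distrib sum_distrib_left)
  then have "(\<integral>x. mu (db {0<..q} x) i * x (0, i) \<partial>\<gamma>) - (\<integral>x. (\<Sum>j\<in>{0<..q}. mu (db {0<..q} x) i * x (j, i)) \<partial>\<gamma>) = 0"
    by (subst (asm) Bochner_Integration.integral_diff)
      (auto intro!: Bochner_Integration.integrable_sum integrable_mu assms)
  then show ?thesis
    by (subst (asm) Bochner_Integration.integral_sum) (auto intro!: integrable_mu assms)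
qed

text \<open>Moving rows 0 and \<open>j\<close> by opposite amounts leaves \<open>z j x\<close>
  unchanged, so a function of the sum is equally correlated with both summands.\<close>

lemma correlation_u_z:
  assumes "i < m" "j \<in> {0<..q}"
  shows "(\<integral>x. u (z j x) i * x (0, i) \<partial>\<gamma>) = (\<integral>x. u (z j x) i * x (j, i) \<partial>\<gamma>)"
proof -
  let ?c = "\<lambda>a::nat. if a = 0 then 1 else if a = j then - 1 else 0 :: real"
  have "(\<integral>x. u (z j x) i * (\<Sum>a\<le>q. ?c a * x (a, i)) \<partial>\<gamma>) = 0"
    unfolding \<gamma>_def
  proof (rule integral_column_shift_invariant[OF assms(1), where B = 1])
    fix x x' :: "nat \<times> nat \<Rightarrow> real" and t
    assume x': "\<And>a b. a \<le> q \<Longrightarrow> b < m \<Longrightarrow> x' (a, b) = x (a, b) + (if b = i then t * ?c a else 0)"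
    have "u (z j x') = u (z j x)" using assms(2) by (intro u_cong) (auto simp: z_def x')
    then show "u (z j x') i = u (z j x) i" by simp
  qed (use abs_u assms measurable_u_z[of j] in \<open>simp_all add: \<gamma>_def\<close>)
  moreover have "(\<Sum>a\<le>q. ?c a * x (a, i)) = x (0, i) - x (j, i)" for x :: "nat \<times> nat \<Rightarrow> real"
  proof -
    have "(\<Sum>a\<le>q. ?c a * x (a, i)) = (\<Sum>a\<le>q. (if a = 0 then x (0, i) else 0) - (if a = j then x (j, i) else 0))"
      using assms by (intro sum.cong) auto
    then show ?thesis using assms by (simp add: sum_subtractf)
  qed
  ultimately have "(\<integral>x. u (z j x) i * x (0, i) - u (z j x) i * x (j, i) \<partial>\<gamma>) = 0"
    by (simp add: right_diff_distrib)
  then show ?thesis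
    using assms by (subst (asm) Bochner_Integration.integral_diff) (auto intro!: integrable_u_z)
qed

lemma correlation_u_0:
  assumes "i < m" "j \<in> {0<..q}"
  shows "(\<integral>x. u (\<lambda>i. x (0, i)) i * x (j, i) \<partial>\<gamma>) = 0"
proof -
  let ?c = "\<lambda>a::nat. if a = j then 1 else 0 :: real"
  have "(\<integral>x. u (\<lambda>i. x (0, i)) i * (\<Sum>a\<le>q. ?c a * x (a, i)) \<partial>\<gamma>) = 0"
    unfolding \<gamma>_def
  proof (rule integral_column_shift_invariant[OF assms(1), where B = 1])
    fix x x' :: "nat \<times> nat \<Rightarrow> real" and t
    assume x': "\<And>a b. a \<le> q \<Longrightarrow> b < m \<Longrightarrow> x' (a, b) = x (a, b) + (if b = i then t * ?c a else 0)"
    have "u (\<lambda>i. x' (0, i)) = u (\<lambda>i. x (0, i))" using assms(2) by (intro u_cong) (auto simp: x')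
    then show "u (\<lambda>i. x' (0, i)) i = u (\<lambda>i. x (0, i)) i" by simp
  qed (use abs_u assms measurable_u_0 in \<open>simp_all add: \<gamma>_def\<close>)
  moreover have "(\<Sum>a\<le>q. ?c a * x (a, i)) = x (j, i)" for x :: "nat \<times> nat \<Rightarrow> real"
  proof -
    have "(\<Sum>a\<le>q. ?c a * x (a, i)) = (\<Sum>a\<le>q. if a = j then x (j, i) else 0)"
      using assms by (intro sum.cong) auto
    then show ?thesis using assms by simp
  qed
  ultimately show ?thesis by simp
qed

section \<open>The total score from below\<close>

text \<open>The correlation of \<open>u (z j x)\<close> with row 0 is half of that with
  \<open>z j x\<close>. At \<open>z j x\<close> this maximiser does at least as well as the
  maximiser for row 0, whose correlation with \<open>z j x\<close> is \<open>H\<close>, because row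
  \<open>j\<close> is centred and independent of row 0.\<close>

lemma correlation_lower:
  assumes j: "j \<in> {0<..q}"
  shows "H / 2 \<le> (\<Sum>i<m. \<integral>x. u (z j x) i * x (0, i) \<partial>\<gamma>)"
proof -
  have "H = (\<Sum>i<m. \<integral>x. u (\<lambda>i. x (0, i)) i * x (0, i) \<partial>\<gamma>)"
    unfolding H_def inner_Rn_def by (rule Bochner_Integration.integral_sum) (auto intro: integrable_u_0)
  also have "\<dots> = (\<Sum>i<m. \<integral>x. u (\<lambda>i. x (0, i)) i * x (0, i) + u (\<lambda>i. x (0, i)) i * x (j, i) \<partial>\<gamma>)"
    using j by (intro sum.cong refl) (simp add: Bochner_Integration.integral_add integrable_u_0 correlation_u_0)
  also have "\<dots> = (\<integral>x. inner_Rn m (u (\<lambda>i. x (0, i))) (z j x) \<partial>\<gamma>)"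
    unfolding inner_Rn_def z_def distrib_left using j
    by (intro Bochner_Integration.integral_sum[symmetric] Bochner_Integration.integrable_add integrable_u_0) auto
  also have "\<dots> \<le> (\<integral>x. inner_Rn m (u (z j x)) (z j x) \<partial>\<gamma>)"
  proof (rule integral_mono)
    show "integrable \<gamma> (\<lambda>x. inner_Rn m (u (\<lambda>i. x (0, i))) (z j x))"
      unfolding inner_Rn_def z_def distrib_left using j
      by (intro Bochner_Integration.integrable_sum Bochner_Integration.integrable_add integrable_u_0) auto
    show "integrable \<gamma> (\<lambda>x. inner_Rn m (u (z j x)) (z j x))"
      unfolding inner_Rn_def z_def distrib_left using j
      by (intro Bochner_Integration.integrable_sum Bochner_Integration.integrable_add integrable_u_z[unfolded z_def]) auto
  qed (rule u_max)
  also have "\<dots> = (\<Sum>i<m. \<integral>x. u (z j x) i * x (0, i) + u (z j x) i * x (j, i) \<partial>\<gamma>)"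
    unfolding inner_Rn_def using j
    by (subst Bochner_Integration.integral_sum[symmetric]) (auto simp: z_def distrib_left intro!: integrable_u_z[unfolded z_def])
  also have "\<dots> = (\<Sum>i<m. 2 * (\<integral>x. u (z j x) i * x (0, i) \<partial>\<gamma>))"
    using j by (intro sum.cong refl) (simp add: Bochner_Integration.integral_add integrable_u_z correlation_u_z)
  also have "\<dots> = 2 * (\<Sum>i<m. \<integral>x. u (z j x) i * x (0, i) \<partial>\<gamma>)" by (simp add: sum_distrib_left)
  finally show ?thesis by simp
qed

definition "score j = (\<Sum>i<m. \<integral>x. mu (db {0<..q} x) i * x (j, i) \<partial>\<gamma>)"

text \<open>By \<open>correlation_mu\<close> the total score is the correlation of the mean output
  with row 0. Replacing the mean output by the database mean costs at most \<alpha> times the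
  expected norm of row 0, and the database mean collects \<open>(k / n) * (H / 2)\<close> from each
  of the \<open>q\<close> groups.\<close>

lemma completeness: "\<rho> * (H / 2) - \<alpha> * sqrt (real m) \<le> (\<Sum>j\<in>{0<..q}. score j)"
proof -
  let ?v = "\<lambda>x i. real k / real n * (\<Sum>j\<in>{0<..q}. u (z j x) i)"
  let ?e = "\<lambda>x i. mu (db {0<..q} x) i - ?v x i"
  have "(\<Sum>j\<in>{0<..q}. score j) = (\<Sum>i<m. \<Sum>j\<in>{0<..q}. \<integral>x. mu (db {0<..q} x) i * x (j, i) \<partial>\<gamma>)"
    unfolding score_def by (rule sum.swap)
  also have "\<dots> = (\<Sum>i<m. \<integral>x. mu (db {0<..q} x) i * x (0, i) \<partial>\<gamma>)"
    by (intro sum.cong refl correlation_mu) auto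
  also have "\<dots> = (\<integral>x. (\<Sum>i<m. mu (db {0<..q} x) i * x (0, i)) \<partial>\<gamma>)"
    by (rule Bochner_Integration.integral_sum[symmetric]) (auto intro!: integrable_mu)
  finally have s: "(\<Sum>j\<in>{0<..q}. score j) = (\<integral>x. (\<Sum>i<m. mu (db {0<..q} x) i * x (0, i)) \<partial>\<gamma>)" .
  have iv: "integrable \<gamma> (\<lambda>x. ?v x i * x (0, i))" if "i < m" for i
  proof -
    have "integrable \<gamma> (\<lambda>x. real k / real n * (\<Sum>j\<in>{0<..q}. u (z j x) i * x (0, i)))"
      using that by (intro integrable_mult_right Bochner_Integration.integrable_sum integrable_u_z) auto
    then show ?thesis by (simp add: mult.assoc sum_distrib_right)
  qed
  have "q * (real k / real n * (H / 2)) = (\<Sum>j\<in>{0<..q}. real k / real n * (H / 2))" by simp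
  also have "\<dots> \<le> (\<Sum>j\<in>{0<..q}. real k / real n * (\<Sum>i<m. \<integral>x. u (z j x) i * x (0, i) \<partial>\<gamma>))"
    by (intro sum_mono mult_left_mono correlation_lower) auto
  also have "\<dots> = (\<Sum>i<m. real k / real n * (\<Sum>j\<in>{0<..q}. \<integral>x. u (z j x) i * x (0, i) \<partial>\<gamma>))"
    unfolding sum_distrib_left by (rule sum.swap)
  also have "\<dots> = (\<Sum>i<m. \<integral>x. ?v x i * x (0, i) \<partial>\<gamma>)"
    by (intro sum.cong refl)
      (simp add: mult.assoc sum_distrib_right Bochner_Integration.integral_sum integrable_u_z)
  also have "\<dots> = (\<integral>x. (\<Sum>i<m. ?v x i * x (0, i)) \<partial>\<gamma>)"
    by (rule Bochner_Integration.integral_sum[symmetric]) (rule iv, simp)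
  finally have v: "\<rho> * (H / 2) \<le> (\<integral>x. (\<Sum>i<m. ?v x i * x (0, i)) \<partial>\<gamma>)"
    by (simp add: \<rho>_def mult_ac)
  note norm = expectation_normals_row_norm[of 0 q m, folded \<gamma>_def, OF _ m, simplified]
  have pt: "(\<Sum>i<m. ?v x i * x (0, i)) - \<alpha> * L2_set (\<lambda>i. x (0, i)) {..<m} \<le>
      (\<Sum>i<m. mu (db {0<..q} x) i * x (0, i))" for x
  proof -
    have "inner_Rn m (\<lambda>i. - ?e x i) (\<lambda>i. x (0, i)) \<le> L2_set (\<lambda>i. - ?e x i) {..<m} * L2_set (\<lambda>i. x (0, i)) {..<m}"
      by (rule inner_Rn_le_L2_set)
    also have "L2_set (\<lambda>i. - ?e x i) {..<m} = L2_set (?e x) {..<m}"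
      unfolding L2_set_def by (simp only: power2_minus)
    also have "L2_set (?e x) {..<m} * L2_set (\<lambda>i. x (0, i)) {..<m} \<le> \<alpha> * L2_set (\<lambda>i. x (0, i)) {..<m}"
      by (intro mult_right_mono mu_error L2_set_nonneg)
    finally show ?thesis
      unfolding inner_Rn_def by (simp add: left_diff_distrib sum_subtractf)
  qed
  have "\<rho> * (H / 2) - \<alpha> * sqrt (real m) \<le>
      (\<integral>x. (\<Sum>i<m. ?v x i * x (0, i)) \<partial>\<gamma>) - \<alpha> * (\<integral>x. L2_set (\<lambda>i. x (0, i)) {..<m} \<partial>\<gamma>)"
    using v norm(2) alpha by (intro diff_mono mult_left_mono) auto
  also have "\<dots> = (\<integral>x. (\<Sum>i<m. ?v x i * x (0, i)) - \<alpha> * L2_set (\<lambda>i. x (0, i)) {..<m} \<partial>\<gamma>)"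
    using norm(1) iv by (subst Bochner_Integration.integral_diff) auto
  also have "\<dots> \<le> (\<integral>x. (\<Sum>i<m. mu (db {0<..q} x) i * x (0, i)) \<partial>\<gamma>)"
    using norm(1) iv pt
    by (intro integral_mono Bochner_Integration.integrable_diff Bochner_Integration.integrable_sum integrable_mu) auto
  finally show ?thesis unfolding s .
qed

end

section \<open>Each score from above\<close>

context fingerprinting
begin

definition "ip j y x = (\<Sum>i<m. truncate m (2 * \<rho>) y i * x (j :: nat, i))"

lemma ip_le: "ip j y x \<le> 2 * \<rho> * L2_set (\<lambda>i. x (j, i)) {..<m}"
proof -
  have "ip j y x \<le> L2_set (truncate m (2 * \<rho>) y) {..<m} * L2_set (\<lambda>i. x (j, i)) {..<m}"
    using inner_Rn_le_L2_set[of m "truncate m (2 * \<rho>) y" "\<lambda>i. x (j, i)"] by (simp add: ip_def inner_Rn_def)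
  also have "\<dots> \<le> 2 * \<rho> * L2_set (\<lambda>i. x (j, i)) {..<m}"
    using rho by (intro mult_right_mono L2_set_truncate) auto
  finally show ?thesis .
qed

lemma measurable_ip: "d \<in> databases K \<Longrightarrow> (\<lambda>y. ip j y x) \<in> borel_measurable (A d)"
  unfolding ip_def using alg[of d] by (simp cong: measurable_cong_sets)

lemma integrable_exp_ip:
  assumes d: "d \<in> databases K" and "0 \<le> \<theta>"
  shows "integrable (A d) (\<lambda>y. exp (\<theta> * ip j y x))"
proof -
  interpret P: prob_space "A d" using alg d by blast
  have [measurable]: "(\<lambda>y. ip j y x) \<in> borel_measurable (A d)" by (rule measurable_ip[OF d])
  show ?thesis
    by (rule P.integrable_const_bound[where B = "exp (\<theta> * (2 * \<rho> * L2_set (\<lambda>i. x (j, i)) {..<m}))"])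
      (auto intro!: mult_left_mono ip_le assms)
qed

lemma mu_ip:
  assumes "d \<in> databases K"
  shows "(\<Sum>i<m. mu d i * x (j, i)) = (\<integral>y. ip j y x \<partial>A d)" "integrable (A d) (\<lambda>y. ip j y x)"
  using assms unfolding mu_def ip_def
  by (auto simp: Bochner_Integration.integral_sum integrable_truncate)

text \<open>Only the excess of the correlation over the threshold \<tau> is transferred to the
  database without group \<open>j\<close>, so the factor \<open>exp L\<close> does not multiply
  \<tau>. The excess is nonnegative and bounded, as the transfer requires, and afterwards it is
  dominated by an exponential moment.\<close>

lemma score_pointwise:
  assumes j: "j \<in> {0<..q}" and \<theta>: "0 < \<theta>" and \<tau>: "0 \<le> \<tau>"
  defines "L \<equiv> real k * \<epsilon>" and "d' \<equiv> \<lambda>x. db ({0<..q} - {j}) x"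
  shows "(\<Sum>i<m. mu (db {0<..q} x) i * x (j, i)) \<le>
    \<tau> + exp L * (exp (- \<theta> * \<tau>) / \<theta>) * (\<integral>y. exp (\<theta> * ip j y x) \<partial>A (d' x)) +
    real k * \<delta> * exp L * (2 * \<rho> * L2_set (\<lambda>i. x (j, i)) {..<m})"
proof -
  let ?d = "db {0<..q} x"
  let ?B = "2 * \<rho> * L2_set (\<lambda>i. x (j, i)) {..<m}"
  define \<phi> where "\<phi> y = max 0 (ip j y x - \<tau>)" for y
  have d: "?d \<in> databases K" and d': "d' x \<in> databases K" unfolding d'_def by (intro db_props; simp)+
  have dd: "?d = d' x + replicate_mset k (u (z j x))" unfolding d'_def by (rule db_remove[OF j])
  interpret P: prob_space "A ?d" using alg d by blast
  interpret Q: prob_space "A (d' x)" using alg d' by blast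
  have B0: "0 \<le> ?B" using rho by simp
  have \<phi>B: "0 \<le> \<phi> y" "\<phi> y \<le> ?B" for y
    using ip_le[of j y x] \<tau> B0 by (auto simp: \<phi>_def)
  have [measurable]: "\<phi> \<in> borel_measurable (A ?d)" "\<phi> \<in> borel_measurable (A (d' x))"
    using measurable_ip[OF d] measurable_ip[OF d'] unfolding \<phi>_def[abs_def] by (measurable; simp)+
  have iP: "integrable (A ?d) \<phi>" by (rule P.integrable_const_bound[where B = ?B]) (auto simp: \<phi>B)
  have iQ: "integrable (A (d' x)) \<phi>" by (rule Q.integrable_const_bound[where B = ?B]) (auto simp: \<phi>B)
  have "(\<Sum>i<m. mu ?d i * x (j, i)) \<le> (\<integral>y. \<tau> + \<phi> y \<partial>A ?d)"
    unfolding mu_ip(1)[OF d] using iP mu_ip(2)[OF d] by (intro integral_mono) (auto simp: \<phi>_def)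
  also have "\<dots> = \<tau> + (\<integral>y. \<phi> y \<partial>A ?d)" using iP P.prob_space by simp
  also have "(\<integral>y. \<phi> y \<partial>A ?d) \<le> exp L * (\<integral>y. \<phi> y \<partial>A (d' x)) + real k * \<delta> * exp L * ?B"
  proof (rule integral_le_of_measure_le)
    show "sets (A ?d) = sets (A (d' x))" using alg[OF d] alg[OF d'] by simp
    show "measure (A ?d) S \<le> exp L * measure (A (d' x)) S + real k * \<delta> * exp L" if "S \<in> sets (A ?d)" for S
      unfolding dd L_def using diff_private_group[OF dp _ delta d' u_in, of S k "z j x"] eps alg[OF d] that by simp
  qed (use delta \<phi>B in \<open>auto intro: P.prob_space_axioms Q.prob_space_axioms\<close>)
  also have "(\<integral>y. \<phi> y \<partial>A (d' x)) \<le> (\<integral>y. exp (- \<theta> * \<tau>) / \<theta> * exp (\<theta> * ip j y x) \<partial>A (d' x))"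
  proof (rule integral_mono[OF iQ])
    show "integrable (A (d' x)) (\<lambda>y. exp (- \<theta> * \<tau>) / \<theta> * exp (\<theta> * ip j y x))"
      using integrable_exp_ip[OF d'] \<theta> by simp
    fix y
    \<comment> \<open>The exponential function dominates the identity; dividing by \<theta> bounds
      the excess.\<close>
    have "\<theta> * (ip j y x - \<tau>) \<le> exp (\<theta> * (ip j y x - \<tau>))"
      using exp_ge_add_one_self[of "\<theta> * (ip j y x - \<tau>)"] by linarith
    then have "ip j y x - \<tau> \<le> exp (\<theta> * (ip j y x - \<tau>)) / \<theta>" using \<theta> by (simp add: field_simps)
    then have "\<phi> y \<le> exp (\<theta> * (ip j y x - \<tau>)) / \<theta>" using \<theta> by (simp add: \<phi>_def)
    also have "\<dots> = exp (- \<theta> * \<tau>) / \<theta> * exp (\<theta> * ip j y x)"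
      by (simp add: exp_add[symmetric] right_diff_distrib)
    finally show "\<phi> y \<le> \<dots>" .
  qed
  finally show ?thesis by (simp add: mult.assoc)
qed

text \<open>Without the points of group \<open>j\<close> the output is independent of row \<open>j\<close>.\<close>

lemma independent_row_exp:
  assumes j: "j \<in> {0<..q}" and \<theta>: "0 \<le> \<theta>"
  defines "d' \<equiv> \<lambda>x. db ({0<..q} - {j}) x"
  shows "integrable \<gamma> (\<lambda>x. \<integral>y. exp (\<theta> * ip j y x) \<partial>A (d' x))"
    "(\<integral>x. (\<integral>y. exp (\<theta> * ip j y x) \<partial>A (d' x)) \<partial>\<gamma>) \<le> exp (2 * \<theta>\<^sup>2 * \<rho>\<^sup>2)"
proof -
  interpret \<gamma>: prob_space \<gamma> by (rule prob_gamma)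
  let ?R = "d' ` space \<gamma>"
  let ?E = "\<lambda>d. d' -` {d} \<inter> space \<gamma>"
  let ?f = "\<lambda>x y. ennreal (exp (\<theta> * ip j y x))"
  have dK: "d' x \<in> databases K" for x unfolding d'_def by (intro db_props) simp
  have "simple_function \<gamma> d'" unfolding d'_def by (rule simple_db) auto
  then have R: "finite ?R" and E: "?E d \<in> sets \<gamma>" for d
    by (auto dest: simple_functionD)
  have nn: "(\<integral>\<^sup>+y. ?f x y \<partial>A (d' x)) = ennreal (\<integral>y. exp (\<theta> * ip j y x) \<partial>A (d' x))" for x
    by (rule nn_integral_eq_integral) (use integrable_exp_ip[OF dK \<theta>] in auto)
  have meas: "case_prod ?f \<in> borel_measurable (\<gamma> \<Otimes>\<^sub>M A d)" if "d \<in> databases K" for d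
  proof -
    note [measurable_cong] = conjunct2[OF alg[OF that]]
    have "(\<lambda>p. fst p (j, i)) \<in> borel_measurable (\<gamma> \<Otimes>\<^sub>M A d)" if "i < m" for i
      using j that by (intro measurable_compose[OF measurable_fst] measurable_gamma) auto
    moreover have "(\<lambda>p. truncate m (2 * \<rho>) (snd p) i) \<in> borel_measurable (\<gamma> \<Otimes>\<^sub>M A d)" for i
      by (intro measurable_compose[OF measurable_snd]) measurable
    ultimately have "(\<lambda>p. ip j (snd p) (fst p)) \<in> borel_measurable (\<gamma> \<Otimes>\<^sub>M A d)"
      unfolding ip_def by (intro borel_measurable_sum borel_measurable_times) auto
    then show ?thesis by (simp add: case_prod_beta')
  qed
  \<comment> \<open>Exchanging the integrals needs a fixed output distribution, so the sample space
    is split by the finitely many values \<open>d\<close> of the reduced database.\<close>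
  have sep: "(\<integral>\<^sup>+y. ?f x y \<partial>A (d' x)) = (\<Sum>d\<in>?R. indicator (?E d) x * (\<integral>\<^sup>+y. ?f x y \<partial>A d))"
    if "x \<in> space \<gamma>" for x
  proof -
    have "(\<Sum>d\<in>?R. indicator (?E d) x * (\<integral>\<^sup>+y. ?f x y \<partial>A d)) =
        (\<Sum>d\<in>?R. if d = d' x then (\<integral>\<^sup>+y. ?f x y \<partial>A (d' x)) else 0)"
      using that by (intro sum.cong) (auto simp: indicator_def)
    then show ?thesis using that R by simp
  qed
  have inner_meas: "(\<lambda>x. \<integral>\<^sup>+y. ?f x y \<partial>A d) \<in> borel_measurable \<gamma>" if d: "d \<in> databases K" for d
  proof -
    interpret P: prob_space "A d" using alg d by blast
    show ?thesis by (rule P.borel_measurable_nn_integral[OF meas[OF d]])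
  qed
  have bound: "(\<integral>\<^sup>+x. indicator (?E d) x * (\<integral>\<^sup>+y. ?f x y \<partial>A d) \<partial>\<gamma>) \<le>
      ennreal (exp (2 * \<theta>\<^sup>2 * \<rho>\<^sup>2)) * emeasure \<gamma> (?E d)" if d: "d \<in> databases K" for d
  proof -
    interpret P: prob_space "A d" using alg d by blast
    interpret pair_sigma_finite \<gamma> "A d" ..
    have "(\<integral>\<^sup>+x. indicator (?E d) x * (\<integral>\<^sup>+y. ?f x y \<partial>A d) \<partial>\<gamma>) =
        (\<integral>\<^sup>+x. (\<integral>\<^sup>+y. indicator (?E d) x * ?f x y \<partial>A d) \<partial>\<gamma>)"
    proof (intro nn_integral_cong nn_integral_cmult[symmetric])
      show "?f x \<in> borel_measurable (A d)" for x
        using measurable_ip[OF d, of j x] by measurable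
    qed
    also have "\<dots> = (\<integral>\<^sup>+y. (\<integral>\<^sup>+x. indicator (?E d) x * ?f x y \<partial>\<gamma>) \<partial>A d)"
    proof (rule Fubini'[symmetric])
      have "(\<lambda>p. indicator (?E d) (fst p) :: ennreal) \<in> borel_measurable (\<gamma> \<Otimes>\<^sub>M A d)"
        by (intro measurable_compose[OF measurable_fst] borel_measurable_indicator E)
      from borel_measurable_times_ennreal[OF this meas[OF d]]
      show "(\<lambda>(x, y). indicator (?E d) x * ?f x y) \<in> borel_measurable (\<gamma> \<Otimes>\<^sub>M A d)"
        by (simp add: case_prod_beta')
    qed
    also have "\<dots> \<le> (\<integral>\<^sup>+y. ennreal (exp (2 * \<theta>\<^sup>2 * \<rho>\<^sup>2)) * emeasure \<gamma> (?E d) \<partial>A d)"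
    proof (rule nn_integral_mono)
      fix y
      let ?w = "\<lambda>b. \<theta> * truncate m (2 * \<rho>) y b"
      have "(\<integral>\<^sup>+x. indicator (?E d) x * ?f x y \<partial>\<gamma>) =
          (\<integral>\<^sup>+x. indicator (?E d) x * ennreal (exp (\<Sum>b<m. ?w b * x (j, b))) \<partial>\<gamma>)"
        by (simp add: ip_def sum_distrib_left mult.assoc)
      also have "\<dots> = ennreal (exp ((\<Sum>b<m. (?w b)\<^sup>2) / 2)) * emeasure \<gamma> (?E d)"
        unfolding \<gamma>_def
      proof (rule nn_integral_row_exp)
        fix x x' :: "nat \<times> nat \<Rightarrow> real"
        assume x': "x' \<in> space (normals 1 ({..q} \<times> {..<m}))"
          and eq: "\<And>a b. a \<le> q \<Longrightarrow> b < m \<Longrightarrow> a \<noteq> j \<Longrightarrow> x' (a, b) = x (a, b)"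
          and x: "x \<in> d' -` {d} \<inter> space (normals 1 ({..q} \<times> {..<m}))"
        have "u (z l x') = u (z l x)" if "l \<in> {0<..q} - {j}" for l
          using that j by (intro u_cong) (auto simp: z_def eq)
        then have "d' x' = d' x" unfolding d'_def db_def by simp
        then show "x' \<in> d' -` {d} \<inter> space (normals 1 ({..q} \<times> {..<m}))" using x x' by auto
      qed (use j E[unfolded \<gamma>_def] in auto)
      \<comment> \<open>The truncation radius \<open>2 * \<rho>\<close> enters here and yields the
        constant in the exponent.\<close>
      also have "(\<Sum>b<m. (?w b)\<^sup>2) / 2 \<le> 2 * \<theta>\<^sup>2 * \<rho>\<^sup>2"
      proof -
        have "(\<Sum>b<m. (?w b)\<^sup>2) = \<theta>\<^sup>2 * (L2_set (truncate m (2 * \<rho>) y) {..<m})\<^sup>2"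
          unfolding L2_set_squared by (simp add: power_mult_distrib sum_distrib_left)
        also have "\<dots> \<le> \<theta>\<^sup>2 * (2 * \<rho>)\<^sup>2"
          using rho by (intro mult_left_mono power_mono L2_set_truncate) auto
        finally show ?thesis by (simp add: power_mult_distrib)
      qed
      finally show "(\<integral>\<^sup>+x. indicator (?E d) x * ?f x y \<partial>\<gamma>) \<le> ennreal (exp (2 * \<theta>\<^sup>2 * \<rho>\<^sup>2)) * emeasure \<gamma> (?E d)"
        by (simp add: mult_right_mono)
    qed
    also have "\<dots> = ennreal (exp (2 * \<theta>\<^sup>2 * \<rho>\<^sup>2)) * emeasure \<gamma> (?E d)"
      using P.emeasure_space_1 by simp
    finally show ?thesis .
  qed
  have RK: "?R \<subseteq> databases K" using dK by auto
  have indm: "(\<lambda>x. indicator (?E d) x * (\<integral>\<^sup>+y. ?f x y \<partial>A d)) \<in> borel_measurable \<gamma>" if "d \<in> ?R" for d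
    using that RK by (intro borel_measurable_times_ennreal borel_measurable_indicator E inner_meas) auto
  have V: "(\<lambda>x. \<integral>\<^sup>+y. ?f x y \<partial>A (d' x)) \<in> borel_measurable \<gamma>"
    using sep by (subst measurable_cong[OF sep]) (auto intro!: borel_measurable_sum indm)
  have "(\<integral>\<^sup>+x. (\<integral>\<^sup>+y. ?f x y \<partial>A (d' x)) \<partial>\<gamma>) =
      (\<integral>\<^sup>+x. (\<Sum>d\<in>?R. indicator (?E d) x * (\<integral>\<^sup>+y. ?f x y \<partial>A d)) \<partial>\<gamma>)"
    by (rule nn_integral_cong) (rule sep)
  also have "\<dots> = (\<Sum>d\<in>?R. \<integral>\<^sup>+x. indicator (?E d) x * (\<integral>\<^sup>+y. ?f x y \<partial>A d) \<partial>\<gamma>)"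
    by (rule nn_integral_sum) (rule indm)
  also have "\<dots> \<le> (\<Sum>d\<in>?R. ennreal (exp (2 * \<theta>\<^sup>2 * \<rho>\<^sup>2)) * emeasure \<gamma> (?E d))"
    using RK by (intro sum_mono bound) auto
  \<comment> \<open>The events for different values \<open>d\<close> are disjoint, so their
    probabilities add up to at most 1.\<close>
  also have "\<dots> = ennreal (exp (2 * \<theta>\<^sup>2 * \<rho>\<^sup>2)) * emeasure \<gamma> (\<Union>d\<in>?R. ?E d)"
    using R E by (subst sum_emeasure[symmetric]) (auto simp: sum_distrib_left disjoint_family_on_def)
  also have "\<dots> \<le> ennreal (exp (2 * \<theta>\<^sup>2 * \<rho>\<^sup>2)) * 1"
    by (intro mult_left_mono \<gamma>.emeasure_le_1) auto
  finally have le: "(\<integral>\<^sup>+x. ennreal (\<integral>y. exp (\<theta> * ip j y x) \<partial>A (d' x)) \<partial>\<gamma>) \<le> ennreal (exp (2 * \<theta>\<^sup>2 * \<rho>\<^sup>2))"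
    unfolding nn by simp
  have nonneg: "0 \<le> (\<integral>y. exp (\<theta> * ip j y x) \<partial>A (d' x))" for x
    by (rule Bochner_Integration.integral_nonneg) simp
  have "(\<lambda>x. enn2real (\<integral>\<^sup>+y. ?f x y \<partial>A (d' x))) \<in> borel_measurable \<gamma>"
    using V by measurable
  then have M: "(\<lambda>x. \<integral>y. exp (\<theta> * ip j y x) \<partial>A (d' x)) \<in> borel_measurable \<gamma>"
    unfolding nn by (simp add: nonneg)
  show i: "integrable \<gamma> (\<lambda>x. \<integral>y. exp (\<theta> * ip j y x) \<partial>A (d' x))"
    using le by (intro integrableI_nonneg M) (auto simp: nonneg intro: le_less_trans)
  have "ennreal (\<integral>x. (\<integral>y. exp (\<theta> * ip j y x) \<partial>A (d' x)) \<partial>\<gamma>) \<le> ennreal (exp (2 * \<theta>\<^sup>2 * \<rho>\<^sup>2))"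
    using le by (subst nn_integral_eq_integral[OF i, symmetric]) (auto simp: nonneg)
  then show "(\<integral>x. (\<integral>y. exp (\<theta> * ip j y x) \<partial>A (d' x)) \<partial>\<gamma>) \<le> exp (2 * \<theta>\<^sup>2 * \<rho>\<^sup>2)"
    by simp
qed

lemma soundness:
  assumes j: "j \<in> {0<..q}"
  defines "L \<equiv> real k * \<epsilon>"
  shows "score j \<le> \<rho> * (3 * sqrt L + 1 / sqrt L + 2 * (real k * \<delta> * exp L) * sqrt (real m))"
proof -
  interpret \<gamma>: prob_space \<gamma> by (rule prob_gamma)
  \<comment> \<open>These choices balance the exponents: \<open>exp L\<close> from group privacy,
    \<open>exp (- 3 * L)\<close> from the threshold and \<open>exp (2 * L)\<close> from the moment
    cancel. What remains is \<open>\<tau> + 1 / \<theta>\<close> and the term with \<delta>.\<close>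
  define \<theta> where "\<theta> = sqrt L / \<rho>"
  define \<tau> where "\<tau> = 3 * \<rho> * sqrt L"
  have L: "0 < L" using k eps by (simp add: L_def)
  have \<theta>: "0 < \<theta>" and \<tau>: "0 \<le> \<tau>" using L rho by (auto simp: \<theta>_def \<tau>_def)
  have \<theta>\<tau>: "- \<theta> * \<tau> = - 3 * L" "2 * \<theta>\<^sup>2 * \<rho>\<^sup>2 = 2 * L"
    using L rho by (simp_all add: \<theta>_def \<tau>_def power_divide)
  let ?W = "\<lambda>x. \<integral>y. exp (\<theta> * ip j y x) \<partial>A (db ({0<..q} - {j}) x)"
  let ?N = "\<lambda>x. L2_set (\<lambda>i. x (j, i)) {..<m}"
  let ?c = "exp L * (exp (- \<theta> * \<tau>) / \<theta>)"
  let ?e = "real k * \<delta> * exp L * (2 * \<rho>)"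
  have W: "integrable \<gamma> ?W" "(\<integral>x. ?W x \<partial>\<gamma>) \<le> exp (2 * L)"
    using independent_row_exp[OF j, of \<theta>] \<theta> unfolding \<theta>\<tau>(2) by auto
  have N: "integrable \<gamma> ?N" "(\<integral>x. ?N x \<partial>\<gamma>) \<le> sqrt (real m)"
    using expectation_normals_row_norm[of j q m] j m unfolding \<gamma>_def by auto
  have "score j = (\<integral>x. (\<Sum>i<m. mu (db {0<..q} x) i * x (j, i)) \<partial>\<gamma>)"
    unfolding score_def using j by (intro Bochner_Integration.integral_sum[symmetric] integrable_mu) auto
  also have "\<dots> \<le> (\<integral>x. \<tau> + ?c * ?W x + ?e * ?N x \<partial>\<gamma>)"
  proof (rule integral_mono)
    show "integrable \<gamma> (\<lambda>x. \<Sum>i<m. mu (db {0<..q} x) i * x (j, i))"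
      using j by (intro Bochner_Integration.integrable_sum integrable_mu) auto
    show "integrable \<gamma> (\<lambda>x. \<tau> + ?c * ?W x + ?e * ?N x)"
      by (intro Bochner_Integration.integrable_add integrable_mult_right W N \<gamma>.integrable_const)
    show "(\<Sum>i<m. mu (db {0<..q} x) i * x (j, i)) \<le> \<tau> + ?c * ?W x + ?e * ?N x" for x
      using score_pointwise[OF j \<theta> \<tau>, of x] unfolding L_def[symmetric] by (simp add: mult.assoc)
  qed
  also have "\<dots> = (\<integral>x. \<tau> \<partial>\<gamma>) + (\<integral>x. ?c * ?W x \<partial>\<gamma>) + (\<integral>x. ?e * ?N x \<partial>\<gamma>)"
    by (subst Bochner_Integration.integral_add;
        (intro Bochner_Integration.integrable_add integrable_mult_right W N \<gamma>.integrable_const)?)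
      (subst Bochner_Integration.integral_add;
        (intro Bochner_Integration.integrable_add integrable_mult_right W N \<gamma>.integrable_const)?; simp)
  also have "\<dots> = \<tau> + ?c * (\<integral>x. ?W x \<partial>\<gamma>) + ?e * (\<integral>x. ?N x \<partial>\<gamma>)"
    using \<gamma>.prob_space by simp
  also have "\<dots> \<le> \<tau> + ?c * exp (2 * L) + ?e * sqrt (real m)"
    using W(2) N(2) \<theta> rho delta by (intro add_mono mult_left_mono order_refl) auto
  also have "?c * exp (2 * L) = 1 / \<theta>"
    unfolding \<theta>\<tau>(1) by (simp add: exp_add[symmetric])
  also have "\<tau> + 1 / \<theta> + ?e * sqrt (real m) =
      \<rho> * (3 * sqrt L + 1 / sqrt L + 2 * (real k * \<delta> * exp L) * sqrt (real m))"
    unfolding \<tau>_def \<theta>_def by (simp add: algebra_simps)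
  finally show ?thesis .
qed

lemma fingerprinting_bound:
  defines "L \<equiv> real k * \<epsilon>"
  shows "\<rho> * (H / 2) - \<alpha> * sqrt (real m) \<le>
    \<rho> * (real q * (3 * sqrt L + 1 / sqrt L + 2 * (real k * \<delta> * exp L) * sqrt (real m)))"
proof -
  have "(\<Sum>j\<in>{0<..q}. score j) \<le>
      (\<Sum>j\<in>{0<..q}. \<rho> * (3 * sqrt L + 1 / sqrt L + 2 * (real k * \<delta> * exp L) * sqrt (real m)))"
    unfolding L_def by (intro sum_mono soundness)
  also have "\<dots> = \<rho> * (real q * (3 * sqrt L + 1 / sqrt L + 2 * (real k * \<delta> * exp L) * sqrt (real m)))"
    by simp
  finally show ?thesis using completeness by linarith
qed

end

section \<open>Sample complexity\<close>

text \<open>By Cauchy-Schwarz, replacing a point of \<open>K\<close> by a point of the net changes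
  the inner product by at most \<eta> times the norm of the Gaussian vector.\<close>

lemma (in fingerprinting) lstar_le:
  assumes net: "\<And>x. x \<in> K \<Longrightarrow> \<exists>t\<in>set ts. L2_set (\<lambda>i. x i - t i) {..<m} \<le> \<eta>" and \<eta>: "0 \<le> \<eta>"
    and pos: "0 < lstar m K"
  shows "lstar m K \<le> H + \<eta> * sqrt (real m)"
proof -
  interpret \<gamma>: prob_space \<gamma> by (rule prob_gamma)
  let ?f = "\<lambda>g. SUP x\<in>K. inner_Rn m x g"
  let ?ext = "\<lambda>x i. if i < m then x i else 0 :: real"
  let ?row = "\<lambda>x. \<lambda>i\<in>{..<m}. x (0 :: nat, i) :: real"
  let ?g = "\<lambda>x i. if i < m then x (0 :: nat, i) else 0 :: real"
  \<comment> \<open>Row 0 is a marginal of the matrix, reindexed along the injection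
    \<open>i \<mapsto> (0, i)\<close>.\<close>
  have row: "distr \<gamma> (normals 1 {..<m}) ?row = normals 1 {..<m}"
    using distr_PiM_reindex[of "{..q} \<times> {..<m}" "\<lambda>_. density lborel (\<lambda>t. ennreal (normal_density 0 1 t))"
        "\<lambda>i. (0, i)" "{..<m}"] prob_space_normal_density[of 1 0]
    unfolding \<gamma>_def normals_def by (auto simp: inj_on_def)
  have row_m: "?row \<in> measurable \<gamma> (normals 1 {..<m})"
    unfolding measurable_cong_sets[OF refl sets_normals]
    by (intro measurable_restrict measurable_gamma) auto
  have ext_m: "?ext \<in> measurable (normals 1 {..<m}) (borel_Rn m)"
  proof (rule measurable_borel_RnI)
    show "(\<lambda>x. ?ext x i) \<in> borel_measurable (normals 1 {..<m})" for i
      by (cases "i < m") (auto intro: measurable_normals_component)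
  qed auto
  have ext_row: "(\<lambda>x. ?ext (?row x)) = ?g" by (auto simp: fun_eq_iff)
  have g_m: "?g \<in> measurable \<gamma> (borel_Rn m)"
    using measurable_compose[OF row_m ext_m] unfolding ext_row .
  have gauss: "gaussian m 1 = distr \<gamma> (borel_Rn m) ?g"
  proof -
    have "gaussian m 1 = distr (distr \<gamma> (normals 1 {..<m}) ?row) (borel_Rn m) ?ext"
      unfolding row by (simp add: gaussian_def normals_def)
    also have "\<dots> = distr \<gamma> (borel_Rn m) ?g"
      by (subst distr_distr[OF ext_m row_m]) (simp add: comp_def ext_row)
    finally show ?thesis .
  qed
  \<comment> \<open>A function that is not integrable has integral 0, so positivity of
    \<open>lstar\<close> yields integrability, and with it measurability, of the supremum.\<close>
  have "integrable (gaussian m 1) ?f"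
    using pos not_integrable_integral_eq[of "gaussian m 1" ?f] unfolding lstar_def by fastforce
  then have int': "integrable (distr \<gamma> (borel_Rn m) ?g) ?f" unfolding gauss .
  have int: "integrable \<gamma> (\<lambda>x. ?f (?g x))" by (rule integrable_distr[OF g_m int'])
  have f_m: "?f \<in> borel_measurable (borel_Rn m)"
    using borel_measurable_integrable[OF int'] by simp
  note norm = expectation_normals_row_norm[of 0 q m, folded \<gamma>_def, OF _ m, simplified]
  let ?h = "\<lambda>x. inner_Rn m (u (\<lambda>i. x (0, i))) (\<lambda>i. x (0, i))"
  have h: "integrable \<gamma> ?h"
    unfolding inner_Rn_def by (intro Bochner_Integration.integrable_sum integrable_u_0) auto
  have "lstar m K = (\<integral>x. ?f (?g x) \<partial>\<gamma>)"
    unfolding lstar_def gauss by (rule integral_distr[OF g_m f_m])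
  also have "\<dots> \<le> (\<integral>x. ?h x + \<eta> * L2_set (\<lambda>i. x (0, i)) {..<m} \<partial>\<gamma>)"
  proof (rule integral_mono[OF int])
    show "integrable \<gamma> (\<lambda>x. ?h x + \<eta> * L2_set (\<lambda>i. x (0, i)) {..<m})"
      using h norm(1) by simp
    fix x :: "nat \<times> nat \<Rightarrow> real"
    show "?f (?g x) \<le> ?h x + \<eta> * L2_set (\<lambda>i. x (0, i)) {..<m}"
    proof (rule cSUP_least)
      show "K \<noteq> {}" using zero by blast
      fix y assume "y \<in> K"
      then obtain t where t: "t \<in> set ts" "L2_set (\<lambda>i. y i - t i) {..<m} \<le> \<eta>" using net by blast
      have "inner_Rn m y (?g x) = inner_Rn m t (\<lambda>i. x (0, i)) + inner_Rn m (\<lambda>i. y i - t i) (\<lambda>i. x (0, i))"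
        unfolding inner_Rn_def by (simp add: sum.distrib[symmetric] algebra_simps)
      also have "inner_Rn m t (\<lambda>i. x (0, i)) \<le> ?h x"
        unfolding u_def by (intro argmax_list ts t)
      also have "inner_Rn m (\<lambda>i. y i - t i) (\<lambda>i. x (0, i)) \<le>
          L2_set (\<lambda>i. y i - t i) {..<m} * L2_set (\<lambda>i. x (0, i)) {..<m}"
        by (rule inner_Rn_le_L2_set)
      also have "\<dots> \<le> \<eta> * L2_set (\<lambda>i. x (0, i)) {..<m}" by (intro mult_right_mono t) simp
      finally show "inner_Rn m y (?g x) \<le> ?h x + \<eta> * L2_set (\<lambda>i. x (0, i)) {..<m}" by simp
    qed
  qed
  also have "\<dots> = H + \<eta> * (\<integral>x. L2_set (\<lambda>i. x (0, i)) {..<m} \<partial>\<gamma>)"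
    unfolding H_def using h norm(1) by simp
  also have "\<dots> \<le> H + \<eta> * sqrt (real m)"
    using norm(2) \<eta> by (intro add_left_mono mult_left_mono) auto
  finally show ?thesis .
qed

text \<open>The distance involves finitely many coordinates, so its balls are open for pointwise
  convergence, the topology in which \<open>K\<close> is compact.\<close>

lemma compact_net:
  assumes K: "compactin (Euclidean_space m) K" and \<eta>: "0 < \<eta>"
  obtains T where "finite T" "T \<subseteq> K" "\<And>x. x \<in> K \<Longrightarrow> \<exists>t\<in>T. L2_set (\<lambda>i. x i - t i) {..<m} \<le> \<eta>"
proof -
  have "compact K"
    using K by (simp add: Euclidean_space_def compactin_subtopology euclidean_product_topology)
  let ?U = "\<lambda>t. {x. L2_set (\<lambda>i. x i - t i) {..<m} < \<eta>}"
  have "open (?U t)" for t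
    unfolding L2_set_def
    by (intro open_Collect_less continuous_intros continuous_on_product_coordinates)
  moreover have "K \<subseteq> (\<Union>t\<in>K. ?U t)" using \<eta> by (auto simp: L2_set_def)
  ultimately obtain T where T: "T \<subseteq> K" "finite T" "K \<subseteq> (\<Union>t\<in>T. ?U t)"
    by (rule compactE_image[OF \<open>compact K\<close>])
  have "\<exists>t\<in>T. L2_set (\<lambda>i. x i - t i) {..<m} \<le> \<eta>" if "x \<in> K" for x
    using T(3) that by (blast intro: less_imp_le)
  then show ?thesis using that[OF T(2,1)] by blast
qed

lemma zero_in_symmetric_convex:
  assumes "convex_Rn K" "symmetric_set K" "K \<noteq> {}"
  shows "(\<lambda>_. 0) \<in> K"
proof -
  obtain x where x: "x \<in> K" using assms by blast
  then have y: "(\<lambda>i. - x i) \<in> K" using assms(2) unfolding symmetric_set_def by blast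
  have "(\<lambda>i. (1 - 1/2) * x i + 1/2 * - x i) \<in> K"
    using assms(1)[unfolded convex_Rn_def, rule_format, OF x y, of "1/2"] by simp
  then show ?thesis by simp
qed


section \<open>The lower bound on the sample size\<close>

text \<open>Groups of size about \<open>\<kappa> * ln (1 / \<delta>) / \<epsilon>\<close> make group
  privacy amplify \<delta> by at most \<open>\<delta> powr (- \<kappa>)\<close>. The choice of
  \<kappa> gives \<open>(1 - \<kappa>) * (1 + c\<^sub>d) = 1 + c\<^sub>d / 2\<close>, so that
  \<open>n\<close> times the amplified \<delta> is at most \<open>n powr (- c\<^sub>d / 2)\<close>.
  The constant \<open>C\<^sub>1\<close> bounds \<open>k * q / (\<alpha> * n)\<close>.\<close>

lemma sample_size_lower_bound:
  fixes c\<^sub>l c\<^sub>e c\<^sub>d \<epsilon> \<alpha> \<delta> :: real and n m :: nat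
  defines "\<kappa> \<equiv> c\<^sub>d / (2 * (1 + c\<^sub>d))"
  defines "C\<^sub>1 \<equiv> 8 / c\<^sub>l + \<kappa> * c\<^sub>e"
  assumes c: "0 < c\<^sub>l" "0 < c\<^sub>e" "0 < c\<^sub>d"
    and eps: "0 < \<epsilon>" "\<epsilon> \<le> \<kappa> / 4" "\<epsilon> \<le> 1 / (2 * c\<^sub>e * (16 / c\<^sub>l) powr (2 / c\<^sub>d))"
    and alpha: "0 < \<alpha>" "\<alpha> \<le> 1" "\<alpha> * C\<^sub>1 \<le> 1" and delta: "0 < \<delta>" and m: "1 \<le> m"
    and K: "convex_body m K" "symmetric_set K" "K \<subseteq> unit_ball m"
    and width: "c\<^sub>l * sqrt (real m) \<le> lstar m K"
    and range: "delta_range c\<^sub>e c\<^sub>d \<epsilon> \<alpha> n \<delta>"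
    and A: "diff_private m K \<epsilon> \<delta> A" "err m K A n \<le> ennreal \<alpha>"
  shows "c\<^sub>l / (8 * C\<^sub>1 * (3 + 4 / \<kappa>) * sqrt (2 / \<kappa>)) * (sqrt (real m * ln (1 / \<delta>)) / (\<alpha> * \<epsilon>)) \<le> real n"
proof -
  define l where "l = ln (1 / \<delta>)"
  have n: "2 \<le> n" and r1: "2 powr (- (c\<^sub>e * (\<alpha> * \<epsilon>) * real n)) \<le> \<delta>" and r2: "\<delta> \<le> 1 / real n powr (1 + c\<^sub>d)"
    using range by (auto simp: delta_range_def)
  have \<kappa>: "0 < \<kappa>" "\<kappa> \<le> 1/2" using c by (auto simp: \<kappa>_def field_simps)
  have C1: "0 < C\<^sub>1" using c \<kappa> by (simp add: C\<^sub>1_def add_pos_pos)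
  have dl: "\<delta> = exp (- l)" using delta by (simp add: l_def ln_div)
  have l_ln: "(1 + c\<^sub>d) * ln (real n) \<le> l"
  proof -
    have "exp (- l) \<le> exp (- ((1 + c\<^sub>d) * ln (real n)))"
      using r2 n unfolding dl by (simp add: powr_def exp_minus divide_inverse)
    then show ?thesis by simp
  qed
  have ln2: "1 / 2 \<le> ln (2 :: real)" "ln 2 \<le> (1 :: real)" using ln2_ge_two_thirds ln_2_less_1 by linarith+
  have "ln 2 \<le> ln (real n)" using n by simp
  moreover have "1 * ln (real n) \<le> (1 + c\<^sub>d) * ln (real n)" using c n by (intro mult_right_mono) auto
  ultimately have l: "1 / 2 \<le> l" using l_ln ln2 by linarith
  have l_upper: "l \<le> c\<^sub>e * \<alpha> * \<epsilon> * real n"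
  proof -
    have "exp (- (c\<^sub>e * (\<alpha> * \<epsilon>) * real n) * ln 2) \<le> exp (- l)"
      using r1 unfolding dl by (simp add: powr_def)
    then have "l \<le> c\<^sub>e * (\<alpha> * \<epsilon>) * real n * ln 2" by simp
    also have "\<dots> \<le> c\<^sub>e * (\<alpha> * \<epsilon>) * real n * 1" using ln2 c alpha eps by (intro mult_left_mono) auto
    finally show ?thesis by (simp add: mult_ac)
  qed

  define k where "k = nat \<lfloor>\<kappa> * l / \<epsilon>\<rfloor>"
  \<comment> \<open>With this bound, rounding down in \<open>k\<close> costs at most a factor
    2.\<close>
  have "2 \<le> \<kappa> * l / \<epsilon>"
  proof -
    have "2 * \<epsilon> \<le> \<kappa> * (1/2)" using eps by simp
    also have "\<dots> \<le> \<kappa> * l" using \<kappa> l by (intro mult_left_mono) auto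
    finally show ?thesis using eps by (simp add: field_simps)
  qed
  then have k: "1 \<le> k" "real k \<le> \<kappa> * l / \<epsilon>" "\<kappa> * l / \<epsilon> \<le> 2 * real k"
    unfolding k_def by linarith+
  \<comment> \<open>This uses the lower end of the range of \<delta>: a single group is at most a
    constant multiple of \<open>\<alpha> * n\<close>, so rounding \<open>q\<close> up keeps
    \<open>k * q\<close> of that order.\<close>
  have k_upper: "real k \<le> \<kappa> * c\<^sub>e * (\<alpha> * real n)"
  proof -
    have "\<kappa> * l \<le> \<kappa> * (c\<^sub>e * \<alpha> * \<epsilon> * real n)" using l_upper \<kappa> by (intro mult_left_mono) auto
    then have "\<kappa> * l / \<epsilon> \<le> \<kappa> * c\<^sub>e * (\<alpha> * real n)" using eps by (simp add: field_simps)
    then show ?thesis using k by linarith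
  qed
  define L where "L = real k * \<epsilon>"
  have L: "\<kappa> / 4 \<le> L" "L \<le> \<kappa> * l"
  proof -
    have "\<kappa> * l \<le> 2 * L" using k eps by (simp add: L_def field_simps)
    moreover have "\<kappa> * (1/2) \<le> \<kappa> * l" using \<kappa> l by (intro mult_left_mono) auto
    ultimately show "\<kappa> / 4 \<le> L" by linarith
    show "L \<le> \<kappa> * l" using k eps by (simp add: L_def field_simps)
  qed
  have L0: "0 < L" using L \<kappa> by linarith

  \<comment> \<open>The constant 8 ensures \<open>\<alpha> \<le> \<rho> * (c\<^sub>l / 8)\<close>,
    so inaccuracy consumes only part of the correlation.\<close>
  define q where "q = nat \<lceil>8 * \<alpha> * real n / (c\<^sub>l * real k)\<rceil>"
  have "0 < 8 * \<alpha> * real n / (c\<^sub>l * real k)" using alpha n c k by (intro divide_pos_pos mult_pos_pos) auto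
  then have q: "1 \<le> q" "8 * \<alpha> * real n / (c\<^sub>l * real k) \<le> real q" "real q \<le> 8 * \<alpha> * real n / (c\<^sub>l * real k) + 1"
    unfolding q_def by linarith+
  have kq1: "8 * \<alpha> * real n / c\<^sub>l \<le> real k * real q"
    using q(2) c k by (simp add: field_simps)
  have kq2: "real k * real q \<le> C\<^sub>1 * (\<alpha> * real n)"
  proof -
    have "real k * real q \<le> real k * (8 * \<alpha> * real n / (c\<^sub>l * real k) + 1)"
      using q(3) by (intro mult_left_mono) auto
    also have "\<dots> = 8 / c\<^sub>l * (\<alpha> * real n) + real k" using c k by (simp add: field_simps)
    also have "\<dots> \<le> C\<^sub>1 * (\<alpha> * real n)" using k_upper by (simp add: C\<^sub>1_def algebra_simps)
    finally show ?thesis .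
  qed
  have "C\<^sub>1 * (\<alpha> * real n) \<le> 1 * real n"
    using alpha n by (simp add: mult.assoc[symmetric] mult.commute[of C\<^sub>1] mult_right_mono)
  then have kqn': "real (k * q) \<le> real n" using kq2 by simp
  then have kqn: "k * q \<le> n" by (simp only: of_nat_le_iff)

  \<comment> \<open>A small \<epsilon> forces a large \<open>n\<close>, since \<open>l\<close> is at
    least 1/2 and at most \<open>c\<^sub>e * \<alpha> * \<epsilon> * n\<close>.\<close>
  have n0: "(16 / c\<^sub>l) powr (2 / c\<^sub>d) \<le> real n"
  proof -
    let ?n0 = "(16 / c\<^sub>l) powr (2 / c\<^sub>d)"
    have "1 / 2 \<le> c\<^sub>e * \<alpha> * \<epsilon> * real n" using l l_upper by linarith
    also have "\<dots> \<le> c\<^sub>e * 1 * (1 / (2 * c\<^sub>e * ?n0)) * real n"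
      using c alpha eps by (intro mult_right_mono mult_mono) auto
    also have "\<dots> = real n / (2 * ?n0)" using c by (simp add: field_simps)
    finally show ?thesis using c by (simp add: field_simps)
  qed
  \<comment> \<open>This uses the upper end of the range of \<delta>; the threshold in
    \<open>n0\<close> is chosen so that \<open>n powr (- c\<^sub>d / 2)\<close> is at most
    \<open>c\<^sub>l / 16\<close>.\<close>
  have small: "2 * (real n * \<delta> * exp L) \<le> c\<^sub>l / 8"
  proof -
    have "ln ((16 / c\<^sub>l) powr (2 / c\<^sub>d)) \<le> ln (real n)"
      using n0 c n by (intro ln_mono) auto
    then have 1: "ln (16 / c\<^sub>l) \<le> c\<^sub>d / 2 * ln (real n)" using c by (simp add: ln_powr field_simps)
    have "(1 - \<kappa>) * ((1 + c\<^sub>d) * ln (real n)) \<le> (1 - \<kappa>) * l"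
      using l_ln \<kappa> by (intro mult_left_mono) auto
    moreover have "(1 - \<kappa>) * (1 + c\<^sub>d) = 1 + c\<^sub>d / 2" using c by (simp add: \<kappa>_def field_simps)
    ultimately have "(1 + c\<^sub>d / 2) * ln (real n) \<le> (1 - \<kappa>) * l" by (simp add: mult.assoc[symmetric])
    then have "ln (real n) - l + L \<le> - (c\<^sub>d / 2 * ln (real n))" using L by (simp add: algebra_simps)
    also have "\<dots> \<le> - ln (16 / c\<^sub>l)" using 1 by linarith
    also have "\<dots> = ln (c\<^sub>l / 16)" using c by (simp add: ln_div)
    finally have "exp (ln (real n) - l + L) \<le> exp (ln (c\<^sub>l / 16))" by (rule exp_le_cancel_iff[THEN iffD2])
    then have "exp (ln (real n) - l + L) \<le> c\<^sub>l / 16" using c by simp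
    moreover have "exp (ln (real n) - l + L) = real n * \<delta> * exp L"
      unfolding dl using n by (simp add: exp_add exp_diff exp_minus divide_inverse)
    ultimately show ?thesis by simp
  qed

  have KR: "compactin (Euclidean_space m) K" "convex_Rn K" "K \<noteq> {}"
    using K interior_of_subset[of "Euclidean_space m" K] by (auto simp: convex_body_def)
  have zero: "(\<lambda>_. 0) \<in> K" by (rule zero_in_symmetric_convex) (use KR K in auto)
  obtain T where T: "finite T" "T \<subseteq> K" "\<And>x. x \<in> K \<Longrightarrow> \<exists>t\<in>T. L2_set (\<lambda>i. x i - t i) {..<m} \<le> c\<^sub>l / 4"
    using compact_net[OF KR(1), of "c\<^sub>l / 4"] c by auto
  obtain ts where set_ts: "set ts = T" using finite_list[OF T(1)] by blast
  have "T \<noteq> {}" using T(3)[OF zero] by auto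
  interpret F: fingerprinting m n k q K \<epsilon> \<delta> \<alpha> A ts
    by standard (use m k q kqn eps delta alpha K zero set_ts T \<open>T \<noteq> {}\<close> A in auto)

  let ?s = "sqrt (real m)"
  have s: "1 \<le> ?s" using m by simp
  have "0 < c\<^sub>l * ?s" using c s by simp
  then have "lstar m K \<le> F.H + c\<^sub>l / 4 * ?s"
    using width T(3) c by (intro F.lstar_le) (auto simp: set_ts)
  then have H: "3 / 4 * (c\<^sub>l * ?s) \<le> F.H" using width by simp
  have \<alpha>\<rho>: "\<alpha> \<le> F.\<rho> * (c\<^sub>l / 8)"
    using kq1 n c by (simp add: F.\<rho>_def field_simps)
  \<comment> \<open>In units of \<open>\<rho> * c\<^sub>l * sqrt m\<close>: the net leaves 3/8 of
    correlation, inaccuracy takes 1/8, and the term with \<delta> will take another 1/8.\<close>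
  have "F.\<rho> * (3 / 8 * (c\<^sub>l * ?s)) \<le> F.\<rho> * (F.H / 2)" using H F.rho by (intro mult_left_mono) auto
  moreover have "\<alpha> * ?s \<le> F.\<rho> * (c\<^sub>l / 8) * ?s" using \<alpha>\<rho> by (intro mult_right_mono) auto
  ultimately have "F.\<rho> * (c\<^sub>l / 4 * ?s) \<le> F.\<rho> * (F.H / 2) - \<alpha> * ?s" by (simp add: algebra_simps)
  also have "\<dots> \<le> F.\<rho> * (real q * (3 * sqrt L + 1 / sqrt L + 2 * (real k * \<delta> * exp L) * ?s))"
    using F.fingerprinting_bound unfolding L_def .
  finally have "c\<^sub>l / 4 * ?s \<le> real q * (3 * sqrt L + 1 / sqrt L + 2 * (real k * \<delta> * exp L) * ?s)"
    by (simp only: mult_le_cancel_left_pos[OF F.rho])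
  also have "\<dots> = real q * (3 * sqrt L + 1 / sqrt L) + 2 * (real (k * q) * \<delta> * exp L) * ?s"
    by (simp add: algebra_simps)
  also have "\<dots> \<le> real q * (3 * sqrt L + 1 / sqrt L) + 2 * (real n * \<delta> * exp L) * ?s"
    using delta by (intro add_left_mono mult_right_mono mult_left_mono kqn') auto
  also have "\<dots> \<le> real q * (3 * sqrt L + 1 / sqrt L) + c\<^sub>l / 8 * ?s"
    using small by (intro add_left_mono mult_right_mono) auto
  finally have main: "c\<^sub>l / 8 * ?s \<le> real q * (3 * sqrt L + 1 / sqrt L)" by linarith
  \<comment> \<open>Since \<open>L\<close> is bounded below by \<open>\<kappa> / 4\<close>, the term
    \<open>sqrt L\<close> dominates.\<close>
  have "1 / sqrt L \<le> 4 / \<kappa> * sqrt L"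
  proof -
    have "1 \<le> 4 / \<kappa> * L" using L \<kappa> by (simp add: field_simps)
    then have "1 / sqrt L \<le> 4 / \<kappa> * L / sqrt L" using L0 by (intro divide_right_mono) auto
    also have "4 / \<kappa> * L / sqrt L = 4 / \<kappa> * (L / sqrt L)" by simp
    also have "L / sqrt L = sqrt L" using L0 by (simp add: real_div_sqrt)
    finally show ?thesis .
  qed
  then have "real q * (3 * sqrt L + 1 / sqrt L) \<le> real q * ((3 + 4 / \<kappa>) * sqrt L)"
    by (intro mult_left_mono) (auto simp: algebra_simps)
  with main have "c\<^sub>l / 8 * ?s \<le> real q * ((3 + 4 / \<kappa>) * sqrt L)" by linarith
  \<comment> \<open>Multiplying by \<open>sqrt L\<close> turns \<open>q * sqrt L\<close> into
    \<open>q * L = \<epsilon> * k * q\<close>, which \<open>kq2\<close> bounds by a multiple of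
    \<open>\<epsilon> * \<alpha> * n\<close>.\<close>
  then have "c\<^sub>l / 8 * ?s * sqrt L \<le> real q * ((3 + 4 / \<kappa>) * sqrt L) * sqrt L"
    by (intro mult_right_mono) (use L0 in auto)
  also have "\<dots> = (3 + 4 / \<kappa>) * \<epsilon> * (real k * real q)"
    using L0 by (simp add: L_def mult_ac)
  also have "\<dots> \<le> (3 + 4 / \<kappa>) * \<epsilon> * (C\<^sub>1 * (\<alpha> * real n))"
    using \<kappa> eps kq2 by (intro mult_left_mono) auto
  finally have 1: "c\<^sub>l / 8 * ?s * sqrt L \<le> (3 + 4 / \<kappa>) * \<epsilon> * (C\<^sub>1 * (\<alpha> * real n))" .
  have "sqrt l \<le> sqrt (2 / \<kappa>) * sqrt L"
  proof -
    have "\<kappa> * l \<le> 2 * L" using k eps by (simp add: L_def field_simps)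
    then have "l \<le> 2 / \<kappa> * L" using \<kappa> by (simp add: field_simps)
    then show ?thesis unfolding real_sqrt_mult[symmetric] by simp
  qed
  then have "c\<^sub>l / 8 * ?s * sqrt l \<le> c\<^sub>l / 8 * ?s * (sqrt (2 / \<kappa>) * sqrt L)"
    using c by (intro mult_left_mono) auto
  also have "\<dots> \<le> sqrt (2 / \<kappa>) * ((3 + 4 / \<kappa>) * \<epsilon> * (C\<^sub>1 * (\<alpha> * real n)))"
    using mult_left_mono[OF 1, of "sqrt (2 / \<kappa>)"] \<kappa> by (simp add: mult_ac)
  finally have fin: "c\<^sub>l / 8 * (?s * sqrt l) \<le> C\<^sub>1 * (3 + 4 / \<kappa>) * sqrt (2 / \<kappa>) * (\<alpha> * \<epsilon>) * real n"
    by (simp add: mult_ac)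
  define Z where "Z = C\<^sub>1 * (3 + 4 / \<kappa>) * sqrt (2 / \<kappa>)"
  have Z: "0 < Z" using C1 \<kappa> by (simp add: Z_def add_pos_pos)
  have ae: "0 < \<alpha> * \<epsilon>" using alpha eps by simp
  have "c\<^sub>l / (8 * Z) * (?s * sqrt l / (\<alpha> * \<epsilon>)) = c\<^sub>l / 8 * (?s * sqrt l) / (Z * (\<alpha> * \<epsilon>))" by simp
  also have "\<dots> \<le> Z * (\<alpha> * \<epsilon>) * real n / (Z * (\<alpha> * \<epsilon>))"
    using fin Z ae unfolding Z_def[symmetric] by (intro divide_right_mono) auto
  also have "\<dots> = real n" using Z alpha eps by simp
  finally show ?thesis by (simp add: Z_def l_def real_sqrt_mult mult.assoc)
qed

section \<open>Matching bounds and optimality of the Gaussian mechanism\<close>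

theorem theorem7:
  "\<forall>c\<^sub>l>0. \<forall>c\<^sub>e>0. \<forall>c\<^sub>d>0. \<exists>\<epsilon>\<^sub>0>0. \<exists>\<alpha>\<^sub>0>0. \<exists>c>0. \<exists>C>0.
    \<forall>(\<epsilon>::real) (\<alpha>::real) (\<delta>::real) (m::nat) (K::(nat \<Rightarrow> real) set).
      0 < \<epsilon> \<and> \<epsilon> < \<epsilon>\<^sub>0 \<and> 0 < \<alpha> \<and> \<alpha> \<le> \<alpha>\<^sub>0 \<and> 0 < \<delta> \<and> 1 \<le> m \<and>
      convex_body m K \<and> symmetric_set K \<and> K \<subseteq> unit_ball m \<and>
      c\<^sub>l * sqrt (real m) \<le> lstar m K \<and>
      (\<forall>n. sample_complexity m K \<epsilon> \<delta> \<alpha> = enat n \<longrightarrow> delta_range c\<^sub>e c\<^sub>d \<epsilon> \<alpha> n \<delta>) \<longrightarrow>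
      (\<exists>n. sample_complexity m K \<epsilon> \<delta> \<alpha> = enat n \<and>
         c * (sqrt (real m * ln (1 / \<delta>)) / (\<alpha> * \<epsilon>)) \<le> real n \<and>
         real n \<le> C * (sqrt (real m * ln (1 / \<delta>)) / (\<alpha> * \<epsilon>)) \<and>
         (\<exists>N. samp m K (gaussian_mechanism m (noise_level \<epsilon> \<delta>)) \<alpha> = enat N \<and>
            real N \<le> C * real n \<and>
            diff_private m K \<epsilon> \<delta> (gaussian_mechanism_public m (noise_level \<epsilon> \<delta>) N) \<and>
            err m K (gaussian_mechanism_public m (noise_level \<epsilon> \<delta>) N) N \<le> ennreal \<alpha>))"
proof (intro allI impI)
  fix c\<^sub>l c\<^sub>e c\<^sub>d :: real
  assume c: "0 < c\<^sub>l" "0 < c\<^sub>e" "0 < c\<^sub>d"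
  define \<kappa> where "\<kappa> = c\<^sub>d / (2 * (1 + c\<^sub>d))"
  define C\<^sub>1 where "C\<^sub>1 = 8 / c\<^sub>l + \<kappa> * c\<^sub>e"
  define n\<^sub>0 where "n\<^sub>0 = (16 / c\<^sub>l) powr (2 / c\<^sub>d)"
  \<comment> \<open>The bound 1 serves the Gaussian mechanism; the other two serve the group size
    and the threshold for \<open>n\<close> in the lower bound.\<close>
  define \<epsilon>\<^sub>0 where "\<epsilon>\<^sub>0 = min 1 (min (\<kappa> / 4) (1 / (2 * c\<^sub>e * n\<^sub>0)))"
  define \<alpha>\<^sub>0 where "\<alpha>\<^sub>0 = min 1 (1 / C\<^sub>1)"
  define c' where "c' = c\<^sub>l / (8 * C\<^sub>1 * (3 + 4 / \<kappa>) * sqrt (2 / \<kappa>))"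
  \<comment> \<open>With \<open>X\<close> the claimed order of growth, the Gaussian mechanism needs
    at most \<open>5 * X\<close> points, and \<open>X\<close> is at most
    \<open>n / c'\<close>.\<close>
  define C where "C = max 5 (5 / c')"
  have \<kappa>: "0 < \<kappa>" using c by (simp add: \<kappa>_def)
  have C1: "0 < C\<^sub>1" using c \<kappa> by (simp add: C\<^sub>1_def add_pos_pos)
  have n0: "0 < n\<^sub>0" using c by (simp add: n\<^sub>0_def)
  have c': "0 < c'" using c C1 \<kappa> by (simp add: c'_def add_pos_pos)
  have pos: "0 < \<epsilon>\<^sub>0" "0 < \<alpha>\<^sub>0" "0 < C"
    using \<kappa> C1 n0 c by (auto simp: \<epsilon>\<^sub>0_def \<alpha>\<^sub>0_def C_def)
  show "\<exists>\<epsilon>\<^sub>0>0. \<exists>\<alpha>\<^sub>0>0. \<exists>c>0. \<exists>C>0.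
    \<forall>(\<epsilon>::real) (\<alpha>::real) (\<delta>::real) (m::nat) (K::(nat \<Rightarrow> real) set).
      0 < \<epsilon> \<and> \<epsilon> < \<epsilon>\<^sub>0 \<and> 0 < \<alpha> \<and> \<alpha> \<le> \<alpha>\<^sub>0 \<and> 0 < \<delta> \<and> 1 \<le> m \<and>
      convex_body m K \<and> symmetric_set K \<and> K \<subseteq> unit_ball m \<and>
      c\<^sub>l * sqrt (real m) \<le> lstar m K \<and>
      (\<forall>n. sample_complexity m K \<epsilon> \<delta> \<alpha> = enat n \<longrightarrow> delta_range c\<^sub>e c\<^sub>d \<epsilon> \<alpha> n \<delta>) \<longrightarrow>
      (\<exists>n. sample_complexity m K \<epsilon> \<delta> \<alpha> = enat n \<and>
         c * (sqrt (real m * ln (1 / \<delta>)) / (\<alpha> * \<epsilon>)) \<le> real n \<and>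
         real n \<le> C * (sqrt (real m * ln (1 / \<delta>)) / (\<alpha> * \<epsilon>)) \<and>
         (\<exists>N. samp m K (gaussian_mechanism m (noise_level \<epsilon> \<delta>)) \<alpha> = enat N \<and>
            real N \<le> C * real n \<and>
            diff_private m K \<epsilon> \<delta> (gaussian_mechanism_public m (noise_level \<epsilon> \<delta>) N) \<and>
            err m K (gaussian_mechanism_public m (noise_level \<epsilon> \<delta>) N) N \<le> ennreal \<alpha>))"
  proof (rule exI[of _ \<epsilon>\<^sub>0], intro conjI pos, rule exI[of _ \<alpha>\<^sub>0], intro conjI pos,
      rule exI[of _ c'], intro conjI c', rule exI[of _ C], intro conjI pos allI impI)
    fix \<epsilon> \<alpha> \<delta> :: real and m :: nat and K :: "(nat \<Rightarrow> real) set"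
    assume H: "0 < \<epsilon> \<and> \<epsilon> < \<epsilon>\<^sub>0 \<and> 0 < \<alpha> \<and> \<alpha> \<le> \<alpha>\<^sub>0 \<and> 0 < \<delta> \<and> 1 \<le> m \<and>
      convex_body m K \<and> symmetric_set K \<and> K \<subseteq> unit_ball m \<and>
      c\<^sub>l * sqrt (real m) \<le> lstar m K \<and>
      (\<forall>n. sample_complexity m K \<epsilon> \<delta> \<alpha> = enat n \<longrightarrow> delta_range c\<^sub>e c\<^sub>d \<epsilon> \<alpha> n \<delta>)"
    have \<epsilon>: "0 < \<epsilon>" "\<epsilon> \<le> 1" "\<epsilon> \<le> \<kappa> / 4" "\<epsilon> \<le> 1 / (2 * c\<^sub>e * n\<^sub>0)" using H by (auto simp: \<epsilon>\<^sub>0_def)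
    have \<alpha>: "0 < \<alpha>" "\<alpha> \<le> 1" "\<alpha> \<le> 1 / C\<^sub>1" using H by (auto simp: \<alpha>\<^sub>0_def)
    have \<delta>: "0 < \<delta>" and m: "1 \<le> m" and K: "convex_body m K" "symmetric_set K" "K \<subseteq> unit_ball m"
      and width: "c\<^sub>l * sqrt (real m) \<le> lstar m K" using H by auto
    have Kne: "K \<noteq> {}" using K(1) interior_of_subset[of "Euclidean_space m" K] by (auto simp: convex_body_def)
    have KR: "K \<subseteq> Rn m" using K(3) unit_ball_Rn[of m] by blast
    \<comment> \<open>Finiteness comes first; only then does the hypothesis on \<delta>
      apply.\<close>
    obtain n where n: "sample_complexity m K \<epsilon> \<delta> \<alpha> = enat n"
      using sample_complexity_finite[OF K(3) Kne \<epsilon>(1,2) \<delta> \<alpha>(1)] .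
    then have range: "delta_range c\<^sub>e c\<^sub>d \<epsilon> \<alpha> n \<delta>" using H by blast
    define X where "X = sqrt (real m * ln (1 / \<delta>)) / (\<alpha> * \<epsilon>)"
    obtain A where A: "diff_private m K \<epsilon> \<delta> A" "err m K A n \<le> ennreal \<alpha>"
      using sample_complexity_enat[OF n] by metis
    have lower: "c' * X \<le> real n"
      unfolding c'_def X_def C\<^sub>1_def \<kappa>_def
      by (rule sample_size_lower_bound[OF c \<epsilon>(1) \<epsilon>(3)[unfolded \<kappa>_def] \<epsilon>(4)[unfolded n\<^sub>0_def] \<alpha>(1,2) _ \<delta> m K width range A])
        (use \<alpha>(3) C1 in \<open>simp add: C\<^sub>1_def \<kappa>_def field_simps\<close>)

    \<comment> \<open>The condition \<open>2 \<le> n\<close> in \<open>delta_range\<close> gives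
      this bound, under which the noise level is private.\<close>
    have \<delta>2: "\<delta> \<le> 1 / 2"
    proof -
      have "2 \<le> n" and d: "\<delta> \<le> 1 / real n powr (1 + c\<^sub>d)" using range by (auto simp: delta_range_def)
      then have "2 powr 1 \<le> real n powr 1" by simp
      also have "\<dots> \<le> real n powr (1 + c\<^sub>d)" using \<open>2 \<le> n\<close> c by (intro powr_mono) auto
      finally have "1 / real n powr (1 + c\<^sub>d) \<le> 1 / 2" using \<open>2 \<le> n\<close> by (intro divide_left_mono) auto
      then show ?thesis using d by linarith
    qed
    define s where "s = noise_level \<epsilon> \<delta>"
    have s: "0 < s" unfolding s_def by (rule noise_level_bound(1)[OF \<epsilon>(1,2) \<delta> \<delta>2])
    obtain N where N: "samp m K (gaussian_mechanism m s) \<alpha> = enat N" "1 \<le> N"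
        "err m K (gaussian_mechanism m s) N \<le> ennreal \<alpha>" "real N \<le> s * sqrt (real m) / \<alpha> + 1"
      using gaussian_mechanism_samp[OF s KR Kne \<alpha>(1)] .
    have priv: "diff_private m K \<epsilon> \<delta> (gaussian_mechanism_public m s N)"
      unfolding s_def by (rule gaussian_mechanism_public_private[OF K(3) \<epsilon>(1,2) \<delta> \<delta>2])
    have acc: "err m K (gaussian_mechanism_public m s N) N \<le> ennreal \<alpha>"
      unfolding err_gaussian_mechanism_public by (rule N(3))
    have "enat n \<le> enat N" using sample_complexity_le[OF priv N(2) acc] unfolding n .
    then have nN: "real n \<le> real N" by simp

    define r where "r = sqrt (ln (1 / \<delta>))"
    have "ln 2 \<le> ln (1 / \<delta>)" using \<delta> \<delta>2 by (intro ln_mono) (auto simp: field_simps)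
    then have l: "1 / 2 \<le> ln (1 / \<delta>)" using ln2_ge_two_thirds by linarith
    have r: "1 / 2 \<le> r"
      unfolding r_def using l by (intro real_le_rsqrt) (simp add: power2_eq_square)
    have X: "X = r * sqrt (real m) / (\<alpha> * \<epsilon>)" by (simp add: X_def r_def real_sqrt_mult mult.commute)
    have "s = (0.5 * sqrt \<epsilon> + sqrt 2 * r) / \<epsilon>" by (simp add: s_def noise_level_def r_def real_sqrt_mult)
    also have "\<dots> \<le> (r + 2 * r) / \<epsilon>"
    proof (intro divide_right_mono add_mono mult_right_mono)
      have "sqrt \<epsilon> \<le> 1" using \<epsilon> by simp
      then show "0.5 * sqrt \<epsilon> \<le> r" using r by linarith
      show "sqrt 2 \<le> (2 :: real)" by (rule real_le_lsqrt) auto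
    qed (use r \<epsilon> in auto)
    finally have "s * (sqrt (real m) / \<alpha>) \<le> 3 * r / \<epsilon> * (sqrt (real m) / \<alpha>)"
      using \<alpha> by (intro mult_right_mono) auto
    then have 1: "s * sqrt (real m) / \<alpha> \<le> 3 * X" by (simp add: X mult_ac)
    \<comment> \<open>As \<open>X\<close> is at least 1/2, the \<open>+ 1\<close> from rounding up
      the sample size is absorbed in \<open>2 * X\<close>.\<close>
    have "1 / 2 * 1 / 1 \<le> r * sqrt (real m) / (\<alpha> * \<epsilon>)"
      using r m \<alpha> \<epsilon> by (intro frac_le mult_mono mult_le_one) auto
    then have 2: "1 \<le> 2 * X" unfolding X[symmetric] by simp
    have NX: "real N \<le> 5 * X" using N(4) 1 2 by linarith
    have X0: "0 \<le> X" using 2 by linarith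
    have "5 * X = 5 / c' * (c' * X)" using c' by simp
    also have "\<dots> \<le> 5 / c' * real n" using lower c' by (intro mult_left_mono) auto
    also have "\<dots> \<le> C * real n" by (intro mult_right_mono) (auto simp: C_def)
    finally have NC: "real N \<le> C * real n" using NX by linarith
    have "5 * X \<le> C * X" using X0 by (intro mult_right_mono) (auto simp: C_def)
    then have nC: "real n \<le> C * X" using NX nN by linarith
    show "\<exists>n. sample_complexity m K \<epsilon> \<delta> \<alpha> = enat n \<and>
         c' * (sqrt (real m * ln (1 / \<delta>)) / (\<alpha> * \<epsilon>)) \<le> real n \<and>
         real n \<le> C * (sqrt (real m * ln (1 / \<delta>)) / (\<alpha> * \<epsilon>)) \<and>
         (\<exists>N. samp m K (gaussian_mechanism m (noise_level \<epsilon> \<delta>)) \<alpha> = enat N \<and>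
            real N \<le> C * real n \<and>
            diff_private m K \<epsilon> \<delta> (gaussian_mechanism_public m (noise_level \<epsilon> \<delta>) N) \<and>
            err m K (gaussian_mechanism_public m (noise_level \<epsilon> \<delta>) N) N \<le> ennreal \<alpha>)"
      using n lower nC N(1) NC priv acc unfolding X_def s_def by blast
  qed
qed

end
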